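(* Consider, for each $n$, non-random strata $s=1,\dots,S$ of sizes $n_s\ge1$ with $n=\sum_{s=1}^S n_s$, and the model $$Y_{si}=\alpha_s+D_{si}\beta+r_{Csi},\quad i=1,\dots,n_s;\ s=1,\dots,S,$$ with non-random $k$-vectors of instruments $Z_{si}\in\mathbb{R}^k$ ($k\ge1$ fixed). Let $\varphi:(0,1)\to\mathbb{R}$ be a score function, let $R_{si}$ be the rank of $Y_{si}-\beta_0D_{si}$ among $Y_{s1}-\beta_0D_{s1},\dots,Y_{sn_s}-\beta_0D_{sn_s}$, and set $\bar Z_s=n_s^{-1}\sum_{i=1}^{n_s}Z_{si}$, $\varphi_{si}=\varphi\big(\tfrac{i}{n_s+1}\big)$, $\bar\varphi_s=n_s^{-1}\sum_{i=1}^{n_s}\varphi_{si}$, $$A_n=n^{-1}\sum_{s=1}^S\sum_{i=1}^{n_s}(Z_{si}-\bar Z_s)\,\varphi\Big(\frac{R_{si}}{n_s+1}\Big),$$ $$\Omega_n^*=n^{-1}\sum_{s\,:\,n_s\ge2}\Big\{\sum_{i=1}^{n_s}(Z_{si}-\bar Z_s)(Z_{si}-\bar Z_s)'\Big\}\Big\{\frac{1}{n_s-1}\sum_{i=1}^{n_s}(\varphi_{si}-\bar\varphi_s)^2\Big\},$$ $$B_n^*=n\,A_n'\,\Omega_n^{*-1}A_n.$$ Assume that $\liminf_{n\to\infty}\lambda_{\min}(\Omega_n^* )>\lambda>0$ for some constant $\lambda$, and: (a) $n^{-1/2}\max_{s,i}\Vert Z_{si}\Vert\to0$, $n^{-1}\sum_{s=1}^S\sum_{i=1}^{n_s}\Vert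 Z_{si}\Vert^2<C_0$ for all $n$, and $\int_0^1|\varphi(x)|^{2+\delta}dx<C_0$ for some positive constants $\delta$ and $C_0$; (b) $\{r_{Csi}:1\le i\le n_s,\ 1\le s\le S\}$ are independent random variables and, for each $s$, $\{r_{Csi}\}_{i=1}^{n_s}$ have an identical continuous distribution. Then, under $H_0:\beta=\beta_0$, $B_n^*\to\chi^2_k$ in distribution as $(n-S)\to\infty$.
   Context: All quantities may depend on $n$ (except $k$, $\varphi$, $\beta$, $\beta_0$ and the constants); this is suppressed in the notation. $\alpha_s$ is a stratum-specific scalar parameter, $Y_{si}$ the response, $D_{si}$ a scalar endogenous (possibly random) regressor, and $r_{Csi}$ the random error. The instruments $Z_{si}$ do not include a constant. $\Vert\cdot\Vert$ is the Euclidean norm, $\lambda_{\min}(\cdot)$ the minimum eigenvalue, $'$ denotes transpose, $\max_{s,i}$ is the maximum over $s\in\{1,\dots,S\}$, $i\in\{1,\dots,n_s\}$, and $\chi^2_k$ is the chi-squared distribution with $k$ degrees of freedom. The limit is along a sequence of such settings with $n-S\to\infty$ (hence $n\to\infty$).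
   Formalization: "Score function" is taken to mean that φ is square integrable on (0,1) and the step functions with values φ(i/(m+1)), i=1,…,m, converge to φ in L²(0,1); for arbitrary φ the claim fails, since φ enters only through its values at rational points. *)

theory Defs
  imports "HOL-Probability.Probability"
begin

text \<open>A single setting is given by the number \<open>S\<close> of strata (indexed \<open>1..S\<close>), the stratum
  sizes \<open>ns s\<close>, and doubly indexed arrays evaluated at pairs \<open>(s, i)\<close> with \<open>1 \<le> i \<le> ns s\<close>.\<close>

definition units :: "nat \<Rightarrow> (nat \<Rightarrow> nat) \<Rightarrow> (nat \<times> nat) set" where
  "units S ns = (SIGMA s:{1..S}. {1..ns s})"

definition sample_size :: "nat \<Rightarrow> (nat \<Rightarrow> nat) \<Rightarrow> nat" where
  "sample_size S ns = (\<Sum>s=1..S. ns s)"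

text \<open>Score functions in the usual sense of rank statistics (Hajek and Sidak, Theory of Rank
  Tests): a square-integrable \<open>\<phi>\<close> on \<open>(0,1)\<close> for which the scores
  \<open>\<phi> (i / (m + 1))\<close>, \<open>1 \<le> i \<le> m\<close>, viewed as a step function with \<open>m\<close> equal steps,
  converge to \<open>\<phi>\<close> in mean square. Every finite sum of monotone square-integrable functions
  qualifies. Some such requirement is part of the notion: the statistic uses \<open>\<phi>\<close> only at
  rational points, so an integrability condition alone would not restrict the scores.\<close>

definition score_function :: "(real \<Rightarrow> real) \<Rightarrow> bool" where
  "score_function \<phi> \<longleftrightarrow>
     set_borel_measurable lebesgue {0<..<1} \<phi> \<and>
     set_integrable lebesgue {0<..<1} (\<lambda>u. (\<phi> u)\<^sup>2) \<and>
     (\<lambda>m::nat. LINT u:{0<..<1}|lebesgue.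
        (\<phi> ((of_int \<lfloor>u * real m\<rfloor> + 1) / (real m + 1)) - \<phi> u)\<^sup>2) \<longlonglongrightarrow> 0"

definition score :: "(real \<Rightarrow> real) \<Rightarrow> nat \<Rightarrow> nat \<Rightarrow> real" where
  "score \<phi> m i = \<phi> (real i / (real m + 1))"

definition score_mean :: "(real \<Rightarrow> real) \<Rightarrow> nat \<Rightarrow> real" where
  "score_mean \<phi> m = (\<Sum>i=1..m. score \<phi> m i) / real m"

definition score_var :: "(real \<Rightarrow> real) \<Rightarrow> nat \<Rightarrow> real" where
  "score_var \<phi> m = (\<Sum>i=1..m. (score \<phi> m i - score_mean \<phi> m)\<^sup>2) / (real m - 1)"

text \<open>Rank of \<open>x i\<close> among \<open>x 1, \<dots>, x m\<close>; the smallest value has rank 1, and ties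
  (a null event for continuous data) receive the largest possible rank.\<close>

definition rank_among :: "nat \<Rightarrow> (nat \<Rightarrow> real) \<Rightarrow> nat \<Rightarrow> nat" where
  "rank_among m x i = card {j \<in> {1..m}. x j \<le> x i}"

definition stratum_mean :: "(nat \<Rightarrow> nat) \<Rightarrow> (nat \<Rightarrow> nat \<Rightarrow> real ^ 'k) \<Rightarrow> nat \<Rightarrow> real ^ 'k" where
  "stratum_mean ns Z s = (1 / real (ns s)) *\<^sub>R (\<Sum>i=1..ns s. Z s i)"

text \<open>The argument \<open>x\<close> holds the null-restricted responses \<open>Y s i - \<beta>\<^sub>0 * D s i\<close>.\<close>

definition A_stat ::
  "(real \<Rightarrow> real) \<Rightarrow> nat \<Rightarrow> (nat \<Rightarrow> nat) \<Rightarrow> (nat \<Rightarrow> nat \<Rightarrow> real ^ 'k) \<Rightarrow> (nat \<Rightarrow> nat \<Rightarrow> real) \<Rightarrow> real ^ 'k"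
where
  "A_stat \<phi> S ns Z x = (1 / real (sample_size S ns)) *\<^sub>R
     (\<Sum>s=1..S. \<Sum>i=1..ns s.
        \<phi> (real (rank_among (ns s) (x s) i) / (real (ns s) + 1)) *\<^sub>R (Z s i - stratum_mean ns Z s))"

definition outer :: "real ^ 'k \<Rightarrow> real ^ 'k ^ 'k" where
  "outer v = (\<chi> i j. v $ i * v $ j)"

definition Omega_star ::
  "(real \<Rightarrow> real) \<Rightarrow> nat \<Rightarrow> (nat \<Rightarrow> nat) \<Rightarrow> (nat \<Rightarrow> nat \<Rightarrow> real ^ 'k) \<Rightarrow> real ^ 'k ^ 'k"
where
  "Omega_star \<phi> S ns Z = (1 / real (sample_size S ns)) *\<^sub>R
     (\<Sum>s | s \<in> {1..S} \<and> 2 \<le> ns s.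
        score_var \<phi> (ns s) *\<^sub>R (\<Sum>i=1..ns s. outer (Z s i - stratum_mean ns Z s)))"

definition B_stat ::
  "(real \<Rightarrow> real) \<Rightarrow> nat \<Rightarrow> (nat \<Rightarrow> nat) \<Rightarrow> (nat \<Rightarrow> nat \<Rightarrow> real ^ 'k) \<Rightarrow> (nat \<Rightarrow> nat \<Rightarrow> real) \<Rightarrow> real"
where
  "B_stat \<phi> S ns Z x = real (sample_size S ns) *
     (A_stat \<phi> S ns Z x \<bullet> (matrix_inv (Omega_star \<phi> S ns Z) *v A_stat \<phi> S ns Z x))"

text \<open>Meaningful for symmetric matrices, whose set of (real) eigenvalues is finite and nonempty.\<close>

definition min_eigenvalue :: "real ^ 'k ^ 'k \<Rightarrow> real" where
  "min_eigenvalue A = Min {c. \<exists>v. v \<noteq> 0 \<and> A *v v = c *\<^sub>R v}"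

text \<open>Law of the sum of squares of \<open>k\<close> independent standard normal variables.\<close>

definition chi_squared :: "nat \<Rightarrow> real measure" where
  "chi_squared k =
     distr (\<Pi>\<^sub>M i\<in>{..<k}. density lborel std_normal_density) borel (\<lambda>x. \<Sum>i<k. (x i)\<^sup>2)"

definition continuous_distribution :: "real measure \<Rightarrow> bool" where
  "continuous_distribution \<mu> \<longleftrightarrow> continuous_on UNIV (cdf \<mu>)"

end

theory Submission
  imports Defs
begin

text \<open>Under the null hypothesis the rank vectors of the strata are independent uniform random
  permutations, so all expectations are averages over a finite product of symmetric groups.
  For bounded scores a linear form of the rank statistic is treated by Stein's method:
  multiplying by a transposition changes \<open>T\<close> by \<open>\<Delta>\<^sub>i\<^sub>j = (c\<^sub>i - c\<^sub>j) (b\<^sub>p\<^sub>i - b\<^sub>p\<^sub>j)\<close>, and within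
  a stratum \<open>T\<close> is a multiple of the sum of all \<open>\<Delta>\<^sub>i\<^sub>j\<close>; this gives \<open>E (T e\<^sup>i\<^sup>u\<^sup>T) \<approx> i u \<sigma>\<^sup>2 E e\<^sup>i\<^sup>u\<^sup>T\<close>, that is, an approximate differential equation
  for the characteristic function. The estimate is uniform in the stratum sizes, so small and
  large strata need not be separated. General scores are reached by truncation, since the mean
  square convergence of the step functions makes the squared scores uniformly integrable.

  The quadratic form is diagonalised by a basis that is orthonormal for \<open>\<Omega>\<close>, which turns
  \<open>B\<close> into a sum of squares \<open>|W|\<^sup>2\<close>. Averaging \<open>e\<^sup>i\<^sup>\<xi>\<^sup>W\<close> over a standard Gaussian \<open>\<xi>\<close> yields the
  Laplace transform of \<open>|W|\<^sup>2\<close>, so that its convergence follows from the one-dimensional limits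
  by dominated convergence; on the half line, convergence of Laplace transforms at the natural
  numbers implies weak convergence by the Weierstrass theorem in the variable \<open>e\<^sup>-\<^sup>x\<close>.\<close>

section \<open>Averages over permutations\<close>

text \<open>\<open>Omega_star\<close> is not assumed to converge, so there is no fixed limiting
  covariance and no fixed direction in which to test the statistic. The basis that diagonalises it
  changes with the sample, and the one-dimensional limit is needed for directions that vary with the
  sample while their length stays bounded and their variance stays constant. Hence every error bound
  is explicit: it involves only a bound \<open>K\<close> on the scores, a bound \<open>M\<close> on
  the coefficients and the sum \<open>gam\<close> of the squared coefficients. \<open>M\<close>
  tends to 0 by the condition on the largest instrument; \<open>gam\<close> stays bounded by the
  second-moment condition.

  The Stein estimate rests on an antisymmetry. A transposition preserves the uniform law and flips
  the sign of \<Delta>, so the mean of \<Delta> g is half the mean of \<Delta> (g - g'), where g' is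
  g after the transposition. To first order this leaves the mean of V g, with V a weighted sum of
  all squares of \<Delta>; the real work is to show that V is close to its mean. The cut-off level
  of the scores has to serve all stratum sizes simultaneously, since arbitrary sizes may coexist in
  one sample.\<close>

definition avg :: "'a set \<Rightarrow> ('a \<Rightarrow> 'b::real_vector) \<Rightarrow> 'b" where
  "avg P f = (1 / real (card P)) *\<^sub>R (\<Sum>p\<in>P. f p)"

lemma avg_cong: "(\<And>p. p \<in> P \<Longrightarrow> f p = g p) \<Longrightarrow> avg P f = avg P g"
  by (simp add: avg_def)

lemma avg_add: "avg P (\<lambda>p. f p + g p) = avg P f + avg P g"
  by (simp add: avg_def sum.distrib scaleR_add_right)

lemma avg_diff: "avg P (\<lambda>p. f p - g p) = avg P f - avg P g"
  by (simp add: avg_def sum_subtractf scaleR_diff_right)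

lemma avg_minus: "avg P (\<lambda>p. - f p) = - avg P f"
  by (simp add: avg_def sum_negf)

lemma avg_sum: "avg P (\<lambda>p. \<Sum>i\<in>I. f i p) = (\<Sum>i\<in>I. avg P (f i))"
  by (simp add: avg_def scaleR_sum_right sum.swap[of _ I P])

lemma avg_cmult: "avg P (\<lambda>p. (a::'b::real_algebra) * f p) = a * avg P f"
  by (simp add: avg_def sum_distrib_left)

lemma avg_const: "finite P \<Longrightarrow> P \<noteq> {} \<Longrightarrow> avg P (\<lambda>_. a) = a"
  by (simp add: avg_def sum_constant_scaleR)

lemma avg_mono: "(\<And>p. p \<in> P \<Longrightarrow> f p \<le> g p) \<Longrightarrow> avg P f \<le> (avg P g :: real)"
  unfolding avg_def by (intro scaleR_left_mono sum_mono) auto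

lemma norm_avg_le: "norm (avg P f :: 'b::real_normed_vector) \<le> avg P (\<lambda>p. norm (f p))"
  unfolding avg_def by (simp add: divide_right_mono norm_sum)

lemma avg_reindex: "bij_betw h P P \<Longrightarrow> avg P (\<lambda>p. f (h p)) = avg P f"
  unfolding avg_def by (simp add: sum.reindex_bij_betw)

lemma avg_Cauchy_Schwarz:
  fixes f g :: "'a \<Rightarrow> real"
  shows "(avg P (\<lambda>p. f p * g p))\<^sup>2 \<le> avg P (\<lambda>p. (f p)\<^sup>2) * avg P (\<lambda>p. (g p)\<^sup>2)"
  using Cauchy_Schwarz_ineq_sum[of f g P]
  by (simp add: avg_def power2_eq_square divide_right_mono)

lemma avg_abs_le:
  fixes f :: "'a \<Rightarrow> real"
  shows "avg P (\<lambda>p. \<bar>f p\<bar>) \<le> sqrt (avg P (\<lambda>p. (f p)\<^sup>2))"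
proof (cases "finite P \<and> P \<noteq> {}")
  case True
  then show ?thesis
    using avg_Cauchy_Schwarz[of P "\<lambda>p. \<bar>f p\<bar>" "\<lambda>_. 1"] 
    by (intro real_le_rsqrt) (simp add: avg_const)
next
  case False
  then show ?thesis by (auto simp: avg_def)
qed

text \<open>Substituting \<open>h p\<close> for \<open>p\<close> preserves the average and flips the
  sign of \<open>d\<close>, so \<open>d p *\<^sub>R g p\<close> and
  \<open>- d p *\<^sub>R g (h p)\<close> have the same average; the right side is their mean. It is
  applied with \<open>g\<close> constant, with \<open>g\<close> the rank sum itself and with
  \<open>g\<close> a complex exponential of it.\<close>

lemma avg_antisymmetric:
  fixes d :: "'a \<Rightarrow> real" and g :: "'a \<Rightarrow> 'b::real_vector"
  assumes h: "bij_betw h P P" and d: "\<And>p. p \<in> P \<Longrightarrow> d (h p) = - d p"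
  shows "avg P (\<lambda>p. d p *\<^sub>R g p) = (1/2) *\<^sub>R avg P (\<lambda>p. d p *\<^sub>R (g p - g (h p)))"
proof -
  have "avg P (\<lambda>p. d p *\<^sub>R g p) = avg P (\<lambda>p. d (h p) *\<^sub>R g (h p))"
    using avg_reindex[OF h, of "\<lambda>p. d p *\<^sub>R g p"] by simp
  also have "\<dots> = avg P (\<lambda>p. - (d p *\<^sub>R g (h p)))"
    by (rule avg_cong) (simp add: d)
  finally have "avg P (\<lambda>p. d p *\<^sub>R (g p - g (h p))) = avg P (\<lambda>p. d p *\<^sub>R g p) + avg P (\<lambda>p. d p *\<^sub>R g p)"
    by (simp add: scaleR_diff_right avg_diff avg_minus)
  then show ?thesis by (simp flip: scaleR_2)
qed

section \<open>Uniform random permutations and transpositions\<close>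

abbreviation perms :: "'a set \<Rightarrow> ('a \<Rightarrow> 'a) set" where
  "perms I \<equiv> {p. p permutes I}"

abbreviation swap :: "'a \<Rightarrow> 'a \<Rightarrow> 'a \<Rightarrow> 'a" where
  "swap \<equiv> Transposition.transpose"

lemma perms_nonempty: "perms I \<noteq> {}"
  using permutes_id by blast

lemma bij_betw_involution: "(\<And>p. p \<in> P \<Longrightarrow> h p \<in> P) \<Longrightarrow> (\<And>p. p \<in> P \<Longrightarrow> h (h p) = p) \<Longrightarrow> bij_betw h P P"
  by (rule bij_betw_byWitness[where f' = h]) auto

lemma bij_betw_perms_swap:
  assumes "i \<in> I" "j \<in> I"
  shows "bij_betw (\<lambda>p. p \<circ> swap i j) (perms I) (perms I)"
  using assms by (intro bij_betw_involution) 
    (auto intro!: permutes_compose permutes_swap_id simp: comp_assoc)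

text \<open>The divisor \<open>card I - 1\<close> makes twice this number the mean of
  \<open>(b (p i) - b (p j))\<^sup>2\<close> for \<open>i \<noteq> j\<close> under a uniform
  permutation. For a single point the value is \<open>0 / 0 = 0\<close>.\<close>

definition var :: "'a set \<Rightarrow> ('a \<Rightarrow> real) \<Rightarrow> real" where
  "var I b = (\<Sum>l\<in>I. (b l - (\<Sum>l\<in>I. b l) / real (card I))\<^sup>2) / (real (card I) - 1)"

lemma sum_centered_squares:
  fixes b :: "'a \<Rightarrow> real"
  assumes "finite I"
  shows "(\<Sum>l\<in>I. (b l - (\<Sum>l\<in>I. b l) / real (card I))\<^sup>2) = (\<Sum>l\<in>I. (b l)\<^sup>2) - (\<Sum>l\<in>I. b l)\<^sup>2 / real (card I)"
proof (cases "I = {}")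
  case False
  define m where "m = real (card I)"
  have m: "m > 0" using False assms by (simp add: m_def card_gt_0_iff)
  define B where "B = (\<Sum>l\<in>I. b l)"
  have "(\<Sum>l\<in>I. (b l - B / m)\<^sup>2) = (\<Sum>l\<in>I. (b l)\<^sup>2 - 2 * (B / m) * b l + (B / m)\<^sup>2)"
    by (rule sum.cong) (auto simp: power2_eq_square algebra_simps)
  also have "\<dots> = (\<Sum>l\<in>I. (b l)\<^sup>2) - 2 * (B / m) * B + m * (B / m)\<^sup>2"
    by (simp only: sum.distrib sum_subtractf sum_distrib_left[symmetric] B_def[symmetric]) (simp add: m_def)
  also have "\<dots> = (\<Sum>l\<in>I. (b l)\<^sup>2) - B\<^sup>2 / m"
    using m by (simp add: field_simps power2_eq_square)
  finally show ?thesis by (simp add: B_def m_def)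
qed simp

lemma sum_centered_squares_le:
  fixes b :: "'a \<Rightarrow> real"
  assumes "finite I"
  shows "(\<Sum>l\<in>I. (b l - (\<Sum>l\<in>I. b l) / real (card I))\<^sup>2) \<le> (\<Sum>l\<in>I. (b l)\<^sup>2)"
  unfolding sum_centered_squares[OF assms] by simp

lemma var_nonneg: "0 \<le> var I b"
proof (cases "card I = 0")
  case True
  then show ?thesis by (auto simp: var_def card_eq_0_iff)
next
  case False
  then show ?thesis unfolding var_def by (intro divide_nonneg_nonneg sum_nonneg) auto
qed

text \<open>The factor 2 bounds \<open>m / (m - 1)\<close> for \<open>m \<ge> 2\<close>; smaller
  sets have variance 0.\<close>

lemma var_le:
  assumes "finite I" 
  shows "var I b \<le> 2 * ((\<Sum>l\<in>I. (b l)\<^sup>2) / real (card I))"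
proof (cases "2 \<le> card I")
  case True
  have "var I b \<le> (\<Sum>l\<in>I. (b l)\<^sup>2) / (real (card I) - 1)"
    unfolding var_def using True by (intro divide_right_mono sum_centered_squares_le assms) auto
  also have "\<dots> \<le> (\<Sum>l\<in>I. (b l)\<^sup>2) / (real (card I) / 2)"
    using True by (intro divide_left_mono sum_nonneg) auto
  finally show ?thesis by (simp add: mult.commute)
next
  case False
  then have "var I b = 0"
    using assms by (auto simp: var_def not_le less_Suc_eq numeral_2_eq_2)
  then show ?thesis by (simp add: sum_nonneg)
qed

lemma var_le_bounded:
  assumes "finite I" "\<And>l. l \<in> I \<Longrightarrow> \<bar>b l\<bar> \<le> K"
  shows "var I b \<le> 2 * K\<^sup>2"
proof (cases "I = {}")
  case False
  have "(\<Sum>l\<in>I. (b l)\<^sup>2) \<le> (\<Sum>l\<in>I. K\<^sup>2)"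
    using assms by (intro sum_mono) (metis abs_ge_zero power2_abs power_mono)
  then have "(\<Sum>l\<in>I. (b l)\<^sup>2) / real (card I) \<le> K\<^sup>2"
    using False assms(1) by (simp add: field_simps card_gt_0_iff)
  with var_le[OF assms(1), of b] show ?thesis by linarith
qed (simp add: var_def)

lemma sum_sum_diff_squares:
  fixes b :: "'a \<Rightarrow> real"
  shows "(\<Sum>i\<in>I. \<Sum>j\<in>I. (b i - b j)\<^sup>2) = 2 * real (card I) * (\<Sum>i\<in>I. (b i)\<^sup>2) - 2 * (\<Sum>i\<in>I. b i)\<^sup>2"
proof -
  have "(\<Sum>i\<in>I. \<Sum>j\<in>I. (b i - b j)\<^sup>2) = (\<Sum>i\<in>I. \<Sum>j\<in>I. (b i)\<^sup>2 + (b j)\<^sup>2 - 2 * (b i * b j))"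
    by (simp add: power2_diff algebra_simps)
  also have "\<dots> = 2 * real (card I) * (\<Sum>i\<in>I. (b i)\<^sup>2) - 2 * (\<Sum>i\<in>I. b i)\<^sup>2"
    by (simp add: sum.distrib sum_subtractf sum_product power2_eq_square sum_distrib_left sum_distrib_right mult_ac)
  finally show ?thesis .
qed

lemma sum_sum_diff_squares_var:
  assumes "2 \<le> card I"
  shows "(\<Sum>i\<in>I. \<Sum>j\<in>I. (b i - b j)\<^sup>2) = 2 * real (card I) * (real (card I) - 1) * var I b"
proof -
  have "finite I" using assms by (metis card.infinite not_numeral_le_zero)
  have *: "2 * m * X - 2 * Y = 2 * m * (m - 1) * ((X - Y / m) / (m - 1))" if "m \<noteq> 0" "m - 1 \<noteq> 0" for m X Y :: real
  proof -
    have "2 * m * (m - 1) * ((X - Y / m) / (m - 1)) = 2 * m * (X - Y / m)" using that by simp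
    then show ?thesis using that by (simp add: right_diff_distrib)
  qed
  show ?thesis
    unfolding sum_sum_diff_squares var_def sum_centered_squares[OF \<open>finite I\<close>]
    using assms by (intro *) auto
qed

section \<open>Moments of rank sums under a uniform permutation\<close>

definition pair_diff :: "('a \<Rightarrow> real) \<Rightarrow> ('a \<Rightarrow> real) \<Rightarrow> 'a \<Rightarrow> 'a \<Rightarrow> ('a \<Rightarrow> 'a) \<Rightarrow> real" where
  "pair_diff c b i j p = (c i - c j) * (b (p i) - b (p j))"

definition rank_sum :: "'a set \<Rightarrow> ('a \<Rightarrow> real) \<Rightarrow> ('a \<Rightarrow> real) \<Rightarrow> ('a \<Rightarrow> 'a) \<Rightarrow> real" where
  "rank_sum I c b p = (\<Sum>i\<in>I. c i * b (p i))"

text \<open>The double sum consists of two copies of \<open>card I * rank_sum\<close> minus two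
  cross terms, each the sum of \<open>c\<close> times the sum of the \<open>b (p i)\<close>; these
  vanish because \<open>c\<close> is centred. Every summand is antisymmetric under its own
  transposition, which prepares \<open>avg_antisymmetric\<close>.\<close>

lemma rank_sum_eq_pair_diff:
  assumes "finite I" "(\<Sum>i\<in>I. c i) = 0"
  shows "rank_sum I c b p = (\<Sum>i\<in>I. \<Sum>j\<in>I. pair_diff c b i j p) / (2 * real (card I))"
proof (cases "I = {}")
  case False
  have "(\<Sum>i\<in>I. \<Sum>j\<in>I. pair_diff c b i j p) 
    = (\<Sum>i\<in>I. \<Sum>j\<in>I. c i * b (p i) + c j * b (p j) - c i * b (p j) - c j * b (p i))"
    by (simp add: pair_diff_def algebra_simps)
  also have "\<dots> = 2 * real (card I) * rank_sum I c b p - 2 * ((\<Sum>i\<in>I. c i) * (\<Sum>i\<in>I. b (p i)))"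
    by (simp add: sum.distrib sum_subtractf sum_distrib_left[symmetric] sum_distrib_right[symmetric] rank_sum_def)
  finally show ?thesis using False assms by (simp add: card_eq_0_iff)
qed (simp add: rank_sum_def)

lemma pair_diff_swap: "pair_diff c b i j (p \<circ> swap i j) = - pair_diff c b i j p"
  by (simp add: pair_diff_def algebra_simps)

lemma rank_sum_swap:
  assumes "finite I" "i \<in> I" "j \<in> I"
  shows "rank_sum I c b (p \<circ> swap i j) = rank_sum I c b p - pair_diff c b i j p"
proof (cases "i = j")
  case False
  have I: "I = insert i (insert j (I - {i, j}))" using assms by auto
  have "(\<Sum>k\<in>I - {i, j}. c k * b ((p \<circ> swap i j) k)) = (\<Sum>k\<in>I - {i, j}. c k * b (p k))"
    by (rule sum.cong) auto
  then show ?thesis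
    unfolding rank_sum_def using False assms(1)
    by (subst (1 2) I) (simp add: pair_diff_def algebra_simps)
qed (simp add: pair_diff_def)

lemma sum_comp_perm: "p permutes I \<Longrightarrow> (\<Sum>i\<in>I. f (p i)) = (\<Sum>i\<in>I. f i)"
  using sum.permute[of p I f] by (simp add: comp_def)

text \<open>Reindexing by transpositions shows that the average is the same for all pairs of
  distinct positions. The sum over all pairs does not depend on \<open>p\<close>, since
  \<open>p\<close> only rearranges the values of \<open>b\<close>, and dividing it by the
  \<open>m (m - 1)\<close> equal terms gives the claim.\<close>

lemma avg_perms_pair:
  fixes b :: "'a \<Rightarrow> real"
  assumes I: "finite I" and ij: "i \<in> I" "j \<in> I" "i \<noteq> j"
  shows "avg (perms I) (\<lambda>p. (b (p i) - b (p j))\<^sup>2) = 2 * var I b"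
proof -
  define w where "w i j = avg (perms I) (\<lambda>p. (b (p i) - b (p j))\<^sup>2)" for i j
  have w0: "w k k = 0" for k
    by (simp add: w_def avg_def)
  have sym: "w k l = w l k" for k l
    unfolding w_def by (simp add: power2_commute)
  have step: "w k l = w k l'" if "k \<in> I" "l \<in> I" "l' \<in> I" "k \<noteq> l" "k \<noteq> l'" for k l l'
    using that avg_reindex[OF bij_betw_perms_swap[OF that(2,3)], of "\<lambda>p. (b (p k) - b (p l'))\<^sup>2"]
    by (simp add: w_def)
  have const: "w k l = w i j" if "k \<in> I" "l \<in> I" "k \<noteq> l" for k l
  proof (cases "k = i")
    case True then show ?thesis using step that ij by metis
  next
    case False
    have "w k l = w k i" using step that ij False by metis
    also have "\<dots> = w i j" using step[of i k j] that ij False sym by metis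
    finally show ?thesis .
  qed
  have 2: "2 \<le> card I" 
    using card_mono[OF I, of "{i, j}"] ij by auto
  define m where "m = real (card I)"
  have m: "m \<ge> 2" using 2 by (simp add: m_def)
  have "(\<Sum>k\<in>I. \<Sum>l\<in>I. w k l) = avg (perms I) (\<lambda>p. \<Sum>k\<in>I. \<Sum>l\<in>I. (b (p k) - b (p l))\<^sup>2)"
    by (simp add: w_def avg_sum)
  also have "\<dots> = avg (perms I) (\<lambda>p. \<Sum>k\<in>I. \<Sum>l\<in>I. (b k - b l)\<^sup>2)"
    by (intro avg_cong) (simp add: sum_comp_perm[of _ _ "\<lambda>k. (b _ - b k)\<^sup>2"] 
        sum_comp_perm[of _ _ "\<lambda>k. \<Sum>l\<in>I. (b k - b l)\<^sup>2"])
  also have "\<dots> = 2 * m * (m - 1) * var I b"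
    unfolding sum_sum_diff_squares_var[OF 2] m_def
    using perms_nonempty[of I] by (intro avg_const finite_permutations I)
  finally have *: "(\<Sum>k\<in>I. \<Sum>l\<in>I. w k l) = 2 * m * (m - 1) * var I b" .
  have "(\<Sum>k\<in>I. \<Sum>l\<in>I. w k l) = (\<Sum>k\<in>I. \<Sum>l\<in>I. if l = k then 0 else w i j)"
    by (intro sum.cong) (auto simp: const w0)
  also have "\<dots> = (\<Sum>k\<in>I. (m - 1) * w i j)"
  proof (rule sum.cong[OF refl])
    fix k assume k: "k \<in> I"
    then have "(\<Sum>l\<in>I. if l = k then 0 else w i j) = (\<Sum>l\<in>I - {k}. w i j)"
      using I by (intro sum.mono_neutral_cong_right) auto
    then show "(\<Sum>l\<in>I. if l = k then 0 else w i j) = (m - 1) * w i j"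
      using k I 2 by (simp add: m_def of_nat_diff)
  qed
  finally have "m * (m - 1) * w i j = 2 * m * (m - 1) * var I b"
    using * by (simp only: sum_constant m_def mult.assoc)
  then have "m * (m - 1) * (w i j - 2 * var I b) = 0" by (simp add: algebra_simps)
  then have "w i j = 2 * var I b" using m by simp
  then show ?thesis by (simp add: w_def)
qed

lemma avg_pair_diff_sq:
  assumes I: "finite I" and ij: "i \<in> I" "j \<in> I"
  shows "avg (perms I) (\<lambda>p. (pair_diff c b i j p)\<^sup>2) = 2 * (c i - c j)\<^sup>2 * var I b"
  using avg_perms_pair[OF assms, of b]
  by (cases "i = j") (auto simp: pair_diff_def power_mult_distrib avg_cmult avg_def)

text \<open>Up to scale, the conditional mean square of the change of \<open>rank_sum\<close> under
  a random transposition. The 4 is the product of the 2 in \<open>rank_sum_eq_pair_diff\<close> and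
  the 2 in \<open>avg_antisymmetric\<close>.\<close>

definition cond_var :: "'a set \<Rightarrow> ('a \<Rightarrow> real) \<Rightarrow> ('a \<Rightarrow> real) \<Rightarrow> ('a \<Rightarrow> 'a) \<Rightarrow> real" where
  "cond_var I c b p = (\<Sum>i\<in>I. \<Sum>j\<in>I. (pair_diff c b i j p)\<^sup>2) / (4 * real (card I))"

lemma avg_cond_var:
  assumes I: "finite I" and c: "(\<Sum>i\<in>I. c i) = 0"
  shows "avg (perms I) (cond_var I c b) = (\<Sum>i\<in>I. (c i)\<^sup>2) * var I b"
proof (cases "I = {}")
  case False
  have "avg (perms I) (cond_var I c b) = (\<Sum>i\<in>I. \<Sum>j\<in>I. 2 * (c i - c j)\<^sup>2 * var I b) / (4 * real (card I))"
  proof -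
    have "avg (perms I) (cond_var I c b) = avg (perms I) (\<lambda>p. 1 / (4 * real (card I)) * (\<Sum>i\<in>I. \<Sum>j\<in>I. (pair_diff c b i j p)\<^sup>2))"
      by (simp add: cond_var_def[abs_def])
    also have "\<dots> = 1 / (4 * real (card I)) * (\<Sum>i\<in>I. \<Sum>j\<in>I. 2 * (c i - c j)\<^sup>2 * var I b)"
      unfolding avg_cmult avg_sum using I by (simp add: avg_pair_diff_sq)
    finally show ?thesis by simp
  qed
  also have "\<dots> = var I b * (\<Sum>i\<in>I. \<Sum>j\<in>I. (c i - c j)\<^sup>2) / (2 * real (card I))"
    by (simp add: sum_distrib_left mult_ac sum_divide_distrib)
  also have "\<dots> = (\<Sum>i\<in>I. (c i)\<^sup>2) * var I b"
    using False I by (simp add: sum_sum_diff_squares c card_eq_0_iff)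
  finally show ?thesis .
qed (simp add: cond_var_def avg_def)

lemma avg_rank_sum:
  assumes I: "finite I" and c: "(\<Sum>i\<in>I. c i) = 0"
  shows "avg (perms I) (rank_sum I c b) = 0"
proof -
  have "avg (perms I) (pair_diff c b i j) = 0" if "i \<in> I" "j \<in> I" for i j
    using avg_antisymmetric[OF bij_betw_perms_swap[OF that], of "pair_diff c b i j" "\<lambda>_. 1::real"]
    by (simp add: pair_diff_swap avg_def)
  then have "avg (perms I) (\<lambda>p. \<Sum>i\<in>I. \<Sum>j\<in>I. pair_diff c b i j p) = 0"
    by (simp add: avg_sum)
  then show ?thesis
    using I c avg_cmult[of "perms I" "1 / (2 * real (card I))" "\<lambda>p. \<Sum>i\<in>I. \<Sum>j\<in>I. pair_diff c b i j p"]
    by (simp add: rank_sum_eq_pair_diff[OF I c] fun_eq_iff cong: avg_cong)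
qed

text \<open>Stein's identity with the rank sum itself as test function: its change under a
  transposition is exactly \<open>pair_diff\<close>, so there is no expansion error and the second
  moment equals the mean of \<open>cond_var\<close>.\<close>

lemma avg_rank_sum_sq:
  assumes I: "finite I" and c: "(\<Sum>i\<in>I. c i) = 0"
  shows "avg (perms I) (\<lambda>p. (rank_sum I c b p)\<^sup>2) = (\<Sum>i\<in>I. (c i)\<^sup>2) * var I b"
proof -
  have 1: "avg (perms I) (\<lambda>p. pair_diff c b i j p * rank_sum I c b p) = 
     avg (perms I) (\<lambda>p. (pair_diff c b i j p)\<^sup>2) / 2" if "i \<in> I" "j \<in> I" for i j
    using avg_antisymmetric[OF bij_betw_perms_swap[OF that], of "pair_diff c b i j" "rank_sum I c b"]
    by (simp add: pair_diff_swap rank_sum_swap[OF I that] power2_eq_square)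
  have "avg (perms I) (\<lambda>p. (rank_sum I c b p)\<^sup>2) = 
    avg (perms I) (\<lambda>p. 1 / (2 * real (card I)) * (\<Sum>i\<in>I. \<Sum>j\<in>I. pair_diff c b i j p * rank_sum I c b p))"
    by (intro avg_cong, simp only: sum_distrib_right[symmetric])
      (simp add: rank_sum_eq_pair_diff[OF I c] power2_eq_square)
  also have "\<dots> = 1 / (4 * real (card I)) * (\<Sum>i\<in>I. \<Sum>j\<in>I. avg (perms I) (\<lambda>p. (pair_diff c b i j p)\<^sup>2))"
    unfolding avg_cmult avg_sum by (simp add: 1 sum_divide_distrib[symmetric])
  also have "\<dots> = avg (perms I) (\<lambda>p. 1 / (4 * real (card I)) * (\<Sum>i\<in>I. \<Sum>j\<in>I. (pair_diff c b i j p)\<^sup>2))"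
    unfolding avg_cmult avg_sum ..
  also have "\<dots> = avg (perms I) (cond_var I c b)"
    by (simp add: cond_var_def[abs_def])
  finally show ?thesis by (simp add: avg_cond_var[OF I c])
qed

text \<open>Centring \<open>d\<close> changes the rank sum by the mean of \<open>d\<close> times the
  sum of the scores, which is the same for every permutation. This constant is \<open>k\<close>, and
  the exact second moment applies to the centred coefficients.\<close>

lemma variance_rank_sum_le:
  fixes e d :: "'a \<Rightarrow> real"
  assumes I: "finite I" and e: "\<And>l. l \<in> I \<Longrightarrow> \<bar>e l\<bar> \<le> E"
  obtains k where "avg (perms I) (\<lambda>p. (rank_sum I d e p - k)\<^sup>2) \<le> 2 * E\<^sup>2 * (\<Sum>i\<in>I. (d i)\<^sup>2)"
proof -
  define db where "db = (\<Sum>i\<in>I. d i) / real (card I)"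
  have 0: "(\<Sum>i\<in>I. d i - db) = 0"
    using I by (cases "I = {}") (auto simp: sum_subtractf db_def)
  have "avg (perms I) (\<lambda>p. (rank_sum I d e p - db * (\<Sum>i\<in>I. e i))\<^sup>2) = 
        avg (perms I) (\<lambda>p. (rank_sum I (\<lambda>i. d i - db) e p)\<^sup>2)"
    by (intro avg_cong) 
      (simp add: rank_sum_def left_diff_distrib sum_subtractf sum_distrib_left[symmetric] sum_comp_perm)
  also have "\<dots> = (\<Sum>i\<in>I. (d i - db)\<^sup>2) * var I e"
    by (rule avg_rank_sum_sq[OF I 0])
  also have "\<dots> \<le> (\<Sum>i\<in>I. (d i)\<^sup>2) * (2 * E\<^sup>2)"
    unfolding db_def using e
    by (intro mult_mono sum_centered_squares_le I var_le_bounded sum_nonneg var_nonneg) auto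
  finally show ?thesis using that by (simp add: mult_ac)
qed

text \<open>Separates \<open>cond_var\<close> into linear rank sums, whose variance is small, and the square of
  \<open>rank_sum\<close>, which the factor \<open>1 / card I\<close> makes negligible.\<close>
lemma cond_var_eq:
  assumes I: "finite I" "I \<noteq> {}" and c: "(\<Sum>i\<in>I. c i) = 0" and p: "p permutes I"
  shows "cond_var I c b p = rank_sum I (\<lambda>i. (c i)\<^sup>2) (\<lambda>l. (b l)\<^sup>2 / 2 - (\<Sum>l\<in>I. b l) / real (card I) * b l) p 
    + (\<Sum>i\<in>I. (c i)\<^sup>2) * (\<Sum>l\<in>I. (b l)\<^sup>2) / (2 * real (card I)) + (rank_sum I c b p)\<^sup>2 / real (card I)"
proof -
  define m where "m = real (card I)"
  have m: "m > 0" using I by (simp add: m_def card_gt_0_iff)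
  define B1 where "B1 = (\<Sum>l\<in>I. b l)"
  define B2 where "B2 = (\<Sum>l\<in>I. (b l)\<^sup>2)"
  define g where "g = (\<Sum>i\<in>I. (c i)\<^sup>2)"
  have B1: "(\<Sum>i\<in>I. b (p i)) = B1" using sum_comp_perm[OF p, of b] by (simp add: B1_def)
  have B2: "(\<Sum>i\<in>I. (b (p i))\<^sup>2) = B2" using sum_comp_perm[OF p, of "\<lambda>l. (b l)\<^sup>2"] by (simp add: B2_def)
  define T where "T = (\<Sum>i\<in>I. c i * b (p i))"
  define P where "P = (\<Sum>i\<in>I. (c i)\<^sup>2 * (b (p i))\<^sup>2)"
  define Q where "Q = (\<Sum>i\<in>I. (c i)\<^sup>2 * b (p i))"
  \<comment> \<open>Of the nine products, the two in which a squared score meets the first power of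
    both coefficients sum to 0, because \<open>c\<close> is centred. In all others the sums over
    \<open>i\<close> and \<open>j\<close> separate into constants, \<open>P\<close>,
    \<open>Q\<close> and \<open>T\<close>.\<close>
  have "(\<Sum>i\<in>I. \<Sum>j\<in>I. (pair_diff c b i j p)\<^sup>2) = (\<Sum>i\<in>I. \<Sum>j\<in>I. 
     (c i)\<^sup>2 * (b (p i))\<^sup>2 + (c j)\<^sup>2 * (b (p j))\<^sup>2 + (c i)\<^sup>2 * (b (p j))\<^sup>2 + (b (p i))\<^sup>2 * (c j)\<^sup>2
     - 2 * ((c i)\<^sup>2 * b (p i) * b (p j)) - 2 * (b (p i) * ((c j)\<^sup>2 * b (p j)))
     - 2 * (c i * (b (p i))\<^sup>2 * c j) - 2 * (c i * (c j * (b (p j))\<^sup>2)) + 4 * (c i * b (p i) * (c j * b (p j))))"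
    by (intro sum.cong refl) (simp add: pair_diff_def power2_eq_square algebra_simps)
  also have "\<dots> = m * P + m * P + (B2 * g + B2 * g) - 2 * (B1 * Q) - 2 * (B1 * Q) + 4 * T\<^sup>2"
    by (simp only: sum.distrib sum_subtractf sum_distrib_left[symmetric] sum_product[symmetric] sum_distrib_right[symmetric] c B1 B2 sum_constant)
       (simp add: c B1 B2 m_def g_def T_def P_def Q_def power2_eq_square sum_distrib_right sum_distrib_left mult_ac)
  finally have E: "(\<Sum>i\<in>I. \<Sum>j\<in>I. (pair_diff c b i j p)\<^sup>2) = 2 * m * P + 2 * g * B2 - 4 * B1 * Q + 4 * T\<^sup>2"
    by simp
  have R: "rank_sum I (\<lambda>i. (c i)\<^sup>2) (\<lambda>l. (b l)\<^sup>2 / 2 - B1 / m * b l) p = P / 2 - B1 / m * Q"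
    by (simp add: rank_sum_def right_diff_distrib sum_subtractf P_def Q_def sum_distrib_left sum_divide_distrib mult_ac)
  show ?thesis
    unfolding B1_def[symmetric] B2_def[symmetric] g_def[symmetric] m_def[symmetric] R cond_var_def E
    using m by (simp add: rank_sum_def T_def[symmetric] field_simps)
qed

text \<open>By \<open>cond_var_eq\<close>, up to a constant this is a rank sum with coefficients
  \<open>(c i)\<^sup>2\<close> and scores of size at most \<open>3/2 * K\<^sup>2\<close>, plus the
  square of \<open>rank_sum\<close> over \<open>card I\<close>. With \<open>g\<close> the sum of the
  \<open>(c i)\<^sup>2\<close>, the two parts contribute at most
  \<open>9/2 * K^4 * M\<^sup>2 * g\<close> and \<open>2 * K^4 * M\<^sup>2 * g\<close>; doubling both
  gives 13. No power of \<open>card I\<close> survives, so the bound adds up over strata.\<close>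

lemma variance_cond_var:
  fixes b c :: "'a \<Rightarrow> real"
  assumes I: "finite I" and c: "(\<Sum>i\<in>I. c i) = 0" 
    and b: "\<And>l. l \<in> I \<Longrightarrow> \<bar>b l\<bar> \<le> K" and M: "\<And>i. i \<in> I \<Longrightarrow> \<bar>c i\<bar> \<le> M"
  shows "avg (perms I) (\<lambda>p. (cond_var I c b p - (\<Sum>i\<in>I. (c i)\<^sup>2) * var I b)\<^sup>2) \<le> 13 * K ^ 4 * M\<^sup>2 * (\<Sum>i\<in>I. (c i)\<^sup>2)"
proof (cases "I = {}")
  case False
  define m where "m = real (card I)"
  have m: "m > 0" using False I by (simp add: m_def card_gt_0_iff)
  define g where "g = (\<Sum>i\<in>I. (c i)\<^sup>2)"
  have g0: "g \<ge> 0" by (simp add: g_def sum_nonneg)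
  have c2: "(c i)\<^sup>2 \<le> M\<^sup>2" if "i \<in> I" for i using M[OF that] by (metis abs_ge_zero power2_abs power_mono)
  have b2: "(b l)\<^sup>2 \<le> K\<^sup>2" if "l \<in> I" for l using b[OF that] by (metis abs_ge_zero power2_abs power_mono)
  have K0: "K \<ge> 0" using False b by (metis abs_ge_zero ex_in_conv order_trans)
  have gM: "g \<le> m * M\<^sup>2" unfolding g_def m_def using sum_bounded_above[of I "\<lambda>i. (c i)\<^sup>2"] c2 by auto
  define e where "e l = (b l)\<^sup>2 / 2 - (\<Sum>l\<in>I. b l) / m * b l" for l
  have "\<bar>\<Sum>l\<in>I. b l\<bar> \<le> (\<Sum>l\<in>I. \<bar>b l\<bar>)" by (rule sum_abs)
  also have "\<dots> \<le> m * K" unfolding m_def using sum_bounded_above[of I "\<lambda>i. \<bar>b i\<bar>"] b by auto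
  finally have B: "\<bar>(\<Sum>l\<in>I. b l) / m\<bar> \<le> K" using m by (simp add: field_simps)
  have e: "\<bar>e l\<bar> \<le> 3 / 2 * K\<^sup>2" if "l \<in> I" for l
  proof -
    have "\<bar>e l\<bar> \<le> \<bar>(b l)\<^sup>2 / 2\<bar> + \<bar>(\<Sum>l\<in>I. b l) / m * b l\<bar>" unfolding e_def by (rule abs_triangle_ineq4)
    also have "\<dots> \<le> K\<^sup>2 / 2 + K * K"
      unfolding abs_mult using b2[OF that] b[OF that] B K0 by (intro add_mono mult_mono) auto
    finally show ?thesis by (simp add: power2_eq_square)
  qed
  obtain k where k: "avg (perms I) (\<lambda>p. (rank_sum I (\<lambda>i. (c i)\<^sup>2) e p - k)\<^sup>2) \<le> 2 * (3 / 2 * K\<^sup>2)\<^sup>2 * (\<Sum>i\<in>I. ((c i)\<^sup>2)\<^sup>2)"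
    using variance_rank_sum_le[of I e "3 / 2 * K\<^sup>2" "\<lambda>i. (c i)\<^sup>2", OF I e] by blast
  also have "\<dots> \<le> 2 * (3 / 2 * K\<^sup>2)\<^sup>2 * (M\<^sup>2 * g)"
    unfolding g_def sum_distrib_left
  proof (intro mult_left_mono sum_mono)
    show "((c i)\<^sup>2)\<^sup>2 \<le> M\<^sup>2 * (c i)\<^sup>2" if "i \<in> I" for i
      unfolding power2_eq_square[of "(c i)\<^sup>2"] using that by (intro mult_right_mono c2) auto
  qed simp
  finally have k': "avg (perms I) (\<lambda>p. (rank_sum I (\<lambda>i. (c i)\<^sup>2) e p - k)\<^sup>2) \<le> 9 / 2 * K ^ 4 * M\<^sup>2 * g"
    by (simp add: power_mult_distrib power_divide algebra_simps)
  define k2 where "k2 = k + g * (\<Sum>l\<in>I. (b l)\<^sup>2) / (2 * m)"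
  \<comment> \<open>Cauchy-Schwarz is spent on only one of the two factors
    \<open>(rank_sum I c b p)\<^sup>2 / m\<close>; the other is kept for the exact second moment. A
    fourth-moment computation is thereby avoided.\<close>
  have T4: "((rank_sum I c b p)\<^sup>2 / m)\<^sup>2 \<le> g * K\<^sup>2 / m * (rank_sum I c b p)\<^sup>2" if p: "p permutes I" for p
  proof -
    have "(rank_sum I c b p)\<^sup>2 \<le> g * (\<Sum>i\<in>I. (b (p i))\<^sup>2)"
      unfolding rank_sum_def g_def by (rule Cauchy_Schwarz_ineq_sum)
    also have "(\<Sum>i\<in>I. (b (p i))\<^sup>2) = (\<Sum>i\<in>I. (b i)\<^sup>2)" using sum_comp_perm[OF p, of "\<lambda>l. (b l)\<^sup>2"] .
    also have "g * (\<Sum>i\<in>I. (b i)\<^sup>2) \<le> g * (m * K\<^sup>2)"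
      using sum_bounded_above[of I "\<lambda>i. (b i)\<^sup>2"] b2 g0 by (intro mult_left_mono) (auto simp: m_def)
    finally have "(rank_sum I c b p)\<^sup>2 / m \<le> g * K\<^sup>2" using m by (simp add: field_simps)
    then have "(rank_sum I c b p)\<^sup>2 / m * ((rank_sum I c b p)\<^sup>2 / m) \<le> g * K\<^sup>2 * ((rank_sum I c b p)\<^sup>2 / m)"
      using m by (intro mult_right_mono) auto
    then show ?thesis by (simp add: power2_eq_square mult_ac)
  qed
  have "avg (perms I) (\<lambda>p. ((rank_sum I c b p)\<^sup>2 / m)\<^sup>2) \<le> avg (perms I) (\<lambda>p. g * K\<^sup>2 / m * (rank_sum I c b p)\<^sup>2)"
    using T4 by (intro avg_mono) auto
  also have "\<dots> = g * K\<^sup>2 / m * (g * var I b)"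
    unfolding avg_cmult avg_rank_sum_sq[OF I c] g_def ..
  also have "\<dots> \<le> g * K\<^sup>2 / m * ((m * M\<^sup>2) * (2 * K\<^sup>2))"
    using m g0 gM by (intro mult_left_mono mult_mono var_le_bounded I b var_nonneg) auto
  also have "\<dots> = 2 * K ^ 4 * M\<^sup>2 * g" using m by (simp add: power2_eq_square eval_nat_numeral)
  finally have T: "avg (perms I) (\<lambda>p. ((rank_sum I c b p)\<^sup>2 / m)\<^sup>2) \<le> 2 * K ^ 4 * M\<^sup>2 * g" .
  define mu where "mu = g * var I b"
  have mu: "avg (perms I) (cond_var I c b) = mu" by (simp add: mu_def g_def avg_cond_var[OF I c])
  have fin: "finite (perms I)" by (simp add: I finite_permutations)
  \<comment> \<open>The mean minimises the mean square deviation, so the convenient centre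
    \<open>k2\<close> may replace \<open>mu\<close> in an upper bound.\<close>
  have sq: "(cond_var I c b p - k2)\<^sup>2 = (cond_var I c b p - mu)\<^sup>2 + (2 * (mu - k2) * (cond_var I c b p - mu) + (mu - k2)\<^sup>2)" for p
    by (simp add: power2_eq_square algebra_simps)
  have "avg (perms I) (\<lambda>p. (cond_var I c b p - k2)\<^sup>2) = avg (perms I) (\<lambda>p. (cond_var I c b p - mu)\<^sup>2) + (mu - k2)\<^sup>2"
    unfolding sq avg_add avg_cmult avg_diff mu
    unfolding avg_const[OF fin perms_nonempty] by simp
  then have "avg (perms I) (\<lambda>p. (cond_var I c b p - mu)\<^sup>2) \<le> avg (perms I) (\<lambda>p. (cond_var I c b p - k2)\<^sup>2)"
    by simp
  also have "\<dots> \<le> avg (perms I) (\<lambda>p. 2 * (rank_sum I (\<lambda>i. (c i)\<^sup>2) e p - k)\<^sup>2 + 2 * ((rank_sum I c b p)\<^sup>2 / m)\<^sup>2)"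
  proof (intro avg_mono)
    fix p assume "p \<in> perms I"
    then have "cond_var I c b p - k2 = (rank_sum I (\<lambda>i. (c i)\<^sup>2) e p - k) + (rank_sum I c b p)\<^sup>2 / m"
      using cond_var_eq[OF I False c, of p b] by (simp add: k2_def e_def[abs_def] m_def g_def)
    moreover have "(x + y)\<^sup>2 \<le> 2 * x\<^sup>2 + 2 * y\<^sup>2" for x y :: real
      using zero_le_power2[of "x - y"] by (simp add: power2_eq_square algebra_simps)
    ultimately show "(cond_var I c b p - k2)\<^sup>2 \<le> 2 * (rank_sum I (\<lambda>i. (c i)\<^sup>2) e p - k)\<^sup>2 + 2 * ((rank_sum I c b p)\<^sup>2 / m)\<^sup>2"
      by metis
  qed
  also have "\<dots> \<le> 2 * (9 / 2 * K ^ 4 * M\<^sup>2 * g) + 2 * (2 * K ^ 4 * M\<^sup>2 * g)"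
    unfolding avg_add avg_cmult by (intro add_mono mult_left_mono k' T) auto
  finally show ?thesis by (simp add: mu_def g_def mult_ac)
qed (simp add: cond_var_def avg_def)

section \<open>Stein's method for stratified rank sums\<close>

lemma avg_scaleR: "avg P (\<lambda>p. a *\<^sub>R f p) = a *\<^sub>R avg P f"
  by (simp add: avg_def scaleR_sum_right mult.commute)

section \<open>Independence of the coordinates of a uniform point of a product\<close>

lemma avg_prod_PiE:
  fixes F :: "'s \<Rightarrow> 'a \<Rightarrow> real"
  assumes "finite A" "\<And>s. s \<in> A \<Longrightarrow> finite (B s)"
  shows "avg (PiE A B) (\<lambda>p. \<Prod>s\<in>A. F s (p s)) = (\<Prod>s\<in>A. avg (B s) (F s))"
  using assms by (simp add: avg_def prod_sum_PiE card_PiE prod_dividef)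

text \<open>The integrand is read as a product over all coordinates in which every factor but one is
  the constant 1; \<open>avg_PiE_components\<close> uses the same device with two proper
  factors.\<close>

lemma avg_PiE_component:
  fixes f :: "'a \<Rightarrow> real"
  assumes A: "finite A" and B: "\<And>s. s \<in> A \<Longrightarrow> finite (B s)" "\<And>s. s \<in> A \<Longrightarrow> B s \<noteq> {}" and s: "s \<in> A"
  shows "avg (PiE A B) (\<lambda>p. f (p s)) = avg (B s) f"
proof -
  have "avg (PiE A B) (\<lambda>p. f (p s)) = avg (PiE A B) (\<lambda>p. \<Prod>x\<in>A. if x = s then f (p x) else 1)"
    using A s by (intro avg_cong) (simp add: prod.delta)
  also have "\<dots> = (\<Prod>x\<in>A. avg (B x) (\<lambda>y. if x = s then f y else 1))"
    by (rule avg_prod_PiE[OF A B(1)])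
  also have "\<dots> = (\<Prod>x\<in>A. if x = s then avg (B x) f else 1)"
    by (intro prod.cong) (auto simp: avg_const B)
  finally show ?thesis using A s by (simp add: prod.delta)
qed

lemma avg_PiE_components:
  fixes f g :: "'a \<Rightarrow> real" and s t :: 's
  assumes A: "finite A" and B: "\<And>s. s \<in> A \<Longrightarrow> finite (B s)" "\<And>s. s \<in> A \<Longrightarrow> B s \<noteq> {}" 
    and s: "s \<in> A" "t \<in> A" "s \<noteq> t"
  shows "avg (PiE A B) (\<lambda>p. f (p s) * g (p t)) = avg (B s) f * avg (B t) g"
proof -
  have *: "(\<Prod>x\<in>A. if x = s then F x else if x = t then G x else 1) = F s * G t" for F G :: "'s \<Rightarrow> real"
  proof -
    have "(\<Prod>x\<in>A. if x = s then F x else if x = t then G x else 1) 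
      = (\<Prod>x\<in>A. (if x = s then F x else 1) * (if x = t then G x else 1))"
      using s by (intro prod.cong) auto
    then show ?thesis using A s by (simp add: prod.distrib prod.delta)
  qed
  have "avg (PiE A B) (\<lambda>p. f (p s) * g (p t)) = 
     avg (PiE A B) (\<lambda>p. \<Prod>x\<in>A. (\<lambda>x y. if x = s then f y else if x = t then g y else 1) x (p x))"
    by (intro avg_cong) (simp add: *)
  also have "\<dots> = (\<Prod>x\<in>A. avg (B x) (\<lambda>y. if x = s then f y else if x = t then g y else 1))"
    by (rule avg_prod_PiE[OF A B(1)])
  also have "\<dots> = (\<Prod>x\<in>A. if x = s then avg (B x) f else if x = t then avg (B x) g else 1)"
    by (intro prod.cong) (auto simp: avg_const B)
  finally show ?thesis by (simp add: *)
qed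

lemma avg_PiE_sum_sq:
  fixes f :: "'s \<Rightarrow> 'a \<Rightarrow> real"
  assumes A: "finite A" and B: "\<And>s. s \<in> A \<Longrightarrow> finite (B s)" "\<And>s. s \<in> A \<Longrightarrow> B s \<noteq> {}" 
    and f: "\<And>s. s \<in> A \<Longrightarrow> avg (B s) (f s) = 0"
  shows "avg (PiE A B) (\<lambda>p. (\<Sum>s\<in>A. f s (p s))\<^sup>2) = (\<Sum>s\<in>A. avg (B s) (\<lambda>y. (f s y)\<^sup>2))"
proof -
  have "avg (PiE A B) (\<lambda>p. (\<Sum>s\<in>A. f s (p s))\<^sup>2) = (\<Sum>s\<in>A. \<Sum>t\<in>A. avg (PiE A B) (\<lambda>p. f s (p s) * f t (p t)))"
    by (simp add: power2_eq_square sum_product avg_sum)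
  also have "\<dots> = (\<Sum>s\<in>A. \<Sum>t\<in>A. if t = s then avg (B s) (\<lambda>y. (f s y)\<^sup>2) else 0)"
  proof (intro sum.cong refl)
    fix s t assume "s \<in> A" "t \<in> A"
    then show "avg (PiE A B) (\<lambda>p. f s (p s) * f t (p t)) = (if t = s then avg (B s) (\<lambda>y. (f s y)\<^sup>2) else 0)"
      using avg_PiE_component[OF A B, where f = "\<lambda>y. (f s y)\<^sup>2" and s = s] 
        avg_PiE_components[OF A B, where s = s and t = t and f = "f s" and g = "f t"] f
      by (auto simp: power2_eq_square)
  qed
  finally show ?thesis using A by (simp add: sum.delta)
qed

text \<open>First-order Taylor bound at \<open>- x\<close>, the sign with which the increment enters
  \<open>iexp\<close> after a transposition.\<close>

lemma iexp_approx2_le: "cmod (1 - iexp (- x) - \<i> * complex_of_real x) \<le> x\<^sup>2 / 2"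
  using iexp_approx1[of "- x" 1] by (simp add: atMost_Suc norm_minus_commute algebra_simps power2_eq_square)

lemma cmod_iexp [simp]: "cmod (iexp x) = 1"
  by simp

text \<open>The scores are a parameter without any bound, while \<open>PP\<close> depends on
  \<open>A\<close> and \<open>I\<close> only. Hence full scores, truncated scores and the remainder
  can be compared on the same set of permutations.\<close>

locale strata =
  fixes A :: "'s set" and I :: "'s \<Rightarrow> 'a set" and c b :: "'s \<Rightarrow> 'a \<Rightarrow> real"
  assumes fin_A: "finite A" and fin_I: "\<And>s. s \<in> A \<Longrightarrow> finite (I s)"
    and c0: "\<And>s. s \<in> A \<Longrightarrow> (\<Sum>i\<in>I s. c s i) = 0"
begin

definition PP where "PP = PiE A (\<lambda>s. perms (I s))"
definition T where "T p = (\<Sum>s\<in>A. rank_sum (I s) (c s) (b s) (p s))"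
definition V where "V p = (\<Sum>s\<in>A. cond_var (I s) (c s) (b s) (p s))"
definition gam where "gam = (\<Sum>s\<in>A. \<Sum>i\<in>I s. (c s i)\<^sup>2)"
definition sig2 where "sig2 = (\<Sum>s\<in>A. (\<Sum>i\<in>I s. (c s i)\<^sup>2) * var (I s) (b s))"

lemma fin_perms: "s \<in> A \<Longrightarrow> finite (perms (I s))"
  using fin_I by (simp add: finite_permutations)

lemma finite_PP: "finite PP"
  unfolding PP_def by (intro finite_PiE fin_A fin_perms)

lemma PP_nonempty: "PP \<noteq> {}"
  unfolding PP_def PiE_eq_empty_iff using perms_nonempty by blast

lemma gam_nonneg: "0 \<le> gam"
  by (simp add: gam_def sum_nonneg)

lemma sig2_nonneg: "0 \<le> sig2"
  by (simp add: sig2_def sum_nonneg var_nonneg)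

lemma avg_component: "s \<in> A \<Longrightarrow> avg PP (\<lambda>p. f (p s)) = avg (perms (I s)) f" for f :: "_ \<Rightarrow> real"
  unfolding PP_def by (rule avg_PiE_component[OF fin_A fin_perms perms_nonempty])

lemma avg_T_sq: "avg PP (\<lambda>p. (T p)\<^sup>2) = sig2"
  unfolding PP_def T_def sig2_def
  by (subst avg_PiE_sum_sq[OF fin_A fin_perms perms_nonempty avg_rank_sum[OF fin_I c0]])
    (auto simp: avg_rank_sum_sq[OF fin_I c0])

lemma avg_V: "avg PP V = sig2"
  unfolding V_def[abs_def] sig2_def by (simp add: avg_sum avg_component avg_cond_var fin_I c0)

text \<open>The strata are independent, so the variances of the \<open>cond_var\<close> add up, and
  the squared coefficients of the single strata combine to \<open>gam\<close>. Neither the number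
  nor the sizes of the strata enter the bound.\<close>

lemma avg_abs_V:
  assumes b: "\<And>s l. s \<in> A \<Longrightarrow> l \<in> I s \<Longrightarrow> \<bar>b s l\<bar> \<le> K" 
    and M: "\<And>s i. s \<in> A \<Longrightarrow> i \<in> I s \<Longrightarrow> \<bar>c s i\<bar> \<le> M"
  shows "avg PP (\<lambda>p. \<bar>V p - sig2\<bar>) \<le> sqrt (13 * K ^ 4 * M\<^sup>2 * gam)"
proof -
  let ?v = "\<lambda>s. (\<Sum>i\<in>I s. (c s i)\<^sup>2) * var (I s) (b s)"
  let ?f = "\<lambda>s q. cond_var (I s) (c s) (b s) q - ?v s"
  have "avg (perms (I s)) (?f s) = 0" if "s \<in> A" for s
    using that by (simp add: avg_diff avg_cond_var fin_I c0 avg_const[OF fin_perms perms_nonempty])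
  then have "avg PP (\<lambda>p. (\<Sum>s\<in>A. ?f s (p s))\<^sup>2) = (\<Sum>s\<in>A. avg (perms (I s)) (\<lambda>q. (?f s q)\<^sup>2))"
    unfolding PP_def by (intro avg_PiE_sum_sq fin_A fin_perms perms_nonempty)
  also have "\<dots> \<le> (\<Sum>s\<in>A. 13 * K ^ 4 * M\<^sup>2 * (\<Sum>i\<in>I s. (c s i)\<^sup>2))"
    by (intro sum_mono variance_cond_var fin_I c0 b M)
  also have "\<dots> = 13 * K ^ 4 * M\<^sup>2 * gam"
    by (simp add: gam_def sum_distrib_left)
  finally have "avg PP (\<lambda>p. (V p - sig2)\<^sup>2) \<le> 13 * K ^ 4 * M\<^sup>2 * gam"
    by (simp add: V_def sig2_def sum_subtractf)
  then have "sqrt (avg PP (\<lambda>p. (V p - sig2)\<^sup>2)) \<le> sqrt (13 * K ^ 4 * M\<^sup>2 * gam)"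
    by simp
  with avg_abs_le[of PP "\<lambda>p. V p - sig2"] show ?thesis by linarith
qed

lemma bij_betw_PP_swap:
  assumes s: "s \<in> A" and ij: "i \<in> I s" "j \<in> I s"
  shows "bij_betw (\<lambda>p. p(s := p s \<circ> swap i j)) PP PP"
proof (rule bij_betw_involution)
  fix p assume p: "p \<in> PP"
  have "p s \<circ> swap i j \<in> perms (I s)"
    using p s ij by (auto simp: PP_def PiE_iff intro!: permutes_compose permutes_swap_id)
  then show "p(s := p s \<circ> swap i j) \<in> PP"
    using p s by (auto simp: PP_def PiE_iff extensional_def)
qed (simp add: comp_assoc)

lemma T_swap:
  assumes s: "s \<in> A" and ij: "i \<in> I s" "j \<in> I s"
  shows "T (p(s := p s \<circ> swap i j)) = T p - pair_diff (c s) (b s) i j (p s)"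
proof -
  have "(\<Sum>t\<in>A - {s}. rank_sum (I t) (c t) (b t) ((p(s := p s \<circ> swap i j)) t)) = 
    (\<Sum>t\<in>A - {s}. rank_sum (I t) (c t) (b t) (p t))"
    by (intro sum.cong) auto
  then show ?thesis
    unfolding T_def sum.remove[OF fin_A s] 
    by (simp add: rank_sum_swap[OF fin_I[OF s] ij])
qed

text \<open>\<open>avg_antisymmetric\<close> replaces each \<open>pair_diff\<close> times
  \<open>g\<close> by half of \<open>pair_diff\<close> times the increment of \<open>g\<close>,
  whose first-order part is \<open>\<i> * u * pair_diff * g\<close>; this part sums to the term with
  \<open>V\<close>. The error per pair is at most
  \<open>\<bar>D\<bar> * (u * D)\<^sup>2 / 2\<close>, and
  \<open>\<bar>D\<bar> \<le> 4 * K * M\<close>, so the weights \<open>1 / (4 * m s)\<close> rebuild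
  \<open>2 * K * M * u\<^sup>2\<close> times the mean of \<open>V\<close>.\<close>

lemma Stein_identity_approx:
  assumes b: "\<And>s l. s \<in> A \<Longrightarrow> l \<in> I s \<Longrightarrow> \<bar>b s l\<bar> \<le> K" 
    and M: "\<And>s i. s \<in> A \<Longrightarrow> i \<in> I s \<Longrightarrow> \<bar>c s i\<bar> \<le> M"
  defines "g \<equiv> \<lambda>u p. iexp (u * T p)"
  shows "cmod (avg PP (\<lambda>p. T p *\<^sub>R g u p) - (\<i> * of_real u) * avg PP (\<lambda>p. V p *\<^sub>R g u p)) \<le> 2 * K * M * u\<^sup>2 * sig2"
proof -
  define D where "D s i j p = pair_diff (c s) (b s) i j (p s)" for s i j and p :: "'s \<Rightarrow> 'a \<Rightarrow> 'a"
  define m where "m s = real (card (I s))" for s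
  define h where "h s i j p = p(s := p s \<circ> swap i j)" for s i j and p :: "'s \<Rightarrow> 'a \<Rightarrow> 'a"
  have T: "T p = (\<Sum>s\<in>A. \<Sum>i\<in>I s. \<Sum>j\<in>I s. 1 / (2 * m s) * D s i j p)" for p
    unfolding T_def
    by (intro sum.cong refl) (simp add: rank_sum_eq_pair_diff fin_I c0 D_def m_def sum_divide_distrib)
  have V: "V p = (\<Sum>s\<in>A. \<Sum>i\<in>I s. \<Sum>j\<in>I s. 1 / (4 * m s) * (D s i j p)\<^sup>2)" for p
    unfolding V_def
    by (intro sum.cong refl) (simp add: cond_var_def D_def m_def sum_divide_distrib)
  \<comment> \<open>The Taylor remainder of one transposition, already multiplied by the
    antisymmetric weight \<open>D\<close>.\<close>
  define R where "R s i j p = D s i j p *\<^sub>R (g u p - g u (h s i j p) - (\<i> * of_real (u * D s i j p)) * g u p)" for s i j p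
  have st: "avg PP (\<lambda>p. D s i j p *\<^sub>R g u p) = (1/2) *\<^sub>R avg PP (\<lambda>p. D s i j p *\<^sub>R (g u p - g u (h s i j p)))"
    if "s \<in> A" "i \<in> I s" "j \<in> I s" for s i j
    unfolding h_def using avg_antisymmetric[OF bij_betw_PP_swap[OF that], of "D s i j" "g u"]
    by (simp add: D_def pair_diff_swap)
  have "avg PP (\<lambda>p. T p *\<^sub>R g u p) = (\<Sum>s\<in>A. \<Sum>i\<in>I s. \<Sum>j\<in>I s. (1 / (2 * m s)) *\<^sub>R avg PP (\<lambda>p. D s i j p *\<^sub>R g u p))"
    unfolding T scaleR_sum_left scaleR_scaleR[symmetric] avg_sum avg_scaleR ..
  also have "\<dots> = (\<Sum>s\<in>A. \<Sum>i\<in>I s. \<Sum>j\<in>I s. (1 / (4 * m s)) *\<^sub>R avg PP (\<lambda>p. D s i j p *\<^sub>R (g u p - g u (h s i j p))))"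
    by (intro sum.cong refl) (simp add: st)
  finally have ET: "avg PP (\<lambda>p. T p *\<^sub>R g u p) = (\<Sum>s\<in>A. \<Sum>i\<in>I s. \<Sum>j\<in>I s. (1 / (4 * m s)) *\<^sub>R avg PP (\<lambda>p. D s i j p *\<^sub>R (g u p - g u (h s i j p))))" .
  have EV: "(\<i> * of_real u) * avg PP (\<lambda>p. V p *\<^sub>R g u p) = 
     (\<Sum>s\<in>A. \<Sum>i\<in>I s. \<Sum>j\<in>I s. (1 / (4 * m s)) *\<^sub>R avg PP (\<lambda>p. (\<i> * of_real u) * ((D s i j p)\<^sup>2 *\<^sub>R g u p)))"
    unfolding V scaleR_sum_left scaleR_scaleR[symmetric] avg_sum avg_scaleR avg_cmult
    by (simp add: sum_distrib_left)
  have "cmod (avg PP (\<lambda>p. T p *\<^sub>R g u p) - (\<i> * of_real u) * avg PP (\<lambda>p. V p *\<^sub>R g u p)) = 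
    cmod (\<Sum>s\<in>A. \<Sum>i\<in>I s. \<Sum>j\<in>I s. (1 / (4 * m s)) *\<^sub>R avg PP (R s i j))"
    unfolding ET EV sum_subtractf[symmetric] scaleR_diff_right[symmetric] avg_diff[symmetric]
    by (intro arg_cong[of _ _ cmod] sum.cong arg_cong2[of _ _ _ _ scaleR] avg_cong refl) 
       (simp add: R_def power2_eq_square scaleR_conv_of_real algebra_simps)
  also have "\<dots> \<le> (\<Sum>s\<in>A. \<Sum>i\<in>I s. \<Sum>j\<in>I s. 1 / (4 * m s) * (2 * K * M * u\<^sup>2 * avg PP (\<lambda>p. (D s i j p)\<^sup>2)))"
  proof (intro order.trans[OF norm_sum] sum_mono)
    fix s i j assume s: "s \<in> A" and ij: "i \<in> I s" "j \<in> I s"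
    have "cmod (avg PP (R s i j)) \<le> avg PP (\<lambda>p. cmod (R s i j p))" by (rule norm_avg_le)
    also have "\<dots> \<le> avg PP (\<lambda>p. 2 * K * M * u\<^sup>2 * (D s i j p)\<^sup>2)"
    proof (rule avg_mono)
      fix p assume p: "p \<in> PP"
      have ps: "p s permutes I s" using p s by (auto simp: PP_def PiE_iff)
      have "T (h s i j p) = T p - D s i j p" unfolding h_def D_def by (rule T_swap[OF s ij])
      then have "g u (h s i j p) = g u p * iexp (- (u * D s i j p))"
        unfolding g_def by (simp only: exp_add[symmetric]) (simp add: algebra_simps)
      then have "g u p - g u (h s i j p) - (\<i> * of_real (u * D s i j p)) * g u p
         = g u p * (1 - iexp (- (u * D s i j p)) - \<i> * of_real (u * D s i j p))"
        by (simp add: algebra_simps)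
      then have "cmod (g u p - g u (h s i j p) - (\<i> * of_real (u * D s i j p)) * g u p) = 
         cmod (1 - iexp (- (u * D s i j p)) - \<i> * of_real (u * D s i j p))"
        by (simp add: norm_mult g_def)
      also have "\<dots> \<le> (u * D s i j p)\<^sup>2 / 2"
        by (rule iexp_approx2_le)
      finally have 1: "cmod (R s i j p) \<le> \<bar>D s i j p\<bar> * ((u * D s i j p)\<^sup>2 / 2)"
        unfolding R_def norm_scaleR by (intro mult_left_mono) auto
      have "\<bar>c s i - c s j\<bar> \<le> 2 * M" using M[OF s ij(1)] M[OF s ij(2)] by linarith
      moreover have "\<bar>b s (p s i) - b s (p s j)\<bar> \<le> 2 * K" 
        using b[OF s, of "p s i"] b[OF s, of "p s j"] ij by (simp add: permutes_in_image[OF ps])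
      ultimately have "\<bar>D s i j p\<bar> \<le> (2 * M) * (2 * K)"
        unfolding D_def pair_diff_def abs_mult by (intro mult_mono) auto
      then have "\<bar>D s i j p\<bar> * ((u * D s i j p)\<^sup>2 / 2) \<le> (2 * M) * (2 * K) * ((u * D s i j p)\<^sup>2 / 2)"
        by (intro mult_right_mono) auto
      with 1 show "cmod (R s i j p) \<le> 2 * K * M * u\<^sup>2 * (D s i j p)\<^sup>2"
        by (simp add: power_mult_distrib mult_ac)
    qed
    finally have "cmod (avg PP (R s i j)) \<le> 2 * K * M * u\<^sup>2 * avg PP (\<lambda>p. (D s i j p)\<^sup>2)"
      by (simp add: avg_cmult)
    then have "1 / (4 * m s) * cmod (avg PP (R s i j)) \<le> 1 / (4 * m s) * (2 * K * M * u\<^sup>2 * avg PP (\<lambda>p. (D s i j p)\<^sup>2))"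
      by (intro mult_left_mono) (auto simp: m_def)
    then show "cmod ((1 / (4 * m s)) *\<^sub>R avg PP (R s i j)) \<le> 1 / (4 * m s) * (2 * K * M * u\<^sup>2 * avg PP (\<lambda>p. (D s i j p)\<^sup>2))"
      by (simp add: m_def)
  qed
  also have "\<dots> = 2 * K * M * u\<^sup>2 * (\<Sum>s\<in>A. \<Sum>i\<in>I s. \<Sum>j\<in>I s. 1 / (4 * m s) * avg PP (\<lambda>p. (D s i j p)\<^sup>2))"
    by (simp add: sum_distrib_left mult_ac)
  also have "\<dots> = 2 * K * M * u\<^sup>2 * avg PP V"
    unfolding V[abs_def] avg_sum avg_cmult ..
  finally show ?thesis by (simp add: avg_V)
qed

text \<open>The direction is absorbed into the coefficients, so the differential equation is
  integrated from \<open>u = 0\<close> to \<open>u = 1\<close> only. The integrating factor grows to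
  at most \<open>exp (sig2 / 2)\<close>, and dividing by it at the end cancels this growth, so the
  final error is the bound on the differential equation itself.\<close>

theorem char_fun_bound:
  assumes b: "\<And>s l. s \<in> A \<Longrightarrow> l \<in> I s \<Longrightarrow> \<bar>b s l\<bar> \<le> K" 
    and M: "\<And>s i. s \<in> A \<Longrightarrow> i \<in> I s \<Longrightarrow> \<bar>c s i\<bar> \<le> M" and KM: "0 \<le> K" "0 \<le> M"
  shows "cmod (avg PP (\<lambda>p. iexp (T p)) - exp (- sig2 / 2)) \<le> 2 * K * M * sig2 + sqrt (13 * K ^ 4 * M\<^sup>2 * gam)"
proof -
  define g where "g u p = iexp (u * T p)" for u p
  define psi where "psi u = avg PP (g u)" for u
  define psi' where "psi' u = \<i> * avg PP (\<lambda>p. T p *\<^sub>R g u p)" for u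
  define B where "B = 2 * K * M * sig2 + sqrt (13 * K ^ 4 * M\<^sup>2 * gam)"
  have B0: "0 \<le> B" unfolding B_def using KM sig2_nonneg gam_nonneg by simp
  have g': "((\<lambda>u. g u p) has_vector_derivative \<i> * T p *\<^sub>R g u p) (at u)" for p u
  proof -
    have "((\<lambda>x. exp (\<i> * of_real (T p) * x)) has_field_derivative \<i> * of_real (T p) * exp (\<i> * of_real (T p) * of_real u)) (at (of_real u))"
      by (auto intro!: derivative_eq_intros)
    from has_vector_derivative_real_field[OF this] show ?thesis
      by (simp add: g_def scaleR_conv_of_real mult_ac)
  qed
  have psi: "(psi has_vector_derivative psi' u) (at u)" for u
  proof -
    have "(psi has_vector_derivative (1 / real (card PP)) *\<^sub>R (\<Sum>p\<in>PP. \<i> * T p *\<^sub>R g u p)) (at u)"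
      unfolding psi_def[abs_def] avg_def
      by (intro bounded_linear.has_vector_derivative[OF bounded_linear_scaleR_right] has_vector_derivative_sum g')
    moreover have "(1 / real (card PP)) *\<^sub>R (\<Sum>p\<in>PP. \<i> * T p *\<^sub>R g u p) = psi' u"
      unfolding psi'_def avg_def sum_distrib_left[symmetric] by (simp only: mult_scaleR_right)
    ultimately show ?thesis by (simp only:)
  qed
  \<comment> \<open>Stein's identity with \<open>V\<close> replaced by its mean; the replacement
    costs the mean of \<open>\<bar>V p - sig2\<bar>\<close>, because \<open>g\<close> has modulus
    1.\<close>
  have bound: "cmod (psi' u + of_real (sig2 * u) * psi u) \<le> B" if u: "0 \<le> u" "u \<le> 1" for u
  proof -
    have "cmod (psi' u + of_real (sig2 * u) * psi u) = cmod (\<i> * (avg PP (\<lambda>p. T p *\<^sub>R g u p) - (\<i> * of_real u) * avg PP (\<lambda>p. V p *\<^sub>R g u p))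
        - of_real u * (avg PP (\<lambda>p. V p *\<^sub>R g u p) - of_real sig2 * psi u))"
    proof -
      have "\<i> * X + s * u' * q = \<i> * (X - (\<i> * u') * Y) - u' * (Y - s * q)" for X Y s q u' :: complex
        by (simp add: right_diff_distrib mult.assoc[symmetric])
      then show ?thesis unfolding psi'_def of_real_mult by (rule arg_cong)
    qed
    also have "\<dots> \<le> cmod (avg PP (\<lambda>p. T p *\<^sub>R g u p) - (\<i> * of_real u) * avg PP (\<lambda>p. V p *\<^sub>R g u p)) 
        + u * cmod (avg PP (\<lambda>p. V p *\<^sub>R g u p) - of_real sig2 * psi u)"
      using u by (intro order.trans[OF norm_triangle_ineq4]) (simp add: norm_mult)
    also have "\<dots> \<le> 2 * K * M * u\<^sup>2 * sig2 + 1 * sqrt (13 * K ^ 4 * M\<^sup>2 * gam)"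
    proof (rule add_mono[OF _ mult_mono])
      show "cmod (avg PP (\<lambda>p. T p *\<^sub>R g u p) - (\<i> * of_real u) * avg PP (\<lambda>p. V p *\<^sub>R g u p)) \<le> 2 * K * M * u\<^sup>2 * sig2"
        unfolding g_def by (rule Stein_identity_approx; fact b M)
      have "cmod (avg PP (\<lambda>p. V p *\<^sub>R g u p) - of_real sig2 * psi u) = cmod (avg PP (\<lambda>p. (V p - sig2) *\<^sub>R g u p))"
        unfolding psi_def avg_cmult[symmetric] avg_diff[symmetric]
        by (intro arg_cong[of _ _ cmod] avg_cong) (simp add: scaleR_conv_of_real left_diff_distrib)
      also have "\<dots> \<le> avg PP (\<lambda>p. cmod ((V p - sig2) *\<^sub>R g u p))" by (rule norm_avg_le)
      also have "\<dots> = avg PP (\<lambda>p. \<bar>V p - sig2\<bar>)"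
        by (intro avg_cong) (simp add: g_def)
      also have "\<dots> \<le> sqrt (13 * K ^ 4 * M\<^sup>2 * gam)"
        by (rule avg_abs_V; fact b M)
      finally show "cmod (avg PP (\<lambda>p. V p *\<^sub>R g u p) - of_real sig2 * psi u) \<le> sqrt (13 * K ^ 4 * M\<^sup>2 * gam)" .
    qed (use u in auto)
    also have "\<dots> \<le> B"
    proof -
      have "u\<^sup>2 \<le> 1" using u by (simp add: power_le_one)
      then have "2 * K * M * u\<^sup>2 * sig2 \<le> 2 * K * M * 1 * sig2"
        using KM sig2_nonneg by (intro mult_right_mono mult_left_mono) auto
      then show ?thesis by (simp add: B_def)
    qed
    finally show ?thesis .
  qed
  \<comment> \<open>\<open>psi\<close> solves \<open>psi' = - sig2 u psi\<close> up to \<open>B\<close>; \<open>G\<close> contains the integrating factor.\<close>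
  define G where "G u = exp (sig2 * u\<^sup>2 / 2) *\<^sub>R psi u" for u
  have G': "(G has_vector_derivative exp (sig2 * u\<^sup>2 / 2) *\<^sub>R (psi' u + of_real (sig2 * u) * psi u)) (at u)" for u
    unfolding G_def[abs_def]
    by (rule has_vector_derivative_eq_rhs, rule has_vector_derivative_scaleR[OF _ psi])
       (auto intro!: derivative_eq_intros simp: scaleR_conv_of_real algebra_simps)
  \<comment> \<open>\<open>G\<close> is complex-valued, so only the norm form of the mean value
    theorem is available; it suffices because only a bound on \<open>G 1 - G 0\<close> is
    wanted.\<close>
  have "\<exists>x\<in>{0<..<1}. norm (G 1 - G 0) \<le> norm ((1 - 0) *\<^sub>R (exp (sig2 * x\<^sup>2 / 2) *\<^sub>R (psi' x + of_real (sig2 * x) * psi x)))"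
  proof (rule mvt_general)
    show "continuous_on {0..1} G"
      by (intro continuous_at_imp_continuous_on ballI has_vector_derivative_continuous[OF G'])
    show "(G has_derivative (\<lambda>h. h *\<^sub>R (exp (sig2 * x\<^sup>2 / 2) *\<^sub>R (psi' x + of_real (sig2 * x) * psi x)))) (at x)" for x
      using G' by (simp add: has_vector_derivative_def)
  qed simp
  then obtain x where x: "0 < x" "x < 1" "norm (G 1 - G 0) \<le> exp (sig2 * x\<^sup>2 / 2) * cmod (psi' x + of_real (sig2 * x) * psi x)"
    by auto
  have "sig2 * x\<^sup>2 \<le> sig2 * 1"
    using x sig2_nonneg by (intro mult_left_mono) (auto simp: power_le_one)
  then have "exp (sig2 * x\<^sup>2 / 2) * cmod (psi' x + of_real (sig2 * x) * psi x) \<le> exp (sig2 / 2) * B"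
    using x by (intro mult_mono bound) auto
  with x have "cmod (G 1 - G 0) \<le> exp (sig2 / 2) * B" by linarith
  moreover have "G 0 = 1" 
    using avg_const[OF finite_PP PP_nonempty, of "1::complex"] by (simp add: G_def psi_def g_def[abs_def])
  ultimately have "cmod (exp (sig2 / 2) *\<^sub>R psi 1 - 1) \<le> exp (sig2 / 2) * B"
    by (simp add: G_def)
  then have "exp (- sig2 / 2) * cmod (exp (sig2 / 2) *\<^sub>R psi 1 - 1) \<le> exp (- sig2 / 2) * (exp (sig2 / 2) * B)"
    by (intro mult_left_mono) auto
  also have "\<dots> = B" by (simp add: exp_minus)
  also have "exp (- sig2 / 2) * cmod (exp (sig2 / 2) *\<^sub>R psi 1 - 1) = cmod (exp (- sig2 / 2) *\<^sub>R (exp (sig2 / 2) *\<^sub>R psi 1 - 1))"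
    by simp
  also have "exp (- sig2 / 2) *\<^sub>R (exp (sig2 / 2) *\<^sub>R psi 1 - 1) = psi 1 - exp (- sig2 / 2)"
    by (simp add: scaleR_diff_right exp_minus) (simp add: scaleR_conv_of_real)
  finally show ?thesis by (simp add: psi_def g_def[abs_def] B_def)
qed

end

section \<open>Truncation of the scores\<close>

definition clip :: "real \<Rightarrow> real \<Rightarrow> real" where
  "clip K x = max (- K) (min K x)"

lemma abs_clip_le: "0 \<le> K \<Longrightarrow> \<bar>clip K x\<bar> \<le> K"
  by (auto simp: clip_def)

text \<open>The remainder \<open>x - clip K x\<close> is 1-Lipschitz in \<open>x\<close>. This
  carries smallness of the remainder from \<open>\<phi>\<close> over to the step functions at the
  price of their mean square distance.\<close>

lemma clip_remainder_sq_le: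
  assumes "0 \<le> K"
  shows "(x - clip K x)\<^sup>2 \<le> 2 * (y - clip K y)\<^sup>2 + 2 * (x - y)\<^sup>2"
proof -
  have "\<bar>x - clip K x\<bar> \<le> \<bar>(y - clip K y)\<bar> + \<bar>x - y\<bar>"
    using assms by (auto simp: clip_def)
  then have "\<bar>x - clip K x\<bar>\<^sup>2 \<le> (\<bar>(y - clip K y)\<bar> + \<bar>x - y\<bar>)\<^sup>2"
    by (intro power_mono) auto
  also have "\<dots> \<le> 2 * \<bar>(y - clip K y)\<bar>\<^sup>2 + 2 * \<bar>x - y\<bar>\<^sup>2"
    using zero_le_power2[of "\<bar>(y - clip K y)\<bar> - \<bar>x - y\<bar>"] by (simp add: power2_sum power2_diff)
  finally show ?thesis by simp
qed

lemma clip_remainder_sq_mono: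
  assumes "0 \<le> K" "K \<le> L"
  shows "(x - clip L x)\<^sup>2 \<le> (x - clip K x)\<^sup>2"
proof -
  have "\<bar>x - clip L x\<bar> \<le> \<bar>x - clip K x\<bar>"
    using assms by (auto simp: clip_def)
  then show ?thesis by (simp add: abs_le_square_iff)
qed

lemma measurable_clip [measurable]: "clip K \<in> borel_measurable borel"
  unfolding clip_def[abs_def] by measurable

lemma step_index:
  assumes "0 < u" "u < 1" "0 < m"
  obtains k where "k \<in> {1..m}" "real k = of_int \<lfloor>u * real m\<rfloor> + 1"
proof
  have fl: "0 \<le> \<lfloor>u * real m\<rfloor>" using assms by simp
  have "u * real m < 1 * real m" using assms by (intro mult_strict_right_mono) auto
  then have "\<lfloor>u * real m\<rfloor> < int m" by (simp add: floor_less_iff)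
  then have "nat \<lfloor>u * real m\<rfloor> < m" using fl by linarith
  then show "nat \<lfloor>u * real m\<rfloor> + 1 \<in> {1..m}" by simp
  show "real (nat \<lfloor>u * real m\<rfloor> + 1) = of_int \<lfloor>u * real m\<rfloor> + 1" using fl by simp
qed

lemma integral_step_function:
  fixes F :: "real \<Rightarrow> real"
  assumes m: "0 < m"
  shows "(LINT u:{0<..<1}|lebesgue. F (\<phi> ((of_int \<lfloor>u * real m\<rfloor> + 1) / (real m + 1)))) = (\<Sum>l=1..m. F (score \<phi> m l)) / real m"
proof -
  \<comment> \<open>The step on which the floor of \<open>u * m\<close> equals \<open>l - 1\<close>.
    Removing 0 makes the steps an exact partition of the open unit interval.\<close>
  let ?J = "\<lambda>l. {(real l - 1) / real m ..< real l / real m} - {0}"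
  have J: "measure lebesgue (?J l) = 1 / real m" for l
  proof -
    have "measure lebesgue (?J l) = measure lebesgue {(real l - 1) / real m ..< real l / real m}"
      by (rule measure_Diff_null_set) auto
    also have "\<dots> = real l / real m - (real l - 1) / real m"
      by (simp add: divide_right_mono)
    also have "\<dots> = 1 / real m" by (simp add: diff_divide_distrib)
    finally show ?thesis .
  qed
  have eq: "indicator {0<..<1} u *\<^sub>R F (\<phi> ((of_int \<lfloor>u * real m\<rfloor> + 1) / (real m + 1)))
     = (\<Sum>l=1..m. indicator (?J l) u *\<^sub>R F (score \<phi> m l))" for u
  proof (cases "0 < u \<and> u < 1")
    case True
    obtain k where k: "k \<in> {1..m}" and kr: "real k = of_int \<lfloor>u * real m\<rfloor> + 1"
      using True m by (auto intro: step_index)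
    have J: "u \<in> ?J l \<longleftrightarrow> l = k" for l
    proof -
      have "u \<in> ?J l \<longleftrightarrow> real l - 1 \<le> u * real m \<and> u * real m < real l"
        using True m by (auto simp: field_simps)
      also have "\<dots> \<longleftrightarrow> \<lfloor>u * real m\<rfloor> = int l - 1"
        by (auto simp: floor_eq_iff)
      also have "\<dots> \<longleftrightarrow> l = k" using kr by linarith
      finally show ?thesis .
    qed
    have "(\<Sum>l=1..m. indicator (?J l) u *\<^sub>R F (score \<phi> m l)) = (\<Sum>l=1..m. if l = k then F (score \<phi> m l) else 0)"
      using J by (intro sum.cong) (auto simp: indicator_def)
    also have "\<dots> = F (score \<phi> m k)" using k by simp
    finally show ?thesis using True kr by (simp add: score_def)
  next
    case False
    have "u \<notin> ?J l" if "l \<in> {1..m}" for l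
    proof
      assume "u \<in> ?J l"
      then have "(real l - 1) / real m \<le> u" "u < real l / real m" "u \<noteq> 0" by auto
      moreover have "0 \<le> (real l - 1) / real m" using that by simp
      moreover have "real l / real m \<le> 1" using that m by simp
      ultimately show False using False by linarith
    qed
    then have "(\<Sum>l=1..m. indicator (?J l) u *\<^sub>R F (score \<phi> m l)) = 0"
      by (intro sum.neutral ballI) (metis indicator_simps(2) scaleR_zero_left)
    moreover have "indicator {0<..<1} u = (0::real)" using False by (auto simp: indicator_def)
    ultimately show ?thesis by simp
  qed
  have "(LINT u:{0<..<1}|lebesgue. F (\<phi> ((of_int \<lfloor>u * real m\<rfloor> + 1) / (real m + 1)))) = 
     (\<integral>u. (\<Sum>l=1..m. indicator (?J l) u *\<^sub>R F (score \<phi> m l)) \<partial>lebesgue)"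
    unfolding set_lebesgue_integral_def eq ..
  also have "\<dots> = (\<Sum>l=1..m. (\<integral>u. indicator (?J l) u *\<^sub>R F (score \<phi> m l) \<partial>lebesgue))"
  proof (rule Bochner_Integration.integral_sum)
    fix l
    have "emeasure lebesgue (?J l) \<le> emeasure lebesgue {(real l - 1) / real m .. real l / real m}"
      by (intro emeasure_mono) auto
    also have "\<dots> < \<infinity>" by (simp add: emeasure_lborel_Icc_eq)
    finally show "integrable lebesgue (\<lambda>u. indicator (?J l) u *\<^sub>R F (score \<phi> m l))"
      by (intro integrable_scaleR_left integrable_real_indicator) auto
  qed
  also have "\<dots> = (\<Sum>l=1..m. 1 / real m * F (score \<phi> m l))"
    using J by (intro sum.cong) auto
  finally show ?thesis by (simp add: sum_divide_distrib)
qed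

text \<open>Uniform integrability of the squared scores. A level \<open>K1\<close> makes the
  remainder of \<open>\<phi>\<close> at most \<open>e / 4\<close> in mean square; for
  \<open>m \<ge> m0\<close> the step function is within \<open>e / 4\<close> of
  \<open>\<phi>\<close>, and \<open>clip_remainder_sq_le\<close> doubles both. Below
  \<open>m0\<close> only finitely many scores exist, and a higher level leaves them uncut.\<close>

lemma score_truncation:
  assumes \<phi>: "score_function \<phi>" and e: "0 < e"
  obtains K where "0 \<le> K" "\<And>m. (\<Sum>l=1..m. (score \<phi> m l - clip K (score \<phi> m l))\<^sup>2) / real m \<le> e"
proof -
  define P where "P = restrict_space lebesgue {0<..<1::real}"
  have int01: "(LINT u:{0<..<1}|lebesgue. f u) = (\<integral>u. f u \<partial>P)" for f :: "real \<Rightarrow> real"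
    unfolding P_def set_lebesgue_integral_def by (subst integral_restrict_space) auto
  have fin: "finite_measure P"
    by (rule finite_measureI) (simp add: P_def space_restrict_space emeasure_restrict_space)
  interpret P: finite_measure P by fact
  have m\<phi> [measurable]: "\<phi> \<in> borel_measurable P"
    using \<phi> unfolding score_function_def set_borel_measurable_def P_def
    by (subst borel_measurable_restrict_space_iff) (auto simp: mult.commute)
  have \<phi>2: "integrable P (\<lambda>u. (\<phi> u)\<^sup>2)"
    using \<phi> unfolding score_function_def set_integrable_def P_def
    by (subst integrable_restrict_space) auto
  define step where "step m u = \<phi> ((of_int \<lfloor>u * real m\<rfloor> + 1) / (real m + 1))" for m :: nat and u :: real
  have step_lim: "(\<lambda>m. \<integral>u. (step m u - \<phi> u)\<^sup>2 \<partial>P) \<longlonglongrightarrow> 0"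
    using \<phi> unfolding score_function_def step_def int01 by blast
  have mstep [measurable]: "step m \<in> borel_measurable P" for m
  proof -
    \<comment> \<open>\<open>\<phi>\<close> is only Lebesgue measurable, but the step function
      factors through an integer, and every function on a discrete space is measurable.\<close>
    have "(\<lambda>u::real. \<lfloor>u * real m\<rfloor>) \<in> borel \<rightarrow>\<^sub>M count_space UNIV" by measurable
    then have "(\<lambda>u. (\<lambda>k. \<phi> ((of_int k + 1) / (real m + 1))) \<lfloor>u * real m\<rfloor>) \<in> borel_measurable borel"
      by (rule measurable_compose) simp
    then have "step m \<in> borel_measurable lebesgue"
      unfolding step_def[abs_def] by (auto intro: measurable_completion)
    then show ?thesis unfolding P_def by (rule measurable_restrict_space1)
  qed
  have sq_int: "integrable P (\<lambda>u. (step m u)\<^sup>2)" if "0 < m" for m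
  proof (rule P.integrable_const_bound)
    define B where "B = (\<Sum>l=1..m. (score \<phi> m l)\<^sup>2)"
    show "AE u in P. norm ((step m u)\<^sup>2) \<le> B"
    proof (rule AE_I2)
      fix u assume "u \<in> space P"
      then have u: "0 < u" "u < 1" by (auto simp: P_def space_restrict_space)
      obtain k where k: "k \<in> {1..m}" and "real k = of_int \<lfloor>u * real m\<rfloor> + 1"
        using u \<open>0 < m\<close> by (auto intro: step_index)
      then have "(step m u)\<^sup>2 = (score \<phi> m k)\<^sup>2" by (simp add: step_def score_def)
      also have "\<dots> \<le> B" unfolding B_def using k by (intro member_le_sum) auto
      finally show "norm ((step m u)\<^sup>2) \<le> B" by simp
    qed
  qed simp
  have diff_int: "integrable P (\<lambda>u. (step m u - \<phi> u)\<^sup>2)" if "0 < m" for m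
  proof (rule Bochner_Integration.integrable_bound)
    show "integrable P (\<lambda>u. 2 * (step m u)\<^sup>2 + 2 * (\<phi> u)\<^sup>2)"
      using sq_int[OF that] \<phi>2 by simp
    show "AE u in P. norm ((step m u - \<phi> u)\<^sup>2) \<le> norm (2 * (step m u)\<^sup>2 + 2 * (\<phi> u)\<^sup>2)"
    proof (rule AE_I2)
      fix u
      show "norm ((step m u - \<phi> u)\<^sup>2) \<le> norm (2 * (step m u)\<^sup>2 + 2 * (\<phi> u)\<^sup>2)"
        using zero_le_power2[of "step m u + \<phi> u"] unfolding real_norm_def abs_power2
        by (intro order.trans[OF _ abs_ge_self]) (simp add: power2_sum power2_diff)
    qed
  qed simp
  have rem_le: "(x - clip K x)\<^sup>2 \<le> x\<^sup>2" if "0 \<le> K" for K x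
    using that by (intro abs_le_square_iff[THEN iffD1]) (auto simp: clip_def)
  have rem_int: "integrable P (\<lambda>u. (\<phi> u - clip K (\<phi> u))\<^sup>2)" if "0 \<le> K" for K
    by (rule Bochner_Integration.integrable_bound[OF \<phi>2]) (use rem_le[OF that] in auto)
  have rem_step_int: "integrable P (\<lambda>u. (step m u - clip K (step m u))\<^sup>2)" if "0 \<le> K" "0 < m" for K m
    by (rule Bochner_Integration.integrable_bound[OF sq_int[OF that(2)]]) (use rem_le[OF that(1)] in auto)
  have "(\<lambda>n. \<integral>u. (\<phi> u - clip (real n) (\<phi> u))\<^sup>2 \<partial>P) \<longlonglongrightarrow> (\<integral>u. 0 \<partial>P)"
  proof (rule integral_dominated_convergence[OF _ _ \<phi>2])
    show "AE u in P. (\<lambda>n. (\<phi> u - clip (real n) (\<phi> u))\<^sup>2) \<longlonglongrightarrow> 0"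
    proof (rule AE_I2, rule tendsto_eventually)
      fix u
      have "eventually (\<lambda>n. \<bar>\<phi> u\<bar> \<le> real n) sequentially"
        using eventually_ge_at_top[of "nat \<lceil>\<bar>\<phi> u\<bar>\<rceil>"] by eventually_elim linarith
      then show "eventually (\<lambda>n. (\<phi> u - clip (real n) (\<phi> u))\<^sup>2 = 0) sequentially"
        by eventually_elim (auto simp: clip_def)
    qed
    show "AE u in P. norm ((\<phi> u - clip (real n) (\<phi> u))\<^sup>2) \<le> (\<phi> u)\<^sup>2" for n
      using rem_le[of "real n"] by auto
  qed auto
  then have "eventually (\<lambda>n. (\<integral>u. (\<phi> u - clip (real n) (\<phi> u))\<^sup>2 \<partial>P) < e / 4) sequentially"
    using e by (intro order_tendstoD(2)) auto
  then obtain K1 :: nat where K1: "(\<integral>u. (\<phi> u - clip (real K1) (\<phi> u))\<^sup>2 \<partial>P) < e / 4"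
    by (auto simp: eventually_sequentially)
  have "eventually (\<lambda>m. (\<integral>u. (step m u - \<phi> u)\<^sup>2 \<partial>P) < e / 4) sequentially"
    using e step_lim by (intro order_tendstoD(2)) auto
  then obtain m0 where m0: "\<And>m. m \<ge> m0 \<Longrightarrow> (\<integral>u. (step m u - \<phi> u)\<^sup>2 \<partial>P) < e / 4"
    by (auto simp: eventually_sequentially)
  \<comment> \<open>The double sum dominates every score of a stratum smaller than
    \<open>m0\<close>; raising the level above \<open>K1\<close> can only shrink the other
    remainders.\<close>
  define K where "K = real K1 + (\<Sum>m<m0. \<Sum>l=1..m. \<bar>score \<phi> m l\<bar>)"
  have K: "real K1 \<le> K" "0 \<le> K" unfolding K_def by (auto intro!: add_nonneg_nonneg sum_nonneg)
  show ?thesis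
  proof (rule that[OF K(2)])
    fix m :: nat
    consider "m = 0" | "0 < m" "m < m0" | "0 < m" "m0 \<le> m" by linarith
    then show "(\<Sum>l=1..m. (score \<phi> m l - clip K (score \<phi> m l))\<^sup>2) / real m \<le> e"
    proof cases
      case 1 then show ?thesis using e by simp
    next
      case 2
      have "(score \<phi> m l - clip K (score \<phi> m l))\<^sup>2 = 0" if l: "l \<in> {1..m}" for l
      proof -
        have "\<bar>score \<phi> m l\<bar> \<le> (\<Sum>l=1..m. \<bar>score \<phi> m l\<bar>)"
          using l by (intro member_le_sum) auto
        also have "\<dots> \<le> (\<Sum>m<m0. \<Sum>l=1..m. \<bar>score \<phi> m l\<bar>)"
          using 2 by (intro member_le_sum[of m "{..<m0}" "\<lambda>m. \<Sum>l=1..m. \<bar>score \<phi> m l\<bar>"] sum_nonneg) auto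
        also have "\<dots> \<le> K" by (simp add: K_def)
        finally show ?thesis by (auto simp: clip_def)
      qed
      then show ?thesis using e by simp
    next
      case 3
      have "(\<Sum>l=1..m. (score \<phi> m l - clip K (score \<phi> m l))\<^sup>2) / real m
          \<le> (\<Sum>l=1..m. (score \<phi> m l - clip (real K1) (score \<phi> m l))\<^sup>2) / real m"
        using K by (intro divide_right_mono sum_mono clip_remainder_sq_mono) auto
      also have "\<dots> = (\<integral>u. (step m u - clip (real K1) (step m u))\<^sup>2 \<partial>P)"
        using integral_step_function[OF 3(1), of "\<lambda>x. (x - clip (real K1) x)\<^sup>2" \<phi>] by (simp add: int01 step_def)
      also have "\<dots> \<le> (\<integral>u. 2 * (\<phi> u - clip (real K1) (\<phi> u))\<^sup>2 + 2 * (step m u - \<phi> u)\<^sup>2 \<partial>P)"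
        using rem_int diff_int 3 rem_step_int
        by (intro integral_mono) (auto intro!: clip_remainder_sq_le)
      also have "\<dots> = 2 * (\<integral>u. (\<phi> u - clip (real K1) (\<phi> u))\<^sup>2 \<partial>P) + 2 * (\<integral>u. (step m u - \<phi> u)\<^sup>2 \<partial>P)"
        using rem_int diff_int 3 by simp
      also have "\<dots> \<le> e" using K1 m0[OF 3(2)] by simp
      finally show ?thesis .
    qed
  qed
qed

lemma cmod_iexp_diff_le: "cmod (iexp x - iexp y) \<le> \<bar>x - y\<bar>"
proof -
  have "iexp x = iexp y * iexp (x - y)"
    by (simp only: exp_add[symmetric]) (simp add: algebra_simps)
  then have "iexp x - iexp y = iexp y * (iexp (x - y) - 1)" by (simp only: right_diff_distrib mult_1_right)
  then have "cmod (iexp x - iexp y) = cmod (iexp (x - y) - 1)" by (simp add: norm_mult)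
  also have "\<dots> \<le> \<bar>x - y\<bar>" using iexp_approx1[of "x - y" 0] by simp
  finally show ?thesis .
qed

lemma abs_exp_minus_diff_le:
  fixes x y :: real
  assumes "0 \<le> x" "0 \<le> y"
  shows "\<bar>exp (- x) - exp (- y)\<bar> \<le> \<bar>x - y\<bar>"
  using assms
proof (induction x y rule: linorder_wlog)
  case (le x y)
  have "exp (- x) - exp (- y) = exp (- x) * (1 - exp (- (y - x)))"
    by (simp add: right_diff_distrib exp_add[symmetric])
  also have "\<dots> \<le> 1 * (y - x)"
  proof (intro mult_mono)
    show "1 - exp (- (y - x)) \<le> y - x" using exp_ge_add_one_self[of "- (y - x)"] by linarith
  qed (use le in auto)
  finally show ?case using le by simp
qed (simp add: abs_minus_commute)

text \<open>The first bracket is the cost of truncation and depends on \<open>e\<close> but not on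
  \<open>K\<close> or \<open>M\<close>; the second is \<open>char_fun_bound\<close> for the clipped
  scores and tends to 0 with \<open>M\<close> once \<open>K\<close> is fixed. The second moment of
  the remainder sum is at most \<open>2 * e * G\<close>, which gives the first square root, and
  \<open>4 * K ^ 3\<close> is \<open>2 * K\<close> times the bound \<open>2 * K\<^sup>2\<close> on
  the clipped variance.\<close>

theorem (in strata) char_fun_bound_truncated:
  assumes K: "0 \<le> K" and e: "0 \<le> e"
    and trunc: "\<And>s. s \<in> A \<Longrightarrow> (\<Sum>l\<in>I s. (b s l - clip K (b s l))\<^sup>2) / real (card (I s)) \<le> e"
    and M: "\<And>s i. s \<in> A \<Longrightarrow> i \<in> I s \<Longrightarrow> \<bar>c s i\<bar> \<le> M" "0 \<le> M" and G: "gam \<le> G"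
  shows "cmod (avg PP (\<lambda>p. iexp (T p)) - exp (- sig2 / 2)) \<le> 
    (sqrt (2 * e * G) + sqrt (2 * e * G * sig2) + e * G) + (4 * K ^ 3 * M * G + sqrt (13 * K ^ 4 * M\<^sup>2 * G))"
proof -
  define b1 where "b1 s l = clip K (b s l)" for s l
  define b2 where "b2 s l = b s l - b1 s l" for s l
  interpret B1: strata A I c b1 by unfold_locales
  interpret B2: strata A I c b2 by unfold_locales
  have T: "B2.T p = T p - B1.T p" for p
    by (simp add: B1.T_def B2.T_def T_def rank_sum_def b2_def right_diff_distrib sum_subtractf)
  have "B2.sig2 \<le> (\<Sum>s\<in>A. (\<Sum>i\<in>I s. (c s i)\<^sup>2) * (2 * e))"
    unfolding B2.sig2_def
  proof (intro sum_mono mult_left_mono sum_nonneg)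
    fix s assume s: "s \<in> A"
    have "var (I s) (b2 s) \<le> 2 * ((\<Sum>l\<in>I s. (b2 s l)\<^sup>2) / real (card (I s)))"
      by (rule var_le[OF fin_I[OF s]])
    with trunc[OF s] show "var (I s) (b2 s) \<le> 2 * e" by (simp add: b2_def b1_def)
  qed simp
  also have "\<dots> = gam * (2 * e)" by (simp add: gam_def sum_distrib_right)
  also have "\<dots> \<le> G * (2 * e)" using G e by (intro mult_right_mono) auto
  finally have s2: "B2.sig2 \<le> 2 * e * G" by (simp add: mult_ac)
  have G0: "0 \<le> G" using G gam_nonneg by linarith
  have "B1.sig2 \<le> (\<Sum>s\<in>A. (\<Sum>i\<in>I s. (c s i)\<^sup>2) * (2 * K\<^sup>2))"
    unfolding B1.sig2_def
    by (intro sum_mono mult_left_mono sum_nonneg var_le_bounded fin_I) (auto simp: b1_def K abs_clip_le)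
  also have "\<dots> = gam * (2 * K\<^sup>2)" by (simp add: gam_def sum_distrib_right)
  also have "\<dots> \<le> G * (2 * K\<^sup>2)" using G by (intro mult_right_mono) auto
  finally have s1: "B1.sig2 \<le> G * (2 * K\<^sup>2)" .
  have 1: "cmod (avg PP (\<lambda>p. iexp (T p)) - avg PP (\<lambda>p. iexp (B1.T p))) \<le> sqrt (2 * e * G)"
  proof -
    have "cmod (avg PP (\<lambda>p. iexp (T p)) - avg PP (\<lambda>p. iexp (B1.T p))) = cmod (avg PP (\<lambda>p. iexp (T p) - iexp (B1.T p)))"
      unfolding avg_diff ..
    also have "\<dots> \<le> avg PP (\<lambda>p. cmod (iexp (T p) - iexp (B1.T p)))" by (rule norm_avg_le)
    also have "\<dots> \<le> avg PP (\<lambda>p. \<bar>B2.T p\<bar>)" unfolding T by (intro avg_mono cmod_iexp_diff_le)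
    also have "\<dots> \<le> sqrt (avg PP (\<lambda>p. (B2.T p)\<^sup>2))" by (rule avg_abs_le)
    also have "\<dots> \<le> sqrt (2 * e * G)" using s2 B2.avg_T_sq by simp
    finally show ?thesis .
  qed
  have 2: "cmod (avg PP (\<lambda>p. iexp (B1.T p)) - exp (- B1.sig2 / 2)) \<le> 4 * K ^ 3 * M * G + sqrt (13 * K ^ 4 * M\<^sup>2 * G)"
  proof -
    have "cmod (avg PP (\<lambda>p. iexp (B1.T p)) - exp (- B1.sig2 / 2)) \<le> 2 * K * M * B1.sig2 + sqrt (13 * K ^ 4 * M\<^sup>2 * gam)"
      by (rule B1.char_fun_bound) (use M K in \<open>simp_all add: b1_def abs_clip_le\<close>)
    also have "\<dots> \<le> 2 * K * M * (G * (2 * K\<^sup>2)) + sqrt (13 * K ^ 4 * M\<^sup>2 * G)"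
      using K M(2) G by (intro add_mono mult_left_mono s1 real_sqrt_le_mono) auto
    finally show ?thesis by (simp add: power2_eq_square power3_eq_cube mult_ac)
  qed
  \<comment> \<open>Variances of full and clipped scores are compared as second moments:
    \<open>T\<^sup>2 - B1.T\<^sup>2\<close> equals \<open>2 * (B2.T * T) - B2.T\<^sup>2\<close>, and
    Cauchy-Schwarz treats the mixed term.\<close>
  have 3: "\<bar>sig2 - B1.sig2\<bar> \<le> 2 * (sqrt (2 * e * G * sig2) + e * G)"
  proof -
    have "sig2 - B1.sig2 = avg PP (\<lambda>p. (T p)\<^sup>2 - (B1.T p)\<^sup>2)"
      using avg_T_sq B1.avg_T_sq by (simp add: avg_diff)
    also have "\<dots> = avg PP (\<lambda>p. 2 * (B2.T p * T p) - (B2.T p)\<^sup>2)"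
      by (intro avg_cong) (simp add: T power2_eq_square algebra_simps)
    also have "\<dots> = 2 * avg PP (\<lambda>p. B2.T p * T p) - B2.sig2"
      using B2.avg_T_sq by (simp add: avg_diff avg_cmult)
    finally have eq: "sig2 - B1.sig2 = 2 * avg PP (\<lambda>p. B2.T p * T p) - B2.sig2" .
    have "(avg PP (\<lambda>p. B2.T p * T p))\<^sup>2 \<le> B2.sig2 * sig2"
      using avg_Cauchy_Schwarz[of PP B2.T T] B2.avg_T_sq avg_T_sq by simp
    also have "\<dots> \<le> 2 * e * G * sig2" using s2 sig2_nonneg by (intro mult_right_mono)
    finally have "\<bar>avg PP (\<lambda>p. B2.T p * T p)\<bar> \<le> sqrt (2 * e * G * sig2)"
      by (metis real_sqrt_abs real_sqrt_le_mono)
    then show ?thesis using eq s2 B2.sig2_nonneg by (simp add: abs_le_iff) 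
  qed
  have "\<bar>exp (- (sig2 / 2)) - exp (- (B1.sig2 / 2))\<bar> \<le> \<bar>sig2 / 2 - B1.sig2 / 2\<bar>"
    using sig2_nonneg B1.sig2_nonneg by (intro abs_exp_minus_diff_le) auto
  with 3 have "\<bar>exp (- B1.sig2 / 2) - exp (- sig2 / 2)\<bar> \<le> sqrt (2 * e * G * sig2) + e * G"
    by (simp add: abs_minus_commute diff_divide_distrib[symmetric])
  then have 4: "cmod (complex_of_real (exp (- B1.sig2 / 2)) - exp (- sig2 / 2)) \<le> sqrt (2 * e * G * sig2) + e * G"
    by (simp only: of_real_diff[symmetric] norm_of_real)
  show ?thesis
    using norm_triangle_ineq[of "avg PP (\<lambda>p. iexp (T p)) - avg PP (\<lambda>p. iexp (B1.T p))" "avg PP (\<lambda>p. iexp (B1.T p)) - exp (- B1.sig2 / 2)"]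
      norm_triangle_ineq[of "avg PP (\<lambda>p. iexp (T p)) - exp (- B1.sig2 / 2)" "complex_of_real (exp (- B1.sig2 / 2)) - exp (- sig2 / 2)"] 1 2 4
    by simp
qed

section \<open>The law of the ranks\<close>

text \<open>By independence the joint law is a product, and for each fixed \<open>x\<close> the law
  of \<open>Y\<close> has no atom at \<open>x\<close>, so Fubini makes the diagonal a null
  set.\<close>

lemma AE_ne_of_indep_continuous:
  fixes X Y :: "'w \<Rightarrow> real"
  assumes "prob_space M" "prob_space.indep_var M borel X borel Y" "continuous_distribution (distr M borel Y)"
  shows "AE w in M. X w \<noteq> Y w"
proof -
  interpret prob_space M by fact
  have [measurable]: "X \<in> borel_measurable M" "Y \<in> borel_measurable M"
    and eq: "distr M borel X \<Otimes>\<^sub>M distr M borel Y = distr M (borel \<Otimes>\<^sub>M borel) (\<lambda>w. (X w, Y w))"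
    using assms(2) unfolding indep_var_distribution_eq by auto
  interpret X: prob_space "distr M borel X" by (rule prob_space_distr) simp
  interpret Y: real_distribution "distr M borel Y" by (rule real_distribution_distr) simp
  interpret P: pair_prob_space "distr M borel X" "distr M borel Y" ..
  have atom: "AE y in distr M borel Y. y \<noteq> x" for x
  proof -
    have "isCont (cdf (distr M borel Y)) x"
      using assms(3) by (simp add: continuous_distribution_def continuous_on_eq_continuous_at)
    then have "measure (distr M borel Y) {x} = 0" by (simp add: Y.isCont_cdf)
    then have "emeasure (distr M borel Y) {x} = 0" by (simp add: Y.emeasure_eq_measure)
    then show ?thesis by (intro AE_I[of _ _ "{x}"]) auto
  qed
  have "AE z in distr M borel X \<Otimes>\<^sub>M distr M borel Y. fst z \<noteq> snd z"
  proof (rule P.AE_pair_measure)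
    have "{z \<in> space (borel \<Otimes>\<^sub>M borel). fst z \<noteq> (snd z :: real)} \<in> sets (borel \<Otimes>\<^sub>M borel)" by measurable
    moreover have sets: "sets (distr M borel X \<Otimes>\<^sub>M distr M borel Y) = sets (borel \<Otimes>\<^sub>M borel)"
      by (intro sets_pair_measure_cong) simp_all
    ultimately show "{z \<in> space (distr M borel X \<Otimes>\<^sub>M distr M borel Y). fst z \<noteq> snd z} \<in> sets (distr M borel X \<Otimes>\<^sub>M distr M borel Y)"
      unfolding sets sets_eq_imp_space_eq[OF sets] by blast
    show "AE x in distr M borel X. AE y in distr M borel Y. fst (x, y) \<noteq> snd (x, y)"
    proof (rule AE_I2)
      fix x show "AE y in distr M borel Y. fst (x, y) \<noteq> snd (x, y)"
        using atom[of x] by eventually_elim simp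
    qed
  qed
  then have "AE z in distr M (borel \<Otimes>\<^sub>M borel) (\<lambda>w. (X w, Y w)). fst z \<noteq> snd z"
    by (simp only: eq)
  then show ?thesis by (subst (asm) AE_distr_iff) auto
qed

text \<open>Extended by the identity, so that without ties it satisfies \<open>permutes\<close>.\<close>
definition rank_perm :: "nat \<Rightarrow> (nat \<Rightarrow> real) \<Rightarrow> nat \<Rightarrow> nat" where
  "rank_perm m x i = (if i \<in> {1..m} then rank_among m x i else i)"

text \<open>Without ties the rank increases strictly with the value, so it is injective from the
  finite set \<open>{1..m}\<close> into itself.\<close>

lemma rank_perm_permutes:
  assumes x: "inj_on x {1..m}"
  shows "rank_perm m x permutes {1..m}"
proof -
  have in_range: "rank_among m x i \<in> {1..m}" if "i \<in> {1..m}" for i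
  proof -
    have "card {j \<in> {1..m}. x j \<le> x i} \<le> card {1..m}" by (intro card_mono) auto
    moreover have "0 < card {j \<in> {1..m}. x j \<le> x i}" using that by (subst card_gt_0_iff) auto
    ultimately show ?thesis unfolding rank_among_def by simp
  qed
  have less: "rank_among m x i < rank_among m x j" if "i \<in> {1..m}" "j \<in> {1..m}" "x i < x j" for i j
    unfolding rank_among_def
  proof (intro psubset_card_mono psubsetI)
    have "j \<in> {k \<in> {1..m}. x k \<le> x j}" "j \<notin> {k \<in> {1..m}. x k \<le> x i}" using that by auto
    then show "{k \<in> {1..m}. x k \<le> x i} \<noteq> {k \<in> {1..m}. x k \<le> x j}" by blast
  qed (use that in auto)
  have "inj_on (rank_among m x) {1..m}"
  proof (rule inj_onI)
    fix i j assume ij: "i \<in> {1..m}" "j \<in> {1..m}" "rank_among m x i = rank_among m x j"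
    then have "x i = x j" using less[of i j] less[of j i] by linarith
    then show "i = j" using x ij by (auto dest: inj_onD)
  qed
  then have "bij_betw (rank_among m x) {1..m} {1..m}"
    unfolding bij_betw_def using in_range by (intro conjI endo_inj_surj image_subsetI) blast+
  then have "bij_betw (rank_perm m x) {1..m} {1..m}"
    by (rule bij_betw_cong[THEN iffD1, rotated]) (simp add: rank_perm_def)
  then show ?thesis by (rule bij_imp_permutes) (auto simp: rank_perm_def)
qed

text \<open>\<open>q\<close> maps the positions counted for the rank after relabelling bijectively
  onto those counted before. Relabelling the data is thus right multiplication of the rank
  permutation, the source of its uniform law.\<close>

lemma rank_perm_comp:
  assumes q: "q permutes {1..m}"
  shows "rank_perm m (x \<circ> q) = rank_perm m x \<circ> q"
proof
  fix i
  show "rank_perm m (x \<circ> q) i = (rank_perm m x \<circ> q) i"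
  proof (cases "i \<in> {1..m}")
    case True
    have "q ` {j \<in> {1..m}. x (q j) \<le> x (q i)} = {j \<in> {1..m}. x j \<le> x (q i)}"
    proof (intro set_eqI iffI)
      fix j assume j: "j \<in> {j \<in> {1..m}. x j \<le> x (q i)}"
      then have "j \<in> q ` {1..m}" by (simp only: permutes_image[OF q]) simp
      then show "j \<in> q ` {j \<in> {1..m}. x (q j) \<le> x (q i)}" using j by auto
    qed (use permutes_in_image[OF q] in auto)
    moreover have "card (q ` {j \<in> {1..m}. x (q j) \<le> x (q i)}) = card {j \<in> {1..m}. x (q j) \<le> x (q i)}"
      by (intro card_image permutes_inj_on[OF q])
    ultimately show ?thesis using True permutes_in_image[OF q, of i] by (simp add: rank_perm_def rank_among_def)
  next
    case False
    then have "q i = i" using q by (rule permutes_not_in[rotated])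
    then show ?thesis using False by (auto simp: rank_perm_def)
  qed
qed

definition perm_families :: "nat \<Rightarrow> (nat \<Rightarrow> nat) \<Rightarrow> (nat \<Rightarrow> nat \<Rightarrow> nat) set" where
  "perm_families S ns = PiE {1..S} (\<lambda>s. perms {1..ns s})"

text \<open>Indexed by pairs because the errors form one product space over \<open>units\<close>;
  restricted to the strata so that its values are extensional, as \<open>PiE\<close>
  demands.\<close>

definition rank_family :: "nat \<Rightarrow> (nat \<Rightarrow> nat) \<Rightarrow> (nat \<times> nat \<Rightarrow> real) \<Rightarrow> nat \<Rightarrow> nat \<Rightarrow> nat" where
  "rank_family S ns x = (\<lambda>s\<in>{1..S}. rank_perm (ns s) (\<lambda>i. x (s, i)))"

lemma finite_perm_families: "finite (perm_families S ns)"
  unfolding perm_families_def by (intro finite_PiE) (auto simp: finite_permutations)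

lemma perm_families_nonempty: "perm_families S ns \<noteq> {}"
  unfolding perm_families_def PiE_eq_empty_iff using perms_nonempty by blast

lemma bij_betw_perm_families_comp:
  assumes p: "p \<in> perm_families S ns"
  shows "bij_betw (\<lambda>q. \<lambda>s\<in>{1..S}. p s \<circ> q s) (perm_families S ns) (perm_families S ns)"
proof (rule bij_betw_byWitness[where f' = "\<lambda>q. \<lambda>s\<in>{1..S}. inv (p s) \<circ> q s"])
  have perm: "p s permutes {1..ns s}" if "s \<in> {1..S}" for s
    using p that by (auto simp: perm_families_def PiE_iff)
  have perm': "inv (p s) permutes {1..ns s}" if "s \<in> {1..S}" for s
    using perm[OF that] by (rule permutes_inv)
  show "\<forall>q\<in>perm_families S ns. (\<lambda>s\<in>{1..S}. inv (p s) \<circ> (\<lambda>s\<in>{1..S}. p s \<circ> q s) s) = q"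
    using permutes_inverses[OF perm] by (auto simp: perm_families_def PiE_iff extensional_def fun_eq_iff)
  show "\<forall>q\<in>perm_families S ns. (\<lambda>s\<in>{1..S}. p s \<circ> (\<lambda>s\<in>{1..S}. inv (p s) \<circ> q s) s) = q"
    using permutes_inverses[OF perm] by (auto simp: perm_families_def PiE_iff extensional_def fun_eq_iff)
  show "(\<lambda>q. \<lambda>s\<in>{1..S}. p s \<circ> q s) ` perm_families S ns \<subseteq> perm_families S ns"
    using permutes_compose[OF _ perm] by (auto simp: perm_families_def PiE_iff)
  show "(\<lambda>q. \<lambda>s\<in>{1..S}. inv (p s) \<circ> q s) ` perm_families S ns \<subseteq> perm_families S ns"
    using permutes_compose[OF _ perm'] by (auto simp: perm_families_def PiE_iff)
qed

lemma finite_units: "finite (units S ns)"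
  by (simp add: units_def)

text \<open>The finite target makes every real function of the ranks measurable and bounded.\<close>

lemma measurable_rank_family:
  "\<exists>R. finite R \<and> rank_family S ns \<in> PiM (units S ns) (\<lambda>_. borel) \<rightarrow>\<^sub>M count_space R"
proof -
  \<comment> \<open>Tied data must have their values in the target too, so \<open>C\<close> admits
    arbitrary maps, not just permutations, extended by the identity.\<close>
  define C where "C s = (\<lambda>g i. if i \<in> {1..ns s} then g i else i) ` (PiE {1..ns s} (\<lambda>_. {..ns s}))" for s
  define R where "R = PiE {1..S} C"
  have "finite R" unfolding R_def C_def by (intro finite_PiE finite_imageI) auto
  let ?P = "PiM (units S ns) (\<lambda>_. borel) :: (nat \<times> nat \<Rightarrow> real) measure"
  have mr: "(\<lambda>x. rank_among (ns s) (\<lambda>i. x (s, i)) i) \<in> ?P \<rightarrow>\<^sub>M count_space UNIV"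
    if "s \<in> {1..S}" "i \<in> {1..ns s}" for s i
    unfolding rank_among_def
  proof (rule measurable_card)
    fix j
    show "{x \<in> space ?P. j \<in> {j \<in> {1..ns s}. x (s, j) \<le> x (s, i)}} \<in> sets ?P"
    proof (cases "j \<in> {1..ns s}")
      case True
      then have [measurable]: "(\<lambda>x. x (s, j)) \<in> borel_measurable ?P" "(\<lambda>x. x (s, i)) \<in> borel_measurable ?P"
        using that by (auto intro!: measurable_component_singleton simp: units_def)
      have "{x \<in> space ?P. x (s, j) \<le> x (s, i)} \<in> sets ?P" by measurable
      then show ?thesis using True by simp
    next
      case False
      then have "{x \<in> space ?P. j \<in> {j \<in> {1..ns s}. x (s, j) \<le> x (s, i)}} = {}" by blast
      then show ?thesis by (simp only: sets.empty_sets)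
    qed
  qed
  have range: "rank_family S ns x \<in> R" for x
  proof -
    have "rank_perm (ns s) (\<lambda>i. x (s, i)) \<in> C s" for s
      unfolding C_def
    proof (rule image_eqI)
      show "rank_perm (ns s) (\<lambda>i. x (s, i)) = (\<lambda>i. if i \<in> {1..ns s} then (\<lambda>i\<in>{1..ns s}. rank_among (ns s) (\<lambda>i. x (s, i)) i) i else i)"
        by (auto simp: rank_perm_def fun_eq_iff)
      have "card {j \<in> {1..ns s}. x (s, j) \<le> x (s, i)} \<le> card {1..ns s}" for i
        by (intro card_mono) auto
      then show "(\<lambda>i\<in>{1..ns s}. rank_among (ns s) (\<lambda>i. x (s, i)) i) \<in> (PiE {1..ns s} (\<lambda>_. {..ns s}))"
        by (auto simp: rank_among_def)
    qed
    then show ?thesis by (auto simp: rank_family_def R_def)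
  qed
  have "rank_family S ns \<in> ?P \<rightarrow>\<^sub>M count_space R"
    unfolding measurable_count_space_eq2[OF \<open>finite R\<close>]
  proof (intro conjI ballI)
    fix a assume a: "a \<in> R"
    have out: "a s i = i" if "s \<in> {1..S}" "i \<notin> {1..ns s}" for s i
    proof -
      have "a s \<in> C s" using a that(1) by (auto simp: R_def)
      then obtain g where "a s = (\<lambda>i. if i \<in> {1..ns s} then g i else i)" unfolding C_def by (rule imageE)
      then show ?thesis using that(2) by auto
    qed
    have "rank_family S ns x = a \<longleftrightarrow> (\<forall>s\<in>{1..S}. \<forall>i\<in>{1..ns s}. rank_among (ns s) (\<lambda>i. x (s, i)) i = a s i)" for x
    proof
      assume *: "\<forall>s\<in>{1..S}. \<forall>i\<in>{1..ns s}. rank_among (ns s) (\<lambda>i. x (s, i)) i = a s i"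
      show "rank_family S ns x = a"
      proof (intro ext)
        fix s i
        show "rank_family S ns x s i = a s i"
          using a * out by (cases "s \<in> {1..S}") (auto simp: rank_family_def rank_perm_def R_def PiE_iff extensional_def)
      qed
    qed (auto simp: rank_family_def rank_perm_def fun_eq_iff split: if_splits)
    then have "rank_family S ns -` {a} \<inter> space ?P = 
      {x \<in> space ?P. \<forall>s\<in>{1..S}. \<forall>i\<in>{1..ns s}. rank_among (ns s) (\<lambda>i. x (s, i)) i = a s i}"
      by auto
    also have "\<dots> \<in> sets ?P"
    proof (intro sets.sets_Collect_finite_All)
      fix s i assume "s \<in> {1..S}" "i \<in> {1..ns s}"
      have [measurable]: "(\<lambda>x. rank_among (ns s) (\<lambda>i. x (s, i)) i) \<in> ?P \<rightarrow>\<^sub>M count_space UNIV"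
        by (rule mr) fact+
      show "{x \<in> space ?P. rank_among (ns s) (\<lambda>i. x (s, i)) i = a s i} \<in> sets ?P" by measurable
    qed auto
    finally show "rank_family S ns -` {a} \<inter> space ?P \<in> sets ?P" .
  qed (use range in auto)
  with \<open>finite R\<close> show ?thesis by blast
qed

text \<open>Permuting the errors within strata by a fixed \<open>q\<close> keeps their joint law and
  multiplies the ranks by \<open>q\<close>. Averaging over all \<open>q\<close> and reindexing for
  each outcome without ties gives an integrand that no longer depends on the outcome. No probability
  of an individual ranking has to be computed.\<close>

theorem expectation_rank_family:
  fixes r :: "nat \<Rightarrow> nat \<Rightarrow> 'w \<Rightarrow> real" and F :: "(nat \<Rightarrow> nat \<Rightarrow> nat) \<Rightarrow> real"
  assumes M: "prob_space M" and ne: "units S ns \<noteq> {}"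
    and indep: "prob_space.indep_vars M (\<lambda>_. borel) (\<lambda>(s, i). r s i) (units S ns)"
    and ident: "\<And>s i j. (s, i) \<in> units S ns \<Longrightarrow> (s, j) \<in> units S ns \<Longrightarrow> distr M borel (r s i) = distr M borel (r s j)"
    and cont: "\<And>s i. (s, i) \<in> units S ns \<Longrightarrow> continuous_distribution (distr M borel (r s i))"
  shows "(\<lambda>w. F (rank_family S ns (\<lambda>(s, i). r s i w))) \<in> borel_measurable M" (is ?meas)
    and "(\<integral>w. F (rank_family S ns (\<lambda>(s, i). r s i w)) \<partial>M) = avg (perm_families S ns) F" (is ?int)
proof -
  interpret prob_space M by fact
  let ?U = "units S ns" and ?PF = "perm_families S ns"
  define X where "X = (\<lambda>(s, i). r s i)"
  define B where "B = PiM ?U (\<lambda>_. borel :: real measure)"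
  define Q where "Q = PiM ?U (\<lambda>u. distr M borel (X u))"
  define G where "G x = F (rank_family S ns x)" for x
  have rv [measurable]: "X u \<in> borel_measurable M" if "u \<in> ?U" for u
    using indep that unfolding indep_vars_def X_def by auto
  have Q: "Q = distr M B (\<lambda>w. \<lambda>u\<in>?U. X u w)"
    unfolding Q_def B_def
    using indep_vars_iff_distr_eq_PiM'[OF ne, where M' = "\<lambda>_. borel" and X = X] indep rv by (simp add: X_def)
  have mX [measurable]: "(\<lambda>w. \<lambda>u\<in>?U. X u w) \<in> M \<rightarrow>\<^sub>M B"
    unfolding B_def by (rule measurable_restrict) (rule rv)
  interpret Q: prob_space Q unfolding Q by (rule prob_space_distr) (rule mX)
  have setsQ: "sets Q = sets B" unfolding Q by simp
  obtain R where R: "finite R" "rank_family S ns \<in> B \<rightarrow>\<^sub>M count_space R"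
    using measurable_rank_family unfolding B_def by blast
  have mF: "(\<lambda>x. H (rank_family S ns x)) \<in> borel_measurable B" for H :: "_ \<Rightarrow> real"
    using R(2) by (rule measurable_compose) simp
  have mG: "G \<in> borel_measurable B" unfolding G_def[abs_def] by (rule mF)
  have cong: "rank_family S ns x = rank_family S ns y" if "\<And>u. u \<in> ?U \<Longrightarrow> x u = y u" for x y
  proof -
    have "rank_among (ns s) (\<lambda>i. x (s, i)) i = rank_among (ns s) (\<lambda>i. y (s, i)) i" if "s \<in> {1..S}" "i \<in> {1..ns s}" for s i
      unfolding rank_among_def using that \<open>\<And>u. u \<in> ?U \<Longrightarrow> x u = y u\<close>
      by (intro arg_cong[of _ _ card]) (auto simp: units_def)
    then show ?thesis by (auto simp: rank_family_def rank_perm_def fun_eq_iff)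
  qed
  have GX: "F (rank_family S ns (\<lambda>(s, i). r s i w)) = G (\<lambda>u\<in>?U. X u w)" for w
    unfolding G_def by (intro arg_cong[of _ _ F] cong) (auto simp: X_def)
  show ?meas unfolding GX using mX mG by (rule measurable_compose)
  have bnd: "integrable Q (\<lambda>x. H (rank_family S ns x))" for H :: "_ \<Rightarrow> real"
  proof (rule Q.integrable_const_bound)
    have "rank_family S ns x \<in> R" if "x \<in> space Q" for x
      using R(2) that setsQ[THEN sets_eq_imp_space_eq] by (auto simp: measurable_def)
    then show "AE x in Q. norm (H (rank_family S ns x)) \<le> (\<Sum>a\<in>R. norm (H a))"
      using R(1) by (intro AE_I2 member_le_sum[of _ R "\<lambda>a. norm (H a)"]) auto
    show "(\<lambda>x. H (rank_family S ns x)) \<in> borel_measurable Q"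
      using mF[of H] measurable_cong_sets[OF setsQ refl] by blast
  qed
  have I1: "(\<integral>w. F (rank_family S ns (\<lambda>(s, i). r s i w)) \<partial>M) = (\<integral>x. G x \<partial>Q)"
    unfolding GX Q using mX mG by (rule integral_distr[symmetric])
  define act where "act p q = (\<lambda>s\<in>{1..S}. p s \<circ> q s)" for p q :: "nat \<Rightarrow> nat \<Rightarrow> nat"
  \<comment> \<open>exchangeability within the strata\<close>
  have I2: "(\<integral>x. G x \<partial>Q) = (\<integral>x. F (act (rank_family S ns x) q) \<partial>Q)" if q: "q \<in> ?PF" for q
  proof -
    have perm: "q s permutes {1..ns s}" if "s \<in> {1..S}" for s
      using q that by (auto simp: perm_families_def PiE_iff)
    define f where "f = (\<lambda>(s, i). (s, q s i))"
    have fU: "f \<in> ?U \<rightarrow> ?U"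
      using permutes_in_image[OF perm] by (auto simp: f_def units_def)
    have inj: "inj_on f ?U"
      by (auto simp: f_def units_def inj_on_def dest!: perm[THEN permutes_inj, THEN injD, rotated])
    have same: "distr M borel (X (f u)) = distr M borel (X u)" if "u \<in> ?U" for u
    proof -
      obtain s i where u: "u = (s, i)" by (cases u)
      have "f u \<in> ?U" using fU that by blast
      then show ?thesis using ident[of s "q s i" i] that by (simp add: u f_def X_def)
    qed
    have Q': "PiM ?U (\<lambda>u. distr M borel (X (f u))) = Q"
      unfolding Q_def by (rule PiM_cong) (simp_all add: same)
    have "distr Q Q (\<lambda>x. \<lambda>u\<in>?U. x (f u)) = Q"
      using distr_PiM_reindex[of ?U "\<lambda>u. distr M borel (X u)" f ?U, OF _ inj fU]
      unfolding Q'[unfolded Q_def] Q_def by (simp add: prob_space_distr)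
    then have "(\<integral>x. G x \<partial>Q) = (\<integral>x. G x \<partial>distr Q Q (\<lambda>x. \<lambda>u\<in>?U. x (f u)))" by simp
    also have "\<dots> = (\<integral>x. G (\<lambda>u\<in>?U. x (f u)) \<partial>Q)"
    proof (rule integral_distr)
      show "(\<lambda>x. \<lambda>u\<in>?U. x (f u)) \<in> Q \<rightarrow>\<^sub>M Q"
        unfolding Q_def
      proof (rule measurable_restrict)
        fix u assume "u \<in> ?U"
        then have "f u \<in> ?U" using fU by blast
        then have "(\<lambda>x. x (f u)) \<in> PiM ?U (\<lambda>u. distr M borel (X u)) \<rightarrow>\<^sub>M distr M borel (X (f u))"
          by (rule measurable_component_singleton)
        then show "(\<lambda>x. x (f u)) \<in> PiM ?U (\<lambda>u. distr M borel (X u)) \<rightarrow>\<^sub>M distr M borel (X u)"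
          by (simp cong: measurable_cong_sets)
      qed
      show "G \<in> borel_measurable Q" using mG measurable_cong_sets[OF setsQ refl] by blast
    qed
    also have "\<dots> = (\<integral>x. F (act (rank_family S ns x) q) \<partial>Q)"
    proof (rule Bochner_Integration.integral_cong[OF refl])
      fix x
      have "rank_family S ns (\<lambda>u\<in>?U. x (f u)) = rank_family S ns (\<lambda>u. x (f u))"
        by (rule cong) simp
      also have "\<dots> = act (rank_family S ns x) q"
        using rank_perm_comp[OF perm, of _ "\<lambda>i. x (_, i)"]
        by (auto simp: rank_family_def act_def f_def comp_def fun_eq_iff)
      finally show "G (\<lambda>u\<in>?U. x (f u)) = F (act (rank_family S ns x) q)" by (simp add: G_def)
    qed
    finally show ?thesis .
  qed
  have distinct: "AE w in M. \<forall>u\<in>?U. \<forall>v\<in>?U. u \<noteq> v \<longrightarrow> X u w \<noteq> X v w"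
  proof (intro AE_finite_allI finite_units)
    fix u v assume uv: "u \<in> ?U" "v \<in> ?U"
    show "AE w in M. u \<noteq> v \<longrightarrow> X u w \<noteq> X v w"
    proof (cases "u = v")
      case False
      have "indep_vars (\<lambda>_. borel) X (insert u {v})"
        using indep uv unfolding X_def by (intro indep_vars_subset[OF indep]) auto
      \<comment> \<open>The sum over a singleton is a detour that extracts independence of two
        variables from independence of a family.\<close>
      then have "indep_var borel (X u) borel (\<lambda>w. \<Sum>i\<in>{v}. X i w)"
        using False by (intro indep_vars_sum) auto
      then have "indep_var borel (X u) borel (X v)" by simp
      moreover have "continuous_distribution (distr M borel (X v))"
        using cont[of "fst v" "snd v"] uv(2) by (simp add: X_def case_prod_beta)
      ultimately show ?thesis using AE_ne_of_indep_continuous[OF M] by auto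
    qed simp
  qed
  have "AE w in M. rank_family S ns (\<lambda>u\<in>?U. X u w) \<in> ?PF"
    using distinct
  proof eventually_elim
    case (elim w)
    have "inj_on (\<lambda>i. (\<lambda>u\<in>?U. X u w) (s, i)) {1..ns s}" if "s \<in> {1..S}" for s
    proof (rule inj_onI)
      fix i j assume ij: "i \<in> {1..ns s}" "j \<in> {1..ns s}"
        "(\<lambda>u\<in>?U. X u w) (s, i) = (\<lambda>u\<in>?U. X u w) (s, j)"
      then have "(s, i) \<in> ?U" "(s, j) \<in> ?U" using that by (auto simp: units_def)
      then show "i = j" using elim ij(3) by (metis prod.inject restrict_apply')
    qed
    then have "rank_perm (ns s) (\<lambda>i. (\<lambda>u\<in>?U. X u w) (s, i)) permutes {1..ns s}" if "s \<in> {1..S}" for s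
      using that by (intro rank_perm_permutes)
    then show ?case unfolding perm_families_def rank_family_def by (intro PiE_I) auto
  qed
  moreover have "{x \<in> space B. rank_family S ns x \<in> ?PF} \<in> sets B"
  proof -
    have "{x \<in> space B. rank_family S ns x \<in> ?PF} = rank_family S ns -` (?PF \<inter> R) \<inter> space B"
      using R(2) by (auto simp: measurable_def)
    then show ?thesis using measurable_sets[OF R(2), of "?PF \<inter> R"] by simp
  qed
  ultimately have aeQ: "AE x in Q. rank_family S ns x \<in> ?PF"
    unfolding Q by (subst AE_distr_iff[OF mX]) auto
  \<comment> \<open>By \<open>I2\<close> the integral equals each of the averaged terms. Moving the
    average inside then allows the translation by the ranks of \<open>x\<close> to be removed
    pointwise.\<close>
  have "(\<integral>x. G x \<partial>Q) = avg ?PF (\<lambda>q. \<integral>x. F (act (rank_family S ns x) q) \<partial>Q)"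
  proof -
    have "avg ?PF (\<lambda>q. \<integral>x. F (act (rank_family S ns x) q) \<partial>Q) = avg ?PF (\<lambda>q. \<integral>x. G x \<partial>Q)"
      by (rule avg_cong) (rule I2[symmetric])
    then show ?thesis by (simp only: avg_const[OF finite_perm_families perm_families_nonempty])
  qed
  also have "\<dots> = (\<integral>x. avg ?PF (\<lambda>q. F (act (rank_family S ns x) q)) \<partial>Q)"
  proof -
    have "integrable Q (\<lambda>x. F (act (rank_family S ns x) q))" for q
      using bnd[of "\<lambda>p. F (act p q)"] .
    then show ?thesis unfolding avg_def by (simp add: Bochner_Integration.integral_sum)
  qed
  also have "\<dots> = (\<integral>x. avg ?PF F \<partial>Q)"
  proof (rule integral_cong_AE)
    show "AE x in Q. avg ?PF (\<lambda>q. F (act (rank_family S ns x) q)) = avg ?PF F"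
      using aeQ
    proof eventually_elim
      case (elim x)
      show ?case unfolding act_def by (rule avg_reindex[OF bij_betw_perm_families_comp[OF elim]])
    qed
    show "(\<lambda>x. avg ?PF (\<lambda>q. F (act (rank_family S ns x) q))) \<in> borel_measurable Q"
      using bnd[of "\<lambda>p. avg ?PF (\<lambda>q. F (act p q))"] by (rule borel_measurable_integrable)
  qed simp
  also have "\<dots> = avg ?PF F" by (simp add: Q.prob_space)
  finally show ?int using I1 by simp
qed

section \<open>Quadratic forms\<close>

lemma symmetric_matrix_inner:
  fixes A :: "real ^ 'k ^ 'k"
  assumes "Finite_Cartesian_Product.transpose A = A"
  shows "(A *v x) \<bullet> y = x \<bullet> (A *v y)"
  by (metis assms dot_lmul_matrix matrix_transpose_mul transpose_matrix_vector vector_transpose_matrix)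

text \<open>Eigenvectors of distinct eigenvalues are orthogonal, hence independent. Finiteness is
  what makes the \<open>Min\<close> in \<open>min_eigenvalue\<close> a lower bound.\<close>

lemma finite_eigenvalues_symmetric:
  fixes A :: "real ^ 'k ^ 'k"
  assumes A: "Finite_Cartesian_Product.transpose A = A"
  shows "finite {c. \<exists>v. v \<noteq> 0 \<and> A *v v = c *\<^sub>R v}" (is "finite ?E")
proof -
  obtain e where e: "\<And>c. c \<in> ?E \<Longrightarrow> e c \<noteq> 0 \<and> A *v e c = c *\<^sub>R e c"
    using bchoice[of ?E "\<lambda>c v. v \<noteq> 0 \<and> A *v v = c *\<^sub>R v"] by auto
  have orth: "e c \<bullet> e d = 0" if "c \<in> ?E" "d \<in> ?E" "c \<noteq> d" for c d
  proof -
    have "c * (e c \<bullet> e d) = (A *v e c) \<bullet> e d" using e[OF that(1)] by simp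
    also have "\<dots> = d * (e c \<bullet> e d)" unfolding symmetric_matrix_inner[OF A] using e[OF that(2)] by simp
    finally show ?thesis using that(3) by simp
  qed
  have inj: "inj_on e ?E"
  proof (rule inj_onI)
    fix c d assume cd: "c \<in> ?E" "d \<in> ?E" "e c = e d"
    then have "e c \<bullet> e d \<noteq> 0" using e[OF cd(1)] by simp
    then show "c = d" using orth[OF cd(1,2)] by blast
  qed
  have "pairwise orthogonal (e ` ?E)"
    by (rule pairwise_imageI) (unfold orthogonal_def, rule orth)
  moreover have "0 \<notin> e ` ?E"
  proof
    assume "0 \<in> e ` ?E"
    then obtain c where "c \<in> ?E" "0 = e c" by (rule imageE)
    then show False using e[of c] by simp
  qed
  ultimately have "independent (e ` ?E)" by (rule pairwise_orthogonal_independent)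
  then have "finite (e ` ?E)" by (rule independent_imp_finite)
  then show ?thesis using inj finite_imageD by blast
qed

text \<open>The quadratic form attains its minimum on the compact unit sphere, and a minimiser is an
  eigenvector; its value is therefore an eigenvalue and at least \<open>min_eigenvalue A\<close>.
  Homogeneity extends the bound from the sphere.\<close>

lemma min_eigenvalue_le_quadratic_form:
  fixes A :: "real ^ 'k ^ 'k"
  assumes A: "Finite_Cartesian_Product.transpose A = A"
  shows "min_eigenvalue A * (norm u)\<^sup>2 \<le> u \<bullet> (A *v u)"
proof (cases "u = 0")
  case False
  define q where "q v = v \<bullet> (A *v v)" for v
  have "continuous_on (sphere 0 1) q"
    unfolding q_def by (intro continuous_intros matrix_vector_mult_linear_continuous_on)
  moreover have "sphere (0::real^'k) 1 \<noteq> {}" by simp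
  ultimately obtain v where v: "v \<in> sphere 0 1" "\<And>w. w \<in> sphere 0 1 \<Longrightarrow> q v \<le> q w"
    using continuous_attains_inf[OF compact_sphere] by metis
  have nv: "norm v = 1" using v by simp
  have scale: "q v * (norm w)\<^sup>2 \<le> q w" for w
  proof (cases "w = 0")
    case False
    have "q v \<le> q ((1 / norm w) *\<^sub>R w)" using False by (intro v) simp
    also have "\<dots> = q w / (norm w)\<^sup>2"
      by (simp add: q_def matrix_vector_mult_scaleR power2_eq_square)
    finally show ?thesis using False by (simp add: field_simps)
  qed (simp add: q_def)
  define y where "y = A *v v - q v *\<^sub>R v"
  have vy: "v \<bullet> y = 0" using nv by (simp add: y_def q_def inner_diff_right dot_square_norm)
  have Ay: "(A *v v) \<bullet> y = (norm y)\<^sup>2"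
  proof -
    have "A *v v = y + q v *\<^sub>R v" by (simp add: y_def)
    then show ?thesis by (simp add: inner_add_left vy dot_square_norm)
  qed
  \<comment> \<open>otherwise moving the minimiser \<open>v\<close> in direction \<open>- y\<close> decreases the Rayleigh quotient\<close>
  have "y = 0"
  proof (rule ccontr)
    assume y: "y \<noteq> 0"
    \<comment> \<open>\<open>C\<close> dominates the second-order coefficient in \<open>t\<close>,
      and the choice of \<open>t\<close> makes the second-order term at most half of the first-order
      gain \<open>2 * t * (norm y)\<^sup>2\<close>.\<close>
    define C where "C = \<bar>q y - q v * (norm y)\<^sup>2\<bar> + 1"
    have C: "C > 0" by (simp add: C_def)
    define t where "t = (norm y)\<^sup>2 / C"
    have t: "t > 0" using y C by (simp add: t_def)
    have "q v * (norm (v - t *\<^sub>R y))\<^sup>2 \<le> q (v - t *\<^sub>R y)" by (rule scale)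
    moreover have "(norm (v - t *\<^sub>R y))\<^sup>2 = 1 + t\<^sup>2 * (norm y)\<^sup>2"
      unfolding power2_norm_eq_inner using nv vy
      by (simp add: inner_diff_left inner_diff_right inner_commute[of y v] power2_eq_square norm_eq_1)
    moreover have "q (v - t *\<^sub>R y) = q v - 2 * t * (norm y)\<^sup>2 + t\<^sup>2 * q y"
      using Ay symmetric_matrix_inner[OF A, of v y]
      by (simp add: q_def matrix_vector_mult_diff_distrib matrix_vector_mult_scaleR inner_diff_left inner_diff_right
          inner_commute[of y "A *v v"] power2_eq_square algebra_simps)
    ultimately have "2 * t * (norm y)\<^sup>2 \<le> t\<^sup>2 * (q y - q v * (norm y)\<^sup>2)" by (simp add: algebra_simps)
    also have "\<dots> \<le> t\<^sup>2 * C" by (intro mult_left_mono) (auto simp: C_def)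
    also have "\<dots> = t * (norm y)\<^sup>2" using C by (simp add: t_def power2_eq_square)
    finally show False using t y by simp
  qed
  then have "A *v v = q v *\<^sub>R v" by (simp add: y_def)
  moreover have "v \<noteq> 0" using nv by auto
  ultimately have "min_eigenvalue A \<le> q v"
    unfolding min_eigenvalue_def by (intro Min_le finite_eigenvalues_symmetric A) blast
  then have "min_eigenvalue A * (norm u)\<^sup>2 \<le> q v * (norm u)\<^sup>2" by (intro mult_right_mono) auto
  with scale[of u] show ?thesis by (simp add: q_def)
qed simp

text \<open>The images \<open>A *v e j\<close> of fewer than \<open>CARD('k)\<close> vectors leave a
  Euclidean orthogonal direction, and symmetry makes it orthogonal to the \<open>e j\<close> for the
  form as well; positivity permits normalising it.\<close>

lemma orthonormal_family_exists:
  fixes A :: "real ^ 'k ^ 'k"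
  assumes A: "Finite_Cartesian_Product.transpose A = A" and pos: "\<And>v. v \<noteq> 0 \<Longrightarrow> 0 < v \<bullet> (A *v v)"
    and n: "n \<le> CARD('k)"
  shows "\<exists>e. \<forall>i<n. \<forall>j<n. e i \<bullet> (A *v e j) = (if i = j then 1 else 0)"
  using n
proof (induction n)
  case (Suc n)
  then obtain e where e: "\<And>i j. i < n \<Longrightarrow> j < n \<Longrightarrow> e i \<bullet> (A *v e j) = (if i = j then 1 else 0)"
    by auto
  let ?S = "(\<lambda>j. A *v e j) ` {..<n}"
  have "dim ?S \<le> card ?S" by (rule dim_le_card') simp
  also have "\<dots> \<le> n" using card_image_le[of "{..<n}"] by simp
  finally have "dim ?S < DIM(real ^ 'k)" using Suc.prems by simp
  then obtain x where x: "x \<noteq> 0" "\<And>y. y \<in> span ?S \<Longrightarrow> orthogonal x y"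
    using orthogonal_to_subspace_exists by blast
  define c where "c = sqrt (x \<bullet> (A *v x))"
  have c: "c > 0" "c * c = x \<bullet> (A *v x)" using pos[OF x(1)] by (simp_all add: c_def)
  define z where "z = (1 / c) *\<^sub>R x"
  have zz: "z \<bullet> (A *v z) = 1" using c(1) by (simp add: z_def matrix_vector_mult_scaleR c(2)[symmetric])
  have ze: "z \<bullet> (A *v e j) = 0" "e j \<bullet> (A *v z) = 0" if "j < n" for j
  proof -
    have "x \<bullet> (A *v e j) = 0" using x(2)[of "A *v e j"] that by (simp add: orthogonal_def span_base)
    then show "z \<bullet> (A *v e j) = 0" by (simp add: z_def)
    then show "e j \<bullet> (A *v z) = 0" using symmetric_matrix_inner[OF A, of "e j" z] by (simp add: inner_commute)
  qed
  show ?case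
    by (rule exI[of _ "e(n := z)"]) (auto simp: less_Suc_eq e zz ze)
qed simp

text \<open>The \<open>e j\<close> are a basis; in it, \<open>y = matrix_inv A *v a\<close> has the
  coefficients \<open>e j \<bullet> (A *v y)\<close>, which are \<open>e j \<bullet> a\<close>.
  Pairing the expansion of \<open>y\<close> with \<open>a\<close> gives the sum of squares.\<close>

lemma inverse_quadratic_form:
  fixes A :: "real ^ 'k ^ 'k"
  assumes A: "Finite_Cartesian_Product.transpose A = A" and pos: "\<And>v. v \<noteq> 0 \<Longrightarrow> 0 < v \<bullet> (A *v v)"
    and e: "\<And>i j. i < CARD('k) \<Longrightarrow> j < CARD('k) \<Longrightarrow> e i \<bullet> (A *v e j) = (if i = j then 1 else 0)"
  shows "a \<bullet> (matrix_inv A *v a) = (\<Sum>j<CARD('k). (e j \<bullet> a)\<^sup>2)"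
proof -
  let ?k = "CARD('k)"
  have "A *v x = 0 \<Longrightarrow> x = 0" for x using pos[of x] by (metis inner_zero_right less_irrefl)
  then have "invertible A"
    unfolding invertible_left_inverse matrix_left_invertible_ker by blast
  then have "A ** matrix_inv A = mat 1"
    using someI_ex[of "\<lambda>B. A ** B = mat 1 \<and> B ** A = mat 1"] by (simp add: invertible_def matrix_inv_def)
  then have inv: "A *v (matrix_inv A *v a) = a"
    by (simp add: matrix_vector_mul_assoc)
  define y where "y = matrix_inv A *v a"
  have coef: "(\<Sum>j<?k. f j *\<^sub>R e j) \<bullet> (A *v e i) = f i" if "i < ?k" for i f
  proof -
    have "(\<Sum>j<?k. f j *\<^sub>R e j) \<bullet> (A *v e i) = (\<Sum>j<?k. f j * (if j = i then 1 else 0))"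
      unfolding inner_sum_left using that by (intro sum.cong) (auto simp: e)
    also have "\<dots> = (\<Sum>j<?k. if j = i then f i else 0)"
      by (intro sum.cong) auto
    finally show ?thesis using that by simp
  qed
  have inj: "inj_on e {..<?k}"
  proof (rule inj_onI)
    fix i j assume "i \<in> {..<?k}" "j \<in> {..<?k}" "e i = e j"
    then show "i = j" using e[of i j] e[of i i] by (auto split: if_splits)
  qed
  have "independent (e ` {..<?k})"
  proof (rule independent_if_scalars_zero)
    fix f x assume *: "(\<Sum>x\<in>e ` {..<?k}. f x *\<^sub>R x) = 0" and "x \<in> e ` {..<?k}"
    then obtain i where i: "i < ?k" "x = e i" by auto
    have "(\<Sum>j<?k. f (e j) *\<^sub>R e j) = 0" using * by (simp add: sum.reindex[OF inj])
    then show "f x = 0" using coef[OF i(1), of "\<lambda>j. f (e j)"] i by simp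
  qed simp
  then have "UNIV \<subseteq> span (e ` {..<?k})"
    by (intro card_ge_dim_independent) (auto simp: card_image inj)
  then have "y \<in> span (e ` {..<?k})" by blast
  then obtain g where "y = (\<Sum>x\<in>e ` {..<?k}. g x *\<^sub>R x)"
    by (auto simp: span_finite)
  then have g: "y = (\<Sum>j<?k. g (e j) *\<^sub>R e j)" by (simp add: sum.reindex[OF inj])
  have ea: "e i \<bullet> a = g (e i)" if "i < ?k" for i
  proof -
    have "e i \<bullet> a = y \<bullet> (A *v e i)"
      using inv symmetric_matrix_inner[OF A, of y "e i"] by (simp add: y_def inner_commute)
    also have "\<dots> = g (e i)" unfolding g using coef[OF that] by simp
    finally show ?thesis .
  qed
  have "a \<bullet> y = (\<Sum>j<?k. g (e j) * (a \<bullet> e j))" by (subst g) (simp add: inner_sum_right)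
  also have "\<dots> = (\<Sum>j<?k. (e j \<bullet> a)\<^sup>2)"
    by (intro sum.cong) (auto simp: ea inner_commute[of a] power2_eq_square)
  finally show ?thesis by (simp add: y_def)
qed

text \<open>For fixed coordinates \<open>x\<close> the variance of the linear form is the same for
  every \<open>A\<close>, so it stays constant along the sequence.\<close>

lemma quadratic_form_orthonormal:
  fixes A :: "real ^ 'k ^ 'k" and n :: nat
  assumes e: "\<And>i j. i < n \<Longrightarrow> j < n \<Longrightarrow> e i \<bullet> (A *v e j) = (if i = j then 1 else 0)"
  shows "(\<Sum>j<n. x j *\<^sub>R e j) \<bullet> (A *v (\<Sum>j<n. x j *\<^sub>R e j)) = (\<Sum>j<n. (x j)\<^sup>2)"
proof -
  have "A *v (\<Sum>j<n. x j *\<^sub>R e j) = (\<Sum>j<n. x j *\<^sub>R (A *v e j))"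
    using linear_sum[OF matrix_vector_mul_linear[of A], of "\<lambda>j. x j *\<^sub>R e j" "{..<n}"]
    by (simp add: matrix_vector_mult_scaleR)
  then have "(\<Sum>j<n. x j *\<^sub>R e j) \<bullet> (A *v (\<Sum>j<n. x j *\<^sub>R e j)) = (\<Sum>i<n. \<Sum>j<n. x i * (x j * (e i \<bullet> (A *v e j))))"
    unfolding inner_sum_left by (simp add: inner_sum_right sum_distrib_left mult.left_commute)
  also have "\<dots> = (\<Sum>i<n. \<Sum>j<n. if j = i then (x i)\<^sup>2 else 0)"
    by (intro sum.cong) (auto simp: e power2_eq_square)
  also have "\<dots> = (\<Sum>i<n. (x i)\<^sup>2)"
    by (intro sum.cong) auto
  finally show ?thesis .
qed

section \<open>Laplace transforms and weak convergence\<close>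

text \<open>A test function that vanishes near infinity becomes, in the variable
  \<open>exp (- x)\<close>, continuous on the closed unit interval. A polynomial in that variable
  integrates to a combination of Laplace transforms at naturals, and a uniform approximation changes
  integrals against probability measures on the half line by no more than the approximation
  error.\<close>

theorem weak_conv_m_of_Laplace:
  fixes \<mu> :: "nat \<Rightarrow> real measure" and \<nu> :: "real measure"
  assumes \<mu>: "\<And>n. real_distribution (\<mu> n)" and \<nu>: "real_distribution \<nu>"
    and nonneg: "eventually (\<lambda>n. AE x in \<mu> n. 0 \<le> x) sequentially" "AE x in \<nu>. 0 \<le> x"
    and lim: "\<And>m::nat. (\<lambda>n. \<integral>x. exp (- real m * x) \<partial>\<mu> n) \<longlonglongrightarrow> (\<integral>x. exp (- real m * x) \<partial>\<nu>)"
  shows "weak_conv_m \<mu> \<nu>"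
proof (rule integral_cts_step_conv_imp_weak_conv[OF \<mu> \<nu>])
  fix x y :: real assume xy: "x < y"
  define h where "h t = (if 0 < t then cts_step x y (- ln t) else 0)" for t
  have cts: "continuous_on UNIV (cts_step x y)"
    using cts_step_uniformly_continuous[OF xy] by (rule uniformly_continuous_imp_continuous)
  \<comment> \<open>For such \<open>t\<close>, either \<open>- ln t\<close> lies beyond
    \<open>y\<close>, where \<open>cts_step x y\<close> is 0, or the default value applies; so
    \<open>h\<close> is continuous at 0.\<close>
  have h0: "h t = 0" if "t < exp (- y)" for t
  proof (cases "0 < t")
    case True
    then have "ln t < ln (exp (- y))" using that by (intro ln_less_cancel_iff[THEN iffD2]) auto
    then have "ln t < - y" by simp
    then show ?thesis using xy True by (auto simp: h_def cts_step_def)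
  qed (simp add: h_def)
  have h: "continuous_on {0..1} h"
  proof (rule continuous_on_subset)
    have "continuous_on ({..<exp (- y)} \<union> {0<..}) h"
    proof (rule continuous_on_open_Un)
      show "continuous_on {..<exp (- y)} h"
        by (rule continuous_on_eq[of _ "\<lambda>_. 0"]) (auto simp: h0)
      have "continuous_on {0<..} (\<lambda>t. cts_step x y (- ln t))"
        by (intro continuous_on_compose2[OF cts] continuous_intros) auto
      then show "continuous_on {0<..} h"
        by (rule continuous_on_eq) (auto simp: h_def)
    qed auto
    then show "continuous_on UNIV h"
    proof -
      have "{..<exp (- y)} \<union> {0<..} = UNIV"
        using exp_gt_zero[of "- y"] by (auto simp: not_less simp del: exp_gt_zero)
      then show ?thesis using \<open>continuous_on ({..<exp (- y)} \<union> {0<..}) h\<close> by simp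
    qed
  qed simp
  have approx: "\<exists>a N. \<forall>t\<in>{0..1}. \<bar>h t - (\<Sum>i\<le>N. a i * t ^ i)\<bar> < e" if "0 < e" for e
  proof -
    obtain g where g: "real_polynomial_function g" "\<And>t. t \<in> {0..1} \<Longrightarrow> \<bar>h t - g t\<bar> < e"
      using Stone_Weierstrass_real_polynomial_function[OF compact_Icc h \<open>0 < e\<close>] by blast
    from g(1) obtain a N where "g = (\<lambda>t. \<Sum>i\<le>N. a i * t ^ i)"
      unfolding real_polynomial_function_iff_sum by blast
    with g(2) show ?thesis by blast
  qed
  have close: "\<bar>(\<integral>u. cts_step x y u \<partial>M) - (\<Sum>i\<le>N. a i * (\<integral>u. exp (- real i * u) \<partial>M))\<bar> \<le> e"
    if M: "real_distribution M" "AE u in M. 0 \<le> u" and a: "\<forall>t\<in>{0..1}. \<bar>h t - (\<Sum>i\<le>N. a i * t ^ i)\<bar> < e" for M a N e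
  proof -
    interpret M: real_distribution M by fact
    have int: "integrable M (\<lambda>u. exp (- real i * u))" for i
      using M(2) by (intro M.integrable_const_bound[where B = 1]) auto
    have int_c: "integrable M (cts_step x y)" by (rule M.integrable_cts_step[OF xy])
    have int_p: "integrable M (\<lambda>u. \<Sum>i\<le>N. a i * exp (- real i * u))"
      by (intro Bochner_Integration.integrable_sum integrable_mult_right int)
    have "(\<integral>u. cts_step x y u \<partial>M) - (\<Sum>i\<le>N. a i * (\<integral>u. exp (- real i * u) \<partial>M))
       = (\<integral>u. cts_step x y u - (\<Sum>i\<le>N. a i * exp (- real i * u)) \<partial>M)"
      using int int_c int_p by (simp add: Bochner_Integration.integral_diff Bochner_Integration.integral_sum)
    also have "\<bar>\<dots>\<bar> \<le> (\<integral>u. \<bar>cts_step x y u - (\<Sum>i\<le>N. a i * exp (- real i * u))\<bar> \<partial>M)"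
      by (rule integral_abs_bound)
    also have "\<dots> \<le> (\<integral>u. e \<partial>M)"
    proof (intro integral_mono_AE integrable_abs Bochner_Integration.integrable_diff int_c int_p)
      show "AE u in M. \<bar>cts_step x y u - (\<Sum>i\<le>N. a i * exp (- real i * u))\<bar> \<le> e"
        using M(2)
      proof eventually_elim
        case (elim u)
        then have "exp (- u) \<in> {0..1}" by simp
        with a have "\<bar>h (exp (- u)) - (\<Sum>i\<le>N. a i * exp (- u) ^ i)\<bar> < e" by blast
        then show ?case by (simp add: h_def exp_of_nat_mult[symmetric])
      qed
    qed simp
    finally show ?thesis using M.prob_space by simp
  qed
  show "(\<lambda>n. \<integral>u. cts_step x y u \<partial>\<mu> n) \<longlonglongrightarrow> (\<integral>u. cts_step x y u \<partial>\<nu>)"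
  proof (rule LIMSEQ_I)
    fix r :: real assume r: "0 < r"
    obtain a N where a: "\<forall>t\<in>{0..1}. \<bar>h t - (\<Sum>i\<le>N. a i * t ^ i)\<bar> < r / 3"
      using approx[of "r / 3"] r by auto
    have "(\<lambda>n. \<Sum>i\<le>N. a i * (\<integral>u. exp (- real i * u) \<partial>\<mu> n)) \<longlonglongrightarrow> (\<Sum>i\<le>N. a i * (\<integral>u. exp (- real i * u) \<partial>\<nu>))"
      by (intro tendsto_intros lim)
    then have "eventually (\<lambda>n. dist (\<Sum>i\<le>N. a i * (\<integral>u. exp (- real i * u) \<partial>\<mu> n)) (\<Sum>i\<le>N. a i * (\<integral>u. exp (- real i * u) \<partial>\<nu>)) < r / 3) sequentially"
      by (rule tendstoD) (use r in simp)
    with nonneg(1) have "eventually (\<lambda>n. norm ((\<integral>u. cts_step x y u \<partial>\<mu> n) - (\<integral>u. cts_step x y u \<partial>\<nu>)) < r) sequentially"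
    proof eventually_elim
      case (elim n)
      show ?case
        using elim(2) close[OF \<mu> elim(1) a] close[OF \<nu> nonneg(2) a]
        unfolding dist_real_def real_norm_def by linarith
    qed
    then show "\<exists>no. \<forall>n\<ge>no. norm ((\<integral>u. cts_step x y u \<partial>\<mu> n) - (\<integral>u. cts_step x y u \<partial>\<nu>)) < r"
      by (simp add: eventually_sequentially)
  qed
qed

section \<open>The rank statistic\<close>

text \<open>With \<open>t j = sqrt (2 * m) * w j\<close> the right side is
  \<open>exp (- m * |w|\<^sup>2)\<close>, the integrand of a Laplace transform.\<close>

lemma iexp_sum_gaussian:
  fixes t :: "nat \<Rightarrow> real"
  shows "(\<integral>\<xi>. iexp (\<Sum>j<k. t j * \<xi> j) \<partial>(\<Pi>\<^sub>M i\<in>{..<k}. density lborel std_normal_density)) = exp (- (\<Sum>j<k. (t j)\<^sup>2) / 2)"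
proof -
  interpret N: prob_space "density lborel std_normal_density"
    by (rule prob_space_normal_density) simp
  interpret product_prob_space "\<lambda>_::nat. density lborel std_normal_density" "{..<k}"
    by unfold_locales
  have "(\<integral>\<xi>. iexp (\<Sum>j<k. t j * \<xi> j) \<partial>(\<Pi>\<^sub>M i\<in>{..<k}. density lborel std_normal_density)) 
    = (\<integral>\<xi>. (\<Prod>j<k. iexp (t j * \<xi> j)) \<partial>(\<Pi>\<^sub>M i\<in>{..<k}. density lborel std_normal_density))"
    by (simp add: exp_sum sum_distrib_left)
  also have "\<dots> = (\<Prod>j<k. \<integral>x. iexp (t j * x) \<partial>(density lborel std_normal_density))"
  proof (rule product_integral_prod)
    fix j
    show "integrable (density lborel std_normal_density) (\<lambda>x. iexp (t j * x))"
      by (rule N.integrable_const_bound[where B = 1]) auto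
  qed simp
  also have "\<dots> = (\<Prod>j<k. complex_of_real (exp (- ((t j)\<^sup>2) / 2)))"
    using char_std_normal_distribution by (intro prod.cong refl) (simp add: char_def fun_eq_iff)
  also have "\<dots> = exp (- (\<Sum>j<k. (t j)\<^sup>2) / 2)"
    by (simp add: exp_sum[symmetric] sum_negf sum_divide_distrib flip: of_real_prod)
  finally show ?thesis .
qed

section \<open>Linear forms of the statistic as stratified rank sums\<close>

definition A_perm :: "(real \<Rightarrow> real) \<Rightarrow> nat \<Rightarrow> (nat \<Rightarrow> nat) \<Rightarrow> (nat \<Rightarrow> nat \<Rightarrow> real ^ 'k) \<Rightarrow> (nat \<Rightarrow> nat \<Rightarrow> nat) \<Rightarrow> real ^ 'k" where
  "A_perm \<phi> S ns Z p = (1 / real (sample_size S ns)) *\<^sub>R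
     (\<Sum>s=1..S. \<Sum>i=1..ns s. score \<phi> (ns s) (p s i) *\<^sub>R (Z s i - stratum_mean ns Z s))"

text \<open>Ranks are taken within a stratum, so the common shift \<open>\<alpha> s\<close> leaves
  them unchanged.\<close>

lemma A_stat_eq_A_perm:
  assumes "\<And>s i. (s, i) \<in> units S ns \<Longrightarrow> x s i = \<alpha> s + r s i"
  shows "A_stat \<phi> S ns Z x = A_perm \<phi> S ns Z (rank_family S ns (\<lambda>(s, i). r s i))"
proof -
  have "rank_among (ns s) (x s) i = rank_family S ns (\<lambda>(s, i). r s i) s i"
    if "s \<in> {1..S}" "i \<in> {1..ns s}" for s i
  proof -
    have "rank_among (ns s) (x s) i = rank_among (ns s) (r s) i"
      unfolding rank_among_def using assms that
      by (intro arg_cong[of _ _ card]) (auto simp: units_def)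
    then show ?thesis using that by (simp add: rank_family_def rank_perm_def)
  qed
  then show ?thesis
    unfolding A_stat_def A_perm_def score_def by (intro arg_cong2[of _ _ _ _ scaleR] sum.cong refl) auto
qed

lemma transpose_Omega_star: "Finite_Cartesian_Product.transpose (Omega_star \<phi> S ns Z) = Omega_star \<phi> S ns Z"
  by (simp add: vec_eq_iff Finite_Cartesian_Product.transpose_def Omega_star_def outer_def mult.commute)

lemma quadratic_form_sum:
  fixes f :: "'a \<Rightarrow> real ^ 'k ^ 'k"
  shows "u \<bullet> ((\<Sum>x\<in>X. f x) *v u) = (\<Sum>x\<in>X. u \<bullet> (f x *v u))"
  by (induction X rule: infinite_finite_induct)
    (auto simp: matrix_vector_mult_add_rdistrib inner_add_right)

lemma quadratic_form_outer: "u \<bullet> (outer v *v u) = (u \<bullet> v)\<^sup>2"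
proof -
  have "outer v *v u = (v \<bullet> u) *\<^sub>R v"
    by (simp add: vec_eq_iff matrix_vector_mult_def outer_def inner_vec_def sum_distrib_left mult_ac)
  then show ?thesis by (simp add: inner_commute power2_eq_square)
qed

lemma quadratic_form_scaleR: "u \<bullet> ((a *\<^sub>R A) *v u) = a * (u \<bullet> (A *v u))"
  for A :: "real ^ 'k ^ 'k"
  by (simp flip: scaleR_matrix_vector_assoc)

context
  fixes \<phi> :: "real \<Rightarrow> real" and S :: nat and ns :: "nat \<Rightarrow> nat" and Z :: "nat \<Rightarrow> nat \<Rightarrow> real ^ 'k"
begin

text \<open>The coefficients of the scores in \<open>sqrt n * (u \<bullet> A_stat)\<close>;
  subtracting the stratum mean makes them sum to 0 in each stratum, as the locale requires.\<close>

definition coeff_lin :: "real ^ 'k \<Rightarrow> nat \<Rightarrow> nat \<Rightarrow> real" where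
  "coeff_lin u s i = (u \<bullet> (Z s i - stratum_mean ns Z s)) / sqrt (real (sample_size S ns))"

lemma inner_stratum_mean: "u \<bullet> stratum_mean ns Z s = (\<Sum>i=1..ns s. u \<bullet> Z s i) / real (ns s)"
  by (simp add: stratum_mean_def inner_sum_right)

lemma sum_coeff_lin: "(\<Sum>i=1..ns s. coeff_lin u s i) = 0"
  unfolding coeff_lin_def inner_diff_right inner_stratum_mean sum_divide_distrib[symmetric]
  by (cases "ns s = 0") (simp_all add: sum_subtractf)

interpretation strata "{1..S}" "\<lambda>s. {1..ns s}" "coeff_lin u" "\<lambda>s. score \<phi> (ns s)" for u
  by unfold_locales (simp, simp, rule sum_coeff_lin)

lemma T_eq_inner_A_perm: "T u p = sqrt (real (sample_size S ns)) * (u \<bullet> A_perm \<phi> S ns Z p)"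
proof -
  define n where "n = real (sample_size S ns)"
  have "sqrt n * (1 / n) = 1 / sqrt n"
    by (cases "n = 0") (simp_all add: n_def real_div_sqrt field_simps)
  then have "sqrt n * (u \<bullet> A_perm \<phi> S ns Z p) = 
      1 / sqrt n * (\<Sum>s=1..S. \<Sum>i=1..ns s. score \<phi> (ns s) (p s i) * (u \<bullet> (Z s i - stratum_mean ns Z s)))"
    unfolding A_perm_def n_def[symmetric] inner_scaleR_right mult.assoc[symmetric]
    by (simp only: inner_sum_right inner_scaleR_right)
  also have "\<dots> = T u p"
    by (simp add: T_def rank_sum_def coeff_lin_def n_def sum_distrib_left mult.commute del: One_nat_def)
  finally show ?thesis by (simp add: n_def)
qed

text \<open>\<open>Omega_star\<close> omits strata with fewer than two units whereas
  \<open>sig2\<close> sums over all; in the omitted ones the centred coefficients vanish.\<close>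

lemma sig2_eq_quadratic_form: "sig2 u = u \<bullet> (Omega_star \<phi> S ns Z *v u)"
proof -
  define n where "n = real (sample_size S ns)"
  have sv: "score_var \<phi> m = var {1..m} (score \<phi> m)" for m
    by (simp add: score_var_def score_mean_def var_def)
  have small: "(\<Sum>i=1..ns s. (coeff_lin u s i)\<^sup>2) = 0" if "\<not> 2 \<le> ns s" for s
  proof -
    consider "ns s = 0" | "ns s = 1" using \<open>\<not> 2 \<le> ns s\<close> by linarith
    then show ?thesis using sum_coeff_lin[of u s] by cases auto
  qed
  have sq: "(\<Sum>i=1..ns s. (coeff_lin u s i)\<^sup>2) = (\<Sum>i=1..ns s. (u \<bullet> (Z s i - stratum_mean ns Z s))\<^sup>2) / n" for s
    by (simp add: coeff_lin_def n_def power_divide sum_divide_distrib)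
  have "u \<bullet> (Omega_star \<phi> S ns Z *v u) = (1 / n) * (\<Sum>s | s \<in> {1..S} \<and> 2 \<le> ns s.
      score_var \<phi> (ns s) * (\<Sum>i=1..ns s. (u \<bullet> (Z s i - stratum_mean ns Z s))\<^sup>2))"
    unfolding Omega_star_def quadratic_form_scaleR quadratic_form_sum quadratic_form_outer n_def ..
  also have "\<dots> = (\<Sum>s | s \<in> {1..S} \<and> 2 \<le> ns s. (\<Sum>i=1..ns s. (coeff_lin u s i)\<^sup>2) * var {1..ns s} (score \<phi> (ns s)))"
    unfolding sq sv by (subst sum_distrib_left) (intro sum.cong refl, simp add: mult_ac)
  also have "\<dots> = sig2 u"
    unfolding sig2_def by (rule sum.mono_neutral_left) (auto simp: small simp del: One_nat_def)
  finally show ?thesis ..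
qed

text \<open>Centring within a stratum can only decrease a sum of squares; the rest is
  Cauchy-Schwarz.\<close>

lemma gam_le:
  "gam u \<le> (norm u)\<^sup>2 * ((\<Sum>s=1..S. \<Sum>i=1..ns s. (norm (Z s i))\<^sup>2) / real (sample_size S ns))"
proof -
  define n where "n = real (sample_size S ns)"
  have "(\<Sum>i=1..ns s. (coeff_lin u s i)\<^sup>2) \<le> (norm u)\<^sup>2 * (\<Sum>i=1..ns s. (norm (Z s i))\<^sup>2) / n" for s
  proof -
    have "(\<Sum>i=1..ns s. (coeff_lin u s i)\<^sup>2) = (\<Sum>i=1..ns s. (u \<bullet> Z s i - (\<Sum>i=1..ns s. u \<bullet> Z s i) / real (card {1..ns s}))\<^sup>2) / n"
      by (simp add: coeff_lin_def n_def power_divide sum_divide_distrib inner_diff_right inner_stratum_mean)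
    also have "\<dots> \<le> (\<Sum>i=1..ns s. (u \<bullet> Z s i)\<^sup>2) / n"
      by (intro divide_right_mono sum_centered_squares_le) (auto simp: n_def)
    also have "\<dots> \<le> (\<Sum>i=1..ns s. (norm u)\<^sup>2 * (norm (Z s i))\<^sup>2) / n"
    proof (intro divide_right_mono sum_mono)
      fix i
      have "(u \<bullet> Z s i)\<^sup>2 \<le> (norm u * norm (Z s i))\<^sup>2"
        using Cauchy_Schwarz_ineq2[of u "Z s i"] by (simp add: abs_le_square_iff[symmetric])
      then show "(u \<bullet> Z s i)\<^sup>2 \<le> (norm u)\<^sup>2 * (norm (Z s i))\<^sup>2" by (simp add: power_mult_distrib)
    qed (simp add: n_def)
    finally show ?thesis by (simp add: sum_distrib_left)
  qed
  then have "gam u \<le> (\<Sum>s=1..S. (norm u)\<^sup>2 * (\<Sum>i=1..ns s. (norm (Z s i))\<^sup>2) / n)"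
    unfolding gam_def by (intro sum_mono)
  then show ?thesis by (simp add: n_def sum_distrib_left sum_divide_distrib)
qed

lemma abs_coeff_lin_le:
  assumes z: "\<And>i. i \<in> {1..ns s} \<Longrightarrow> norm (Z s i) \<le> z" and i: "i \<in> {1..ns s}"
  shows "\<bar>coeff_lin u s i\<bar> \<le> 2 * norm u * (z / sqrt (real (sample_size S ns)))"
proof -
  have "norm (stratum_mean ns Z s) = norm (\<Sum>i=1..ns s. Z s i) / real (ns s)"
    by (simp add: stratum_mean_def)
  also have "\<dots> \<le> (\<Sum>i=1..ns s. z) / real (ns s)"
    using z by (intro divide_right_mono order.trans[OF norm_sum] sum_mono) auto
  also have "\<dots> = z" using i by simp
  finally have "norm (Z s i - stratum_mean ns Z s) \<le> 2 * z"
    using z[OF i] norm_triangle_ineq4[of "Z s i" "stratum_mean ns Z s"] by linarith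
  then have "\<bar>u \<bullet> (Z s i - stratum_mean ns Z s)\<bar> \<le> norm u * (2 * z)"
    using Cauchy_Schwarz_ineq2[of u "Z s i - stratum_mean ns Z s"]
    by (meson mult_left_mono norm_ge_zero order.trans)
  then have "\<bar>u \<bullet> (Z s i - stratum_mean ns Z s)\<bar> / sqrt (real (sample_size S ns)) \<le> norm u * (2 * z) / sqrt (real (sample_size S ns))"
    by (intro divide_right_mono) auto
  then show ?thesis by (simp add: coeff_lin_def mult_ac)
qed

text \<open>\<open>M\<close> and \<open>G\<close> contain the bound \<open>b\<close> instead of
  \<open>norm u\<close>, so the error is controlled uniformly over directions of bounded
  length.\<close>

lemma char_fun_A_perm_bound:
  assumes K: "0 \<le> K" and e: "0 \<le> e"
    and trunc: "\<And>m. (\<Sum>l=1..m. (score \<phi> m l - clip K (score \<phi> m l))\<^sup>2) / real m \<le> e"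
    and z: "\<And>s i. (s, i) \<in> units S ns \<Longrightarrow> norm (Z s i) \<le> z" "0 \<le> z" 
    and C: "(\<Sum>s=1..S. \<Sum>i=1..ns s. (norm (Z s i))\<^sup>2) / real (sample_size S ns) \<le> C" "0 \<le> C"
    and u: "norm u \<le> b"
  defines "\<sigma> \<equiv> u \<bullet> (Omega_star \<phi> S ns Z *v u)" and "M \<equiv> 2 * b * (z / sqrt (real (sample_size S ns)))" and "G \<equiv> b\<^sup>2 * C"
  shows "cmod (avg (perm_families S ns) (\<lambda>p. iexp (sqrt (real (sample_size S ns)) * (u \<bullet> A_perm \<phi> S ns Z p))) - exp (- \<sigma> / 2)) \<le> 
    (sqrt (2 * e * G) + sqrt (2 * e * G * \<sigma>) + e * G) + (4 * K ^ 3 * M * G + sqrt (13 * K ^ 4 * M\<^sup>2 * G))"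
proof -
  have b: "0 \<le> b" using u norm_ge_zero order.trans by blast
  have "gam u \<le> G"
  proof -
    have "gam u \<le> (norm u)\<^sup>2 * C"
      using gam_le[of u] C by (meson mult_left_mono order.trans zero_le_power2)
    also have "\<dots> \<le> G" unfolding G_def using u C by (intro mult_right_mono power_mono) auto
    finally show ?thesis .
  qed
  moreover have "\<bar>coeff_lin u s i\<bar> \<le> M" if "s \<in> {1..S}" "i \<in> {1..ns s}" for s i
  proof -
    have "\<bar>coeff_lin u s i\<bar> \<le> 2 * norm u * (z / sqrt (real (sample_size S ns)))"
      using z(1) that by (intro abs_coeff_lin_le) (auto simp: units_def)
    also have "\<dots> \<le> M" unfolding M_def using u z(2) by (intro mult_right_mono) auto
    finally show ?thesis .
  qed
  moreover have "0 \<le> M" unfolding M_def using b z(2) by simp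
  moreover have "PP = perm_families S ns" by (simp only: PP_def perm_families_def)
  ultimately show ?thesis
    using char_fun_bound_truncated[of K e u M G] K e trunc
    by (simp add: T_eq_inner_A_perm[symmetric] sig2_eq_quadratic_form[symmetric] \<sigma>_def)
qed

end

text \<open>The direction may move with \<open>N\<close>; only its length is bounded and its
  variance fixed. The constants are chosen in the order \<open>e\<close>, \<open>K\<close>,
  \<open>N\<close>: the level \<open>K\<close> may be huge for small \<open>e\<close>, but it is
  fixed before \<open>M N\<close> is sent to 0.\<close>

lemma char_fun_A_perm_tendsto:
  fixes Z :: "nat \<Rightarrow> nat \<Rightarrow> nat \<Rightarrow> real ^ 'k"
  assumes score: "score_function \<phi>"
    and Z_max: "(\<lambda>N. Max ((\<lambda>(s, i). norm (Z N s i)) ` units (S N) (ns N))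
        / sqrt (real (sample_size (S N) (ns N)))) \<longlonglongrightarrow> 0"
    and Z_sq: "\<And>N. (\<Sum>s=1..S N. \<Sum>i=1..ns N s. (norm (Z N s i))\<^sup>2)
        / real (sample_size (S N) (ns N)) < C0" and C0: "0 < C0"
    and ne: "\<And>N. units (S N) (ns N) \<noteq> {}"
    and u: "eventually (\<lambda>N. norm (u N) \<le> b \<and> u N \<bullet> (Omega_star \<phi> (S N) (ns N) (Z N) *v u N) = \<sigma>) sequentially"
  shows "(\<lambda>N. avg (perm_families (S N) (ns N))
      (\<lambda>p. iexp (sqrt (real (sample_size (S N) (ns N))) * (u N \<bullet> A_perm \<phi> (S N) (ns N) (Z N) p))))
    \<longlonglongrightarrow> exp (- \<sigma> / 2)"
proof (rule tendstoI)
  fix \<eta> :: real assume \<eta>: "0 < \<eta>"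
  define G where "G = b\<^sup>2 * C0"
  define z where "z N = Max ((\<lambda>(s, i). norm (Z N s i)) ` units (S N) (ns N))" for N
  define M where "M N = 2 * b * (z N / sqrt (real (sample_size (S N) (ns N))))" for N
  have z: "norm (Z N s i) \<le> z N" if "(s, i) \<in> units (S N) (ns N)" for N s i
    unfolding z_def using that by (intro Max_ge) (auto simp: finite_units intro: image_eqI[of _ _ "(s, i)"])
  have z0: "0 \<le> z N" for N
  proof -
    obtain s i where "(s, i) \<in> units (S N) (ns N)" using ne[of N] by (metis ex_in_conv prod.exhaust)
    with z show ?thesis using norm_ge_zero order.trans by blast
  qed
  have M: "M \<longlonglongrightarrow> 0"
    unfolding M_def z_def using tendsto_mult_left[OF Z_max, of "2 * b"] by simp
  \<comment> \<open>Because the variance is the constant \<open>\<sigma>\<close>, the truncation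
    error does not involve \<open>N\<close> and can be made small beforehand.\<close>
  have "((\<lambda>e. sqrt (2 * e * G) + sqrt (2 * e * G * \<sigma>) + e * G) \<longlongrightarrow> sqrt (2 * 0 * G) + sqrt (2 * 0 * G * \<sigma>) + 0 * G) (at_right 0)"
    by (intro tendsto_intros)
  then have "eventually (\<lambda>e. sqrt (2 * e * G) + sqrt (2 * e * G * \<sigma>) + e * G < \<eta> / 2) (at_right 0)"
    using \<eta> by (intro order_tendstoD(2)) auto
  then have "eventually (\<lambda>e. 0 < e \<and> sqrt (2 * e * G) + sqrt (2 * e * G * \<sigma>) + e * G < \<eta> / 2) (at_right (0::real))"
    using eventually_at_right_less[of "0::real"] by eventually_elim auto
  then obtain e where e: "0 < e" "sqrt (2 * e * G) + sqrt (2 * e * G * \<sigma>) + e * G < \<eta> / 2"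
    by (metis (mono_tags, lifting) eventually_happens' trivial_limit_at_right_real)
  obtain K where K: "0 \<le> K" "\<And>m. (\<Sum>l=1..m. (score \<phi> m l - clip K (score \<phi> m l))\<^sup>2) / real m \<le> e"
    using score_truncation[OF score e(1)] by blast
  have "(\<lambda>N. 4 * K ^ 3 * M N * G + sqrt (13 * K ^ 4 * (M N)\<^sup>2 * G)) \<longlonglongrightarrow> 4 * K ^ 3 * 0 * G + sqrt (13 * K ^ 4 * 0\<^sup>2 * G)"
    by (intro tendsto_intros M)
  then have "eventually (\<lambda>N. 4 * K ^ 3 * M N * G + sqrt (13 * K ^ 4 * (M N)\<^sup>2 * G) < \<eta> / 2) sequentially"
    using \<eta> by (intro order_tendstoD(2)) auto
  with u show "eventually (\<lambda>N. dist (avg (perm_families (S N) (ns N))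
      (\<lambda>p. iexp (sqrt (real (sample_size (S N) (ns N))) * (u N \<bullet> A_perm \<phi> (S N) (ns N) (Z N) p))))
      (complex_of_real (exp (- \<sigma> / 2))) < \<eta>) sequentially"
  proof eventually_elim
    case (elim N)
    have "cmod (avg (perm_families (S N) (ns N))
      (\<lambda>p. iexp (sqrt (real (sample_size (S N) (ns N))) * (u N \<bullet> A_perm \<phi> (S N) (ns N) (Z N) p)))
      - complex_of_real (exp (- (u N \<bullet> (Omega_star \<phi> (S N) (ns N) (Z N) *v u N)) / 2)))
      \<le> (sqrt (2 * e * (b\<^sup>2 * C0)) + sqrt (2 * e * (b\<^sup>2 * C0) * (u N \<bullet> (Omega_star \<phi> (S N) (ns N) (Z N) *v u N))) + e * (b\<^sup>2 * C0))
        + (4 * K ^ 3 * (2 * b * (z N / sqrt (real (sample_size (S N) (ns N))))) * (b\<^sup>2 * C0)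
          + sqrt (13 * K ^ 4 * (2 * b * (z N / sqrt (real (sample_size (S N) (ns N)))))\<^sup>2 * (b\<^sup>2 * C0)))"
      by (rule char_fun_A_perm_bound) (use K e(1) z z0 Z_sq[of N] C0 elim(1) in \<open>auto simp: less_imp_le\<close>)
    then show ?case
      using e(2) elim(2) conjunct2[OF elim(1)] by (simp add: dist_norm G_def M_def)
  qed
qed

text \<open>The first two properties turn the statistic into a sum of squares; the third bounds the
  length of a direction by its variance.\<close>

lemma Omega_orthonormal_family:
  fixes Om :: "real ^ 'k ^ 'k"
  assumes sym: "Finite_Cartesian_Product.transpose Om = Om" and lam: "0 < lam" "lam < min_eigenvalue Om"
  obtains e where "\<And>i j. i < CARD('k) \<Longrightarrow> j < CARD('k) \<Longrightarrow> e i \<bullet> (Om *v e j) = (if i = j then 1 else 0)"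
    "\<And>a. a \<bullet> (matrix_inv Om *v a) = (\<Sum>j<CARD('k). (e j \<bullet> a)\<^sup>2)"
    "\<And>v. lam * (norm v)\<^sup>2 \<le> v \<bullet> (Om *v v)"
proof -
  have low: "lam * (norm v)\<^sup>2 \<le> v \<bullet> (Om *v v)" for v
  proof -
    have "lam * (norm v)\<^sup>2 \<le> min_eigenvalue Om * (norm v)\<^sup>2" using lam by (intro mult_right_mono) auto
    with min_eigenvalue_le_quadratic_form[OF sym, of v] show ?thesis by linarith
  qed
  have pos: "0 < v \<bullet> (Om *v v)" if "v \<noteq> 0" for v
  proof -
    have "0 < lam * (norm v)\<^sup>2" using lam that by simp
    with low[of v] show ?thesis by linarith
  qed
  obtain e where e: "\<And>i j. i < CARD('k) \<Longrightarrow> j < CARD('k) \<Longrightarrow> e i \<bullet> (Om *v e j) = (if i = j then 1 else 0)"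
    using orthonormal_family_exists[OF sym pos order.refl] by blast
  show ?thesis using that[OF e inverse_quadratic_form[OF sym pos e] low] by blast
qed

section \<open>Convergence of the quadratic statistic\<close>

theorem proposition4p3:
  fixes M :: "nat \<Rightarrow> 'w measure"
    and S :: "nat \<Rightarrow> nat"
    and ns :: "nat \<Rightarrow> nat \<Rightarrow> nat"
    and Z :: "nat \<Rightarrow> nat \<Rightarrow> nat \<Rightarrow> real ^ 'k"
    and Y D r :: "nat \<Rightarrow> nat \<Rightarrow> nat \<Rightarrow> 'w \<Rightarrow> real"
    and \<alpha> :: "nat \<Rightarrow> nat \<Rightarrow> real"
    and \<phi> :: "real \<Rightarrow> real"
    and \<beta> \<beta>0 lam \<delta> C0 :: real
  assumes prob: "\<And>N. prob_space (M N)"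
    and strata: "\<And>N. 1 \<le> S N"
    and sizes: "\<And>N s. s \<in> {1..S N} \<Longrightarrow> 1 \<le> ns N s"
    and D_rv: "\<And>N s i. (s, i) \<in> units (S N) (ns N) \<Longrightarrow> D N s i \<in> borel_measurable (M N)"
    and model: "\<And>N s i w. (s, i) \<in> units (S N) (ns N) \<Longrightarrow> w \<in> space (M N) \<Longrightarrow>
        Y N s i w = \<alpha> N s + D N s i w * \<beta> + r N s i w"
    and score: "score_function \<phi>"
    and lam_pos: "0 < lam"
    and eig: "ereal lam <
        liminf (\<lambda>N. ereal (min_eigenvalue (Omega_star \<phi> (S N) (ns N) (Z N))))"
    and delta_pos: "0 < \<delta>"
    and C0_pos: "0 < C0"
    and Z_max: "(\<lambda>N. Max ((\<lambda>(s, i). norm (Z N s i)) ` units (S N) (ns N))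
        / sqrt (real (sample_size (S N) (ns N)))) \<longlonglongrightarrow> 0"
    and Z_sq: "\<And>N. (\<Sum>s=1..S N. \<Sum>i=1..ns N s. (norm (Z N s i))\<^sup>2)
        / real (sample_size (S N) (ns N)) < C0"
    and phi_int: "set_integrable lebesgue {0<..<1} (\<lambda>x. \<bar>\<phi> x\<bar> powr (2 + \<delta>))"
    and phi_bd: "(LINT x:{0<..<1}|lebesgue. \<bar>\<phi> x\<bar> powr (2 + \<delta>)) < C0"
    and indep: "\<And>N. prob_space.indep_vars (M N) (\<lambda>_. borel) (\<lambda>(s, i). r N s i)
        (units (S N) (ns N))"
    and ident: "\<And>N s i j. (s, i) \<in> units (S N) (ns N) \<Longrightarrow> (s, j) \<in> units (S N) (ns N) \<Longrightarrow>
        distr (M N) borel (r N s i) = distr (M N) borel (r N s j)"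
    and cont: "\<And>N s i. (s, i) \<in> units (S N) (ns N) \<Longrightarrow>
        continuous_distribution (distr (M N) borel (r N s i))"
    and n_minus_S: "filterlim (\<lambda>N. real (sample_size (S N) (ns N)) - real (S N))
        at_top sequentially"
    and H0: "\<beta> = \<beta>0"
  shows "weak_conv_m
      (\<lambda>N. distr (M N) borel
        (\<lambda>w. B_stat \<phi> (S N) (ns N) (Z N) (\<lambda>s i. Y N s i w - \<beta>0 * D N s i w)))
      (chi_squared CARD('k))"
proof -
  let ?k = "CARD('k)"
  let ?n = "\<lambda>N. real (sample_size (S N) (ns N))"
  let ?Om = "\<lambda>N. Omega_star \<phi> (S N) (ns N) (Z N)"
  let ?PF = "\<lambda>N. perm_families (S N) (ns N)"
  let ?A = "\<lambda>N. A_perm \<phi> (S N) (ns N) (Z N)"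
  define \<gamma> where "\<gamma> = (\<Pi>\<^sub>M i\<in>{..<?k}. density lborel std_normal_density)"
  define B where "B N p = ?n N * (?A N p \<bullet> (matrix_inv (?Om N) *v ?A N p))" for N p
  define X where "X N w = B_stat \<phi> (S N) (ns N) (Z N) (\<lambda>s i. Y N s i w - \<beta>0 * D N s i w)" for N w
  have ne: "units (S N) (ns N) \<noteq> {}" for N
  proof -
    have "(1, 1) \<in> units (S N) (ns N)" using strata[of N] sizes[of 1 N] by (simp add: units_def)
    then show ?thesis by blast
  qed
  \<comment> \<open>Under the null hypothesis the endogenous term cancels, and what is ranked is
    \<open>r\<close> plus a stratum constant.\<close>
  have X_eq: "X N w = B N (rank_family (S N) (ns N) (\<lambda>(s, i). r N s i w))" if "w \<in> space (M N)" for N w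
  proof -
    have "A_stat \<phi> (S N) (ns N) (Z N) (\<lambda>s i. Y N s i w - \<beta>0 * D N s i w)
       = ?A N (rank_family (S N) (ns N) (\<lambda>(s, i). r N s i w))"
      by (rule A_stat_eq_A_perm[where \<alpha> = "\<alpha> N"]) (simp add: model that H0 mult.commute)
    then show ?thesis by (simp add: X_def B_def B_stat_def)
  qed
  have rank_law: "(\<lambda>w. F (rank_family (S N) (ns N) (\<lambda>(s, i). r N s i w))) \<in> borel_measurable (M N)"
    "(\<integral>w. F (rank_family (S N) (ns N) (\<lambda>(s, i). r N s i w)) \<partial>M N) = avg (?PF N) F" for F :: "_ \<Rightarrow> real" and N
    using expectation_rank_family[OF prob ne indep ident cont, of N F] by auto
  have mX [measurable]: "X N \<in> borel_measurable (M N)" for N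
    using rank_law(1)[of "B N" N] by (subst measurable_cong[OF X_eq])
  define \<mu> where "\<mu> N = distr (M N) borel (X N)" for N
  have int_\<mu>: "(\<integral>x. f x \<partial>\<mu> N) = avg (?PF N) (\<lambda>p. f (B N p))" if "f \<in> borel_measurable borel" for f :: "real \<Rightarrow> real" and N
  proof -
    have "(\<integral>x. f x \<partial>\<mu> N) = (\<integral>w. f (X N w) \<partial>M N)"
      unfolding \<mu>_def by (rule integral_distr[OF mX that])
    also have "\<dots> = (\<integral>w. f (B N (rank_family (S N) (ns N) (\<lambda>(s, i). r N s i w))) \<partial>M N)"
      by (rule Bochner_Integration.integral_cong) (simp_all add: X_eq)
    also have "\<dots> = avg (?PF N) (\<lambda>p. f (B N p))" by (rule rank_law(2))
    finally show ?thesis .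
  qed
  define good where "good N e \<longleftrightarrow>
      (\<forall>i<?k. \<forall>j<?k. e i \<bullet> (?Om N *v e j) = (if i = j then 1 else 0)) \<and>
      (\<forall>a. a \<bullet> (matrix_inv (?Om N) *v a) = (\<Sum>j<?k. (e j \<bullet> a)\<^sup>2)) \<and>
      (\<forall>v. lam * (norm v)\<^sup>2 \<le> v \<bullet> (?Om N *v v))" for N and e :: "nat \<Rightarrow> real ^ 'k"
  \<comment> \<open>The eigenvalue bound holds only from some \<open>N\<close> on; for earlier
    \<open>N\<close> the choice is arbitrary, and every use of \<open>good\<close> is under
    \<open>eventually\<close>.\<close>
  define e where "e N = (SOME e. good N e)" for N
  have good: "eventually (\<lambda>N. good N (e N)) sequentially"
    using less_LiminfD[OF eig]
  proof eventually_elim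
    case (elim N)
    then have "lam < min_eigenvalue (?Om N)" by simp
    then have "\<exists>e. good N e"
      using Omega_orthonormal_family[OF transpose_Omega_star lam_pos] unfolding good_def by metis
    then show ?case unfolding e_def by (rule someI_ex)
  qed
  define w where "w N j p = sqrt (?n N) * (e N j \<bullet> ?A N p)" for N j p
  have B_sum: "B N p = (\<Sum>j<?k. (w N j p)\<^sup>2)" if "good N (e N)" for N p
    using that by (simp add: good_def B_def w_def power_mult_distrib sum_distrib_left)
  have clt: "(\<lambda>N. avg (?PF N) (\<lambda>p. iexp (\<Sum>j<?k. x j * w N j p))) \<longlonglongrightarrow> exp (- (\<Sum>j<?k. (x j)\<^sup>2) / 2)" for x :: "nat \<Rightarrow> real"
  proof -
    define u where "u N = (\<Sum>j<?k. x j *\<^sub>R e N j)" for N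
    define \<sigma> where "\<sigma> = (\<Sum>j<?k. (x j)\<^sup>2)"
    have "(\<lambda>N. avg (?PF N) (\<lambda>p. iexp (sqrt (?n N) * (u N \<bullet> ?A N p)))) \<longlonglongrightarrow> exp (- \<sigma> / 2)"
    proof (rule char_fun_A_perm_tendsto[OF score Z_max Z_sq C0_pos ne])
      \<comment> \<open>\<open>lam * (norm (u N))\<^sup>2\<close> is at most the variance
        \<open>\<sigma>\<close>, so the length bound does not depend on \<open>N\<close>.\<close>
      show "eventually (\<lambda>N. norm (u N) \<le> sqrt (\<sigma> / lam) \<and> u N \<bullet> (?Om N *v u N) = \<sigma>) sequentially"
        using good
      proof eventually_elim
        case (elim N)
        have s: "u N \<bullet> (?Om N *v u N) = \<sigma>"
          unfolding u_def \<sigma>_def using elim by (intro quadratic_form_orthonormal) (auto simp: good_def)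
        have "lam * (norm (u N))\<^sup>2 \<le> \<sigma>" using elim s unfolding good_def by metis
        then have "norm (u N) \<le> sqrt (\<sigma> / lam)" using lam_pos by (intro real_le_rsqrt) (simp add: field_simps)
        with s show ?case by simp
      qed
    qed
    moreover have "sqrt (?n N) * (u N \<bullet> ?A N p) = (\<Sum>j<?k. x j * w N j p)" for N p
      by (simp add: u_def w_def inner_sum_left sum_distrib_left mult_ac)
    ultimately show ?thesis by (simp add: \<sigma>_def)
  qed
  have N01: "prob_space (density lborel std_normal_density)"
    by (rule prob_space_normal_density) simp
  interpret \<gamma>: prob_space \<gamma> unfolding \<gamma>_def by (rule prob_space_PiM) (rule N01)
  have comp [measurable]: "(\<lambda>\<xi>. \<xi> j) \<in> borel_measurable \<gamma>" if "j < ?k" for j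
  proof -
    have "(\<lambda>\<xi>. \<xi> j) \<in> \<gamma> \<rightarrow>\<^sub>M density lborel std_normal_density"
      unfolding \<gamma>_def using that by (intro measurable_component_singleton) auto
    then show ?thesis by simp
  qed
  have m_sq [measurable]: "(\<lambda>\<xi>. \<Sum>j<?k. (\<xi> j)\<^sup>2) \<in> borel_measurable \<gamma>"
    by (intro borel_measurable_sum borel_measurable_power comp) auto
  have chi: "chi_squared ?k = distr \<gamma> borel (\<lambda>\<xi>. \<Sum>j<?k. (\<xi> j)\<^sup>2)"
    by (simp add: chi_squared_def \<gamma>_def)
  have "weak_conv_m \<mu> (chi_squared ?k)"
  proof (rule weak_conv_m_of_Laplace)
    show "real_distribution (\<mu> N)" for N
      unfolding \<mu>_def by (rule prob_space.real_distribution_distr[OF prob mX])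
    show "real_distribution (chi_squared ?k)"
      unfolding chi by (rule \<gamma>.real_distribution_distr[OF m_sq])
    show "AE x in chi_squared ?k. 0 \<le> x"
      unfolding chi by (subst AE_distr_iff[OF m_sq]) (auto intro!: sum_nonneg)
    show "eventually (\<lambda>N. AE x in \<mu> N. 0 \<le> x) sequentially"
      using good
    proof eventually_elim
      case (elim N)
      have "AE w in M N. 0 \<le> X N w"
        by (rule AE_I2) (simp add: X_eq B_sum[OF elim] sum_nonneg)
      then show ?case unfolding \<mu>_def by (subst AE_distr_iff[OF mX]) auto
    qed
    fix m :: nat
    \<comment> \<open>The scale \<open>sqrt (2 * m)\<close> makes the Gaussian average of
      \<open>iexp\<close> equal to \<open>exp (- m * |w|\<^sup>2)\<close>. For fixed
      \<open>\<xi>\<close> the integrand converges by \<open>clt\<close>, and averages of unit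
      complex numbers are dominated by 1.\<close>
    have "(\<lambda>N. \<integral>\<xi>. avg (?PF N) (\<lambda>p. iexp (\<Sum>j<?k. (sqrt (2 * real m) * \<xi> j) * w N j p)) \<partial>\<gamma>)
       \<longlonglongrightarrow> (\<integral>\<xi>. complex_of_real (exp (- (\<Sum>j<?k. (sqrt (2 * real m) * \<xi> j)\<^sup>2) / 2)) \<partial>\<gamma>)"
    proof (rule integral_dominated_convergence[where w = "\<lambda>_. 1"])
      show "AE \<xi> in \<gamma>. (\<lambda>N. avg (?PF N) (\<lambda>p. iexp (\<Sum>j<?k. (sqrt (2 * real m) * \<xi> j) * w N j p)))
         \<longlonglongrightarrow> complex_of_real (exp (- (\<Sum>j<?k. (sqrt (2 * real m) * \<xi> j)\<^sup>2) / 2))"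
        by (intro AE_I2 clt)
      show "AE \<xi> in \<gamma>. cmod (avg (?PF N) (\<lambda>p. iexp (\<Sum>j<?k. (sqrt (2 * real m) * \<xi> j) * w N j p))) \<le> 1" for N
      proof (rule AE_I2)
        fix \<xi>
        have "cmod (avg (?PF N) (\<lambda>p. iexp (\<Sum>j<?k. (sqrt (2 * real m) * \<xi> j) * w N j p)))
           \<le> avg (?PF N) (\<lambda>p. cmod (iexp (\<Sum>j<?k. (sqrt (2 * real m) * \<xi> j) * w N j p)))" by (rule norm_avg_le)
        also have "\<dots> = 1"
          using avg_const[OF finite_perm_families perm_families_nonempty, where a = "1::real"]
          by (simp only: cmod_iexp)
        finally show "cmod (avg (?PF N) (\<lambda>p. iexp (\<Sum>j<?k. (sqrt (2 * real m) * \<xi> j) * w N j p))) \<le> 1" .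
      qed
    qed (simp_all add: avg_def)
    also have "(\<integral>\<xi>. complex_of_real (exp (- (\<Sum>j<?k. (sqrt (2 * real m) * \<xi> j)\<^sup>2) / 2)) \<partial>\<gamma>)
      = complex_of_real (\<integral>x. exp (- real m * x) \<partial>chi_squared ?k)"
    proof -
      have "(\<integral>x. exp (- real m * x) \<partial>chi_squared ?k) = (\<integral>\<xi>. exp (- real m * (\<Sum>j<?k. (\<xi> j)\<^sup>2)) \<partial>\<gamma>)"
        unfolding chi by (rule integral_distr[OF m_sq]) simp
      moreover have "- (\<Sum>j<?k. (sqrt (2 * real m) * \<xi> j)\<^sup>2) / 2 = - real m * (\<Sum>j<?k. (\<xi> j)\<^sup>2)" for \<xi> :: "nat \<Rightarrow> real"
        by (simp add: power_mult_distrib sum_distrib_left[symmetric])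
      ultimately show ?thesis by simp
    qed
    finally have lim: "(\<lambda>N. \<integral>\<xi>. avg (?PF N) (\<lambda>p. iexp (\<Sum>j<?k. (sqrt (2 * real m) * \<xi> j) * w N j p)) \<partial>\<gamma>)
       \<longlonglongrightarrow> complex_of_real (\<integral>x. exp (- real m * x) \<partial>chi_squared ?k)" .
    \<comment> \<open>Averages over permutations are finite sums, so linearity moves the Gaussian
      integral inside. There it produces the Laplace transform of \<open>B N p\<close>, as soon as
      the basis is \<open>good\<close>.\<close>
    have "eventually (\<lambda>N. (\<integral>\<xi>. avg (?PF N) (\<lambda>p. iexp (\<Sum>j<?k. (sqrt (2 * real m) * \<xi> j) * w N j p)) \<partial>\<gamma>)
       = complex_of_real (\<integral>x. exp (- real m * x) \<partial>\<mu> N)) sequentially"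
      using good
    proof eventually_elim
      case (elim N)
      have gauss: "(\<integral>\<xi>. iexp (\<Sum>j<?k. (sqrt (2 * real m) * \<xi> j) * w N j p) \<partial>\<gamma>) = complex_of_real (exp (- real m * B N p))" for p
      proof -
        have "(\<integral>\<xi>. iexp (\<Sum>j<?k. (sqrt (2 * real m) * \<xi> j) * w N j p) \<partial>\<gamma>)
          = (\<integral>\<xi>. iexp (\<Sum>j<?k. (sqrt (2 * real m) * w N j p) * \<xi> j) \<partial>\<gamma>)"
          by (simp only: mult_ac)
        also have "\<dots> = exp (- (\<Sum>j<?k. (sqrt (2 * real m) * w N j p)\<^sup>2) / 2)"
          unfolding \<gamma>_def by (rule iexp_sum_gaussian)
        also have "- (\<Sum>j<?k. (sqrt (2 * real m) * w N j p)\<^sup>2) / 2 = - real m * B N p"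
          by (simp add: B_sum[OF elim] power_mult_distrib sum_distrib_left[symmetric])
        finally show ?thesis .
      qed
      have int: "integrable \<gamma> (\<lambda>\<xi>. iexp (\<Sum>j<?k. (sqrt (2 * real m) * \<xi> j) * w N j p))" for p
        by (rule \<gamma>.integrable_const_bound[where B = 1]) simp_all
      have "(\<integral>\<xi>. avg (?PF N) (\<lambda>p. iexp (\<Sum>j<?k. (sqrt (2 * real m) * \<xi> j) * w N j p)) \<partial>\<gamma>)
        = avg (?PF N) (\<lambda>p. \<integral>\<xi>. iexp (\<Sum>j<?k. (sqrt (2 * real m) * \<xi> j) * w N j p) \<partial>\<gamma>)"
        unfolding avg_def by (simp only: integral_scaleR_right Bochner_Integration.integral_sum[OF int])
      also have "\<dots> = avg (?PF N) (\<lambda>p. complex_of_real (exp (- real m * B N p)))"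
        by (simp only: gauss)
      also have "\<dots> = complex_of_real (avg (?PF N) (\<lambda>p. exp (- real m * B N p)))"
        by (simp add: avg_def scaleR_conv_of_real)
      also have "avg (?PF N) (\<lambda>p. exp (- real m * B N p)) = (\<integral>x. exp (- real m * x) \<partial>\<mu> N)"
        by (rule int_\<mu>[symmetric]) simp
      finally show ?case .
    qed
    with lim have "(\<lambda>N. complex_of_real (\<integral>x. exp (- real m * x) \<partial>\<mu> N)) \<longlonglongrightarrow> complex_of_real (\<integral>x. exp (- real m * x) \<partial>chi_squared ?k)"
      by (rule Lim_transform_eventually)
    then show "(\<lambda>N. \<integral>x. exp (- real m * x) \<partial>\<mu> N) \<longlonglongrightarrow> (\<integral>x. exp (- real m * x) \<partial>chi_squared ?k)"
      by (simp only: tendsto_of_real_iff)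
  qed
  then show ?thesis unfolding \<mu>_def[abs_def] X_def[abs_def] .
qed

end
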